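(* Let $k\ge-\frac12$, let $M=(a,b;c,d)\in SL(2,\mathbb{R})$ with $b\ne0$, let $P$ be a non-constant polynomial in one variable (with complex coefficients), let $1\le p\le\infty$, and let $f\in\mathcal{S}(\mathbb{R})$. Set $$\Omega_{P,b}=\left\{\lambda\in\mathbb{R}: \left|P\left(\tfrac{\lambda}{b}\right)\right|\le 1\right\}.$$ Then the linear canonical Dunkl transform $\mathcal{D}_k^M(f)$ vanishes outside of $\Omega_{P,b}$ if and only if $$\limsup_{n\to\infty}\left\|P^n(-i\Lambda_{k,M^{-1}})f\right\|_{L^p_k(\mathbb{R})}^{1/n}\le 1.$$
   Context: $\mathcal{S}(\mathbb{R})$ is the Schwartz space of complex-valued functions on $\mathbb{R}$. $M=(a,b;c,d)$ denotes the $2\times2$ real matrix with rows $(a,b)$ and $(c,d)$, of determinant $1$; its inverse is $M^{-1}=(d,-b;-c,a)$. Measure and norms: $d\mu_k(x)=\frac{|x|^{2k+1}}{2^{k+1}\Gamma(k+1)}\,dx$ on $\mathbb{R}$. For $1\le p<\infty$, $\|f\|_{L^p_k(\mathbb{R})}=\left(\int_{\mathbb{R}}|f|^p\,d\mu_k\right)^{1/p}$; $\|f\|_{L^\infty_k(\mathbb{R})}=\operatorname{ess\,sup}_{x\in\mathbb{R}}|f(x)|$. Dunkl operator: $\Lambda_k f(x)=f'(x)+\frac{2k+1}{x}\cdot\frac{f(x)-f(-x)}{2}$ (extended continuously to $x=0$). Linear canonical Dunkl operator: $\Lambda_{k,M}f(x)=\Lambda_k f(x)-i\frac{d}{b}\,x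 f(x)$; hence for the matrix $M^{-1}$, $\Lambda_{k,M^{-1}}f(x)=\Lambda_kf(x)+i\frac{a}{b}\,xf(x)$. It maps $\mathcal{S}(\mathbb{R})$ into itself. For a polynomial $P$ and an operator $T$ on $\mathcal{S}(\mathbb{R})$, $P(T)$ is the usual polynomial in $T$ and $P^n(T)=(P(T))^n$. Dunkl kernel: for $\lambda,x\in\mathbb{R}$, $E_k(i\lambda,x)=j_k(\lambda x)+\frac{i\lambda x}{2(k+1)}j_{k+1}(\lambda x)$, where $j_\alpha(x)=\Gamma(\alpha+1)\sum_{n=0}^\infty\frac{(-1)^n(x/2)^{2n}}{n!\,\Gamma(n+\alpha+1)}$. Linear canonical Dunkl transform: for $f\in L^1_k(\mathbb{R})$, $$\mathcal{D}_k^M(f)(\lambda)=\frac{1}{(ib)^{k+1}}\int_{\mathbb{R}}f(x)\,E_k^M(\lambda,x)\,d\mu_k(x),\qquad E_k^M(\lambda,x)=e^{\frac{i}{2}\left(\frac{d}{b}\lambda^2+\frac{a}{b}x^2\right)}E_k(-i\lambda/b,x),$$ with $(ib)^{k+1}$ the principal power. It maps $\mathcal{S}(\mathbb{R})$ onto $\mathcal{S}(\mathbb{R})$. *)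

theory Defs
  imports
    "HOL-Probability.Essential_Supremum"
    "HOL-Analysis.Analysis"
    "HOL-Computational_Algebra.Polynomial"
begin

text \<open>Matrix entries are \<open>a = M $ 1 $ 1\<close>, \<open>b = M $ 1 $ 2\<close>, \<open>c = M $ 2 $ 1\<close>, \<open>d = M $ 2 $ 2\<close>.\<close>

definition real_deriv :: "(real \<Rightarrow> complex) \<Rightarrow> real \<Rightarrow> complex" where
  "real_deriv f x = vector_derivative f (at x)"

definition schwartz :: "(real \<Rightarrow> complex) set" where
  "schwartz = {f. (\<forall>n x. (real_deriv ^^ n) f differentiable (at x)) \<and>
     (\<forall>m n. bounded (range (\<lambda>x. of_real (x ^ m) * (real_deriv ^^ n) f x)))}"

text \<open>For \<open>k = -1/2\<close> the density below is \<open>0\<close> rather than \<open>1/sqrt (2 * pi)\<close> at the single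
  point \<open>x = 0\<close>, because \<open>0 powr 0 = 0\<close>; this does not change the measure.\<close>

definition dunkl_measure :: "real \<Rightarrow> real measure" where
  "dunkl_measure k = density lborel
     (\<lambda>x. ennreal (\<bar>x\<bar> powr (2 * k + 1) / (2 powr (k + 1) * Gamma (k + 1))))"

text \<open>Used for \<open>r > 0\<close> only.\<close>

definition ennreal_rpow :: "ennreal \<Rightarrow> real \<Rightarrow> ennreal" where
  "ennreal_rpow x r = (if x = \<infinity> then \<infinity> else ennreal (enn2real x powr r))"

definition Lp_norm :: "real \<Rightarrow> ennreal \<Rightarrow> (real \<Rightarrow> complex) \<Rightarrow> ennreal" where
  "Lp_norm k p f =
     (if p = \<infinity> then esssup (dunkl_measure k) (\<lambda>x. ennreal (norm (f x)))
      else ennreal_rpow (\<integral>\<^sup>+x. ennreal (norm (f x) powr enn2real p) \<partial>dunkl_measure k)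
             (1 / enn2real p))"

definition dunkl_quotient :: "real \<Rightarrow> (real \<Rightarrow> complex) \<Rightarrow> real \<Rightarrow> complex" where
  "dunkl_quotient k f x =
     real_deriv f x + of_real ((2 * k + 1) / x) * ((f x - f (- x)) / 2)"

definition dunkl_op :: "real \<Rightarrow> (real \<Rightarrow> complex) \<Rightarrow> real \<Rightarrow> complex" where
  "dunkl_op k f x =
     (if x = 0 then Lim (at 0) (dunkl_quotient k f) else dunkl_quotient k f x)"

definition lc_dunkl_op ::
    "real \<Rightarrow> real ^ 2 ^ 2 \<Rightarrow> (real \<Rightarrow> complex) \<Rightarrow> real \<Rightarrow> complex" where
  "lc_dunkl_op k M f x =
     dunkl_op k f x - \<i> * of_real (M $ 2 $ 2 / M $ 1 $ 2) * of_real x * f x"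

definition poly_op ::
    "complex poly \<Rightarrow> ((real \<Rightarrow> complex) \<Rightarrow> real \<Rightarrow> complex) \<Rightarrow> (real \<Rightarrow> complex) \<Rightarrow> real \<Rightarrow> complex" where
  "poly_op P T f x = (\<Sum>j\<le>degree P. coeff P j * (T ^^ j) f x)"

text \<open>The normalised spherical Bessel function \<open>j\<^sub>\<alpha>\<close>.\<close>

definition bessel_j :: "real \<Rightarrow> real \<Rightarrow> real" where
  "bessel_j \<alpha> x = Gamma (\<alpha> + 1) *
     (\<Sum>n. (- 1) ^ n * (x / 2) ^ (2 * n) / (fact n * Gamma (real n + \<alpha> + 1)))"

text \<open>\<open>dunkl_kernel k \<xi> x\<close> stands for \<open>E\<^sub>k(\<i>\<xi>, x)\<close>: the imaginary unit in the first argument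
  is implicit.\<close>

definition dunkl_kernel :: "real \<Rightarrow> real \<Rightarrow> real \<Rightarrow> complex" where
  "dunkl_kernel k \<xi> x = of_real (bessel_j k (\<xi> * x)) +
     \<i> * of_real (\<xi> * x / (2 * (k + 1)) * bessel_j (k + 1) (\<xi> * x))"

definition lc_dunkl_kernel :: "real \<Rightarrow> real ^ 2 ^ 2 \<Rightarrow> real \<Rightarrow> real \<Rightarrow> complex" where
  "lc_dunkl_kernel k M \<xi> x =
     exp (\<i> / 2 * of_real (M $ 2 $ 2 / M $ 1 $ 2 * \<xi>\<^sup>2 + M $ 1 $ 1 / M $ 1 $ 2 * x\<^sup>2)) *
     dunkl_kernel k (- \<xi> / M $ 1 $ 2) x"

definition lc_dunkl_transform ::
    "real \<Rightarrow> real ^ 2 ^ 2 \<Rightarrow> (real \<Rightarrow> complex) \<Rightarrow> real \<Rightarrow> complex" where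
  "lc_dunkl_transform k M f \<xi> =
     1 / (\<i> * of_real (M $ 1 $ 2)) powr of_real (k + 1) *
     (\<integral>x. f x * lc_dunkl_kernel k M \<xi> x \<partial>dunkl_measure k)"

definition Omega :: "complex poly \<Rightarrow> real \<Rightarrow> real set" where
  "Omega P b = {\<xi>. norm (poly P (of_real (\<xi> / b))) \<le> 1}"

end

theory Submission
  imports
    Defs
    "HOL-Probability.Sinc_Integral"
    "HOL-Real_Asymp.Real_Asymp"
begin

text \<open>
Multiplication by the chirp \<open>exp (\<i> a x\<^sup>2 / (2 b))\<close> has modulus 1, turns the linear canonical Dunkl operator
of \<open>M\<^sup>-\<^sup>1\<close> into the Dunkl operator \<open>\<Lambda>\<close> (\<open>lc_dunkl_op_conjugate\<close>), and turns the linear canonical transform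
at \<open>\<xi>\<close> into the Dunkl transform \<open>D\<close> at \<open>\<xi> / b\<close>, up to a nonzero factor. So the claim is one about \<open>D\<close>: with
\<open>u\<^sub>n = P(-\<i>\<Lambda>)\<^sup>n g\<close>, whose transform is \<open>P\<^sup>n \<cdot> D g\<close>, the function \<open>D g\<close> lives on \<open>{\<bar>P\<bar> \<le> 1}\<close> iff the norms of
\<open>u\<^sub>n\<close> grow subexponentially.

If \<open>D g\<close> lives on that set, compact as \<open>P\<close> is not constant, then each derivative of \<open>P\<^sup>n \<cdot> D g\<close> is bounded by a power of \<open>n\<close>
(\<open>Ck_in_power_mult\<close>). Since \<open>-\<i>\<Lambda>\<close> and multiplication by the variable are exchanged by \<open>D\<close>, smoothness of a
function of compact support becomes decay of its transform (\<open>dunkl_transform_decay\<close>). By inversion \<open>u\<^sub>n\<close> is such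
a transform, so it is at most a power of \<open>n\<close> times a fixed function that lies in every \<open>L\<^sup>p\<close>.

Conversely, suppose that \<open>D g\<close> is nonzero at a point where \<open>\<bar>P\<bar>\<close> exceeds 1. Integrate \<open>P\<^sup>n \<cdot> D g\<close> against
its complex conjugate, cut off by a bump \<open>\<eta>\<close> on which \<open>\<bar>P\<bar>\<close> is almost constant. The result is at least
a positive constant times \<open>(inf \<bar>P\<bar>)\<^sup>2\<^sup>n\<close>. By Fubini it is also the pairing of \<open>u\<^sub>n\<close> with the transform of
the cut-off function, which by the same two lemmas is at most \<open>(sup \<bar>P\<bar>)\<^sup>n\<close> times a power of \<open>n\<close>, with decay. Hence \<open>u\<^sub>n\<close> grows
exponentially, like \<open>(inf \<bar>P\<bar>)\<^sup>2\<^sup>n / (sup \<bar>P\<bar>)\<^sup>n\<close>, in any \<open>L\<^sup>p\<close>.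

The inversion theorem is algebraic. Up to a reflection \<open>D \<circ> D\<close> commutes with
multiplication by \<open>x\<close>; a Schwartz function is a multiple of the Gaussian plus \<open>(x - y)\<close> times a Schwartz
function; and the Gaussian is an eigenfunction of \<open>D\<close> (\<open>dunkl_inversion\<close>).
\<close>

section \<open>Smooth functions with growth conditions\<close>

text \<open>All growth classes of this development are instances: \<open>B\<close> is the class of rapidly decreasing, of slowly
increasing, of bounded or of all functions, and \<open>Ck_in B n f\<close> requires the derivatives up to order \<open>n\<close> to
lie in \<open>B\<close> and to be differentiable. Peeling off the first derivative makes the product rule an induction on
\<open>n\<close> that uses only how the classes multiply.\<close>

fun Ck_in :: "(real \<Rightarrow> complex) set \<Rightarrow> nat \<Rightarrow> (real \<Rightarrow> complex) \<Rightarrow> bool" where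
  "Ck_in B 0 f \<longleftrightarrow> f \<in> B \<and> (\<forall>x. f differentiable (at x))"
| "Ck_in B (Suc n) f \<longleftrightarrow> f \<in> B \<and> (\<forall>x. f differentiable (at x)) \<and> Ck_in B n (real_deriv f)"

definition smooth_in :: "(real \<Rightarrow> complex) set \<Rightarrow> (real \<Rightarrow> complex) set" where
  "smooth_in B = {f. \<forall>n. Ck_in B n f}"

abbreviation smooth :: "(real \<Rightarrow> complex) set" where
  "smooth \<equiv> smooth_in UNIV"

lemma real_deriv_works:
  "f differentiable (at x) \<Longrightarrow> (f has_vector_derivative real_deriv f x) (at x)"
  by (simp add: real_deriv_def vector_derivative_works)

lemma real_deriv_eqI:
  "(\<And>x. (f has_vector_derivative f' x) (at x)) \<Longrightarrow> real_deriv f = f'"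
  by (auto simp: real_deriv_def vector_derivative_at)

lemma Ck_in_base: "Ck_in B n f \<Longrightarrow> f \<in> B"
  by (cases n) auto

lemma Ck_in_0I:
  assumes "\<And>x. (f has_vector_derivative f' x) (at x)" "f \<in> B"
  shows "Ck_in B 0 f"
  using assms differentiableI_vector by fastforce

lemma Ck_in_SucI:
  assumes "\<And>x. (f has_vector_derivative f' x) (at x)" "f \<in> B" "Ck_in B n f'"
  shows "Ck_in B (Suc n) f"
proof -
  have "real_deriv f = f'" using assms(1) by (rule real_deriv_eqI)
  moreover have "f differentiable (at x)" for x
    using assms(1)[of x] by (rule differentiableI_vector)
  ultimately show ?thesis using assms by simp
qed

lemma Ck_in_lower: "Ck_in B (Suc n) f \<Longrightarrow> Ck_in B n f"
  by (induction n arbitrary: f) auto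

lemma Ck_in_mono: "Ck_in B n f \<Longrightarrow> B \<subseteq> C \<Longrightarrow> Ck_in C n f"
  by (induction n arbitrary: f) auto

lemma Ck_in_add:
  assumes "\<And>f g. f \<in> A \<Longrightarrow> g \<in> B \<Longrightarrow> (\<lambda>x. f x + g x) \<in> C"
  shows "Ck_in A n f \<Longrightarrow> Ck_in B n g \<Longrightarrow> Ck_in C n (\<lambda>x. f x + g x)"
proof (induction n arbitrary: f g)
  case 0
  show ?case
    by (rule Ck_in_0I[where f' = "\<lambda>x. real_deriv f x + real_deriv g x"])
       (use 0 assms in \<open>auto intro!: has_vector_derivative_add real_deriv_works\<close>)
next
  case (Suc n)
  show ?case
    by (rule Ck_in_SucI[where f' = "\<lambda>x. real_deriv f x + real_deriv g x"])
       (use Suc assms in \<open>auto intro!: has_vector_derivative_add real_deriv_works\<close>)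
qed

lemma Ck_in_mult:
  assumes mult: "\<And>f g. f \<in> A \<Longrightarrow> g \<in> B \<Longrightarrow> (\<lambda>x. f x * g x) \<in> C"
    and add: "\<And>f g. f \<in> C \<Longrightarrow> g \<in> C \<Longrightarrow> (\<lambda>x. f x + g x) \<in> C"
  shows "Ck_in A n f \<Longrightarrow> Ck_in B n g \<Longrightarrow> Ck_in C n (\<lambda>x. f x * g x)"
proof (induction n arbitrary: f g)
  case 0
  show ?case
    by (rule Ck_in_0I[where f' = "\<lambda>x. f x * real_deriv g x + real_deriv f x * g x"])
       (use 0 mult in \<open>auto intro!: has_vector_derivative_mult real_deriv_works\<close>)
next
  case (Suc n)
  have "Ck_in C n (\<lambda>x. f x * real_deriv g x + real_deriv f x * g x)"
    using Suc.IH[of f "real_deriv g"] Suc.IH[of "real_deriv f" g] Suc.prems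
      Ck_in_lower[of A n f] Ck_in_lower[of B n g]
    by (intro Ck_in_add[of C C C] add) auto
  then show ?case
    by (intro Ck_in_SucI[where f' = "\<lambda>x. f x * real_deriv g x + real_deriv f x * g x"])
       (use Suc mult in \<open>auto intro!: has_vector_derivative_mult real_deriv_works\<close>)
qed

lemma affine_has_vector_derivative:
  fixes f :: "real \<Rightarrow> complex"
  assumes "(f has_vector_derivative f') (at (\<alpha> * x + \<beta>))"
  shows "((\<lambda>x. c * f (\<alpha> * x + \<beta>)) has_vector_derivative (c * of_real \<alpha>) * f') (at x)"
proof -
  have "((f \<circ> (\<lambda>x. \<alpha> * x + \<beta>)) has_vector_derivative \<alpha> *\<^sub>R f') (at x)"
    by (rule vector_diff_chain_at)
       (use assms in \<open>auto intro!: derivative_eq_intros simp: has_real_derivative_iff_has_vector_derivative[symmetric]\<close>)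
  then show ?thesis
    using has_vector_derivative_mult_right[of "\<lambda>x. f (\<alpha> * x + \<beta>)" "\<alpha> *\<^sub>R f'" "at x" c]
    by (simp add: o_def scaleR_conv_of_real mult.assoc)
qed

text \<open>Each derivative multiplies the constant \<open>c\<close> by \<open>\<alpha>\<close>; the predicate \<open>Q\<close> records what is invariant under
this, for instance the modulus of \<open>c\<close> when \<open>\<alpha> = - 1\<close>.\<close>

lemma Ck_in_affine:
  assumes "\<And>f c. f \<in> B \<Longrightarrow> Q c \<Longrightarrow> (\<lambda>x. c * f (\<alpha> * x + \<beta>)) \<in> C"
    and "\<And>c. Q c \<Longrightarrow> Q (c * of_real \<alpha>)"
  shows "Ck_in B n f \<Longrightarrow> Q c \<Longrightarrow> Ck_in C n (\<lambda>x. c * f (\<alpha> * x + \<beta>))"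
proof (induction n arbitrary: f c)
  case 0
  have "((\<lambda>x. c * f (\<alpha> * x + \<beta>)) has_vector_derivative (c * of_real \<alpha>) * real_deriv f (\<alpha> * x + \<beta>)) (at x)" for x
    using 0 by (intro affine_has_vector_derivative real_deriv_works) simp
  then show ?case using 0 assms(1) by (intro Ck_in_0I) auto
next
  case (Suc n)
  have "((\<lambda>x. c * f (\<alpha> * x + \<beta>)) has_vector_derivative (c * of_real \<alpha>) * real_deriv f (\<alpha> * x + \<beta>)) (at x)" for x
    using Suc.prems by (intro affine_has_vector_derivative real_deriv_works) simp
  moreover have "Ck_in C n (\<lambda>x. (c * of_real \<alpha>) * real_deriv f (\<alpha> * x + \<beta>))"
    by (rule Suc.IH) (use Suc assms(2) in auto)
  ultimately show ?case using Suc assms(1) by (intro Ck_in_SucI) auto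
qed

lemma smooth_in_iff_funpow:
  "f \<in> smooth_in B \<longleftrightarrow>
    (\<forall>n. (real_deriv ^^ n) f \<in> B \<and> (\<forall>x. (real_deriv ^^ n) f differentiable (at x)))"
proof -
  have *: "Ck_in B n f \<longleftrightarrow> (\<forall>m\<le>n. (real_deriv ^^ m) f \<in> B \<and> (\<forall>x. (real_deriv ^^ m) f differentiable (at x)))" for n
  proof (induction n arbitrary: f)
    case (Suc n)
    have "(\<forall>m\<le>Suc n. Q m) \<longleftrightarrow> Q 0 \<and> (\<forall>m\<le>n. Q (Suc m))" for Q
      by (metis Suc_le_mono le0 old.nat.exhaust)
    then show ?case using Suc.IH by (auto simp: funpow_Suc_right simp del: funpow.simps(2))
  qed simp
  show ?thesis unfolding smooth_in_def mem_Collect_eq * by blast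
qed

lemma smooth_inD:
  assumes "f \<in> smooth_in B"
  shows "f \<in> B" "f differentiable (at x)" "real_deriv f \<in> smooth_in B"
    "(f has_vector_derivative real_deriv f x) (at x)" "continuous_on S f" "isCont f x"
proof -
  have *: "Ck_in B (Suc n) f" for n using assms unfolding smooth_in_def by blast
  show "f \<in> B" "f differentiable (at x)" using *[of 0] by simp_all
  have "Ck_in B n (real_deriv f)" for n using *[of n] by simp
  then show "real_deriv f \<in> smooth_in B" by (simp add: smooth_in_def)
  show "(f has_vector_derivative real_deriv f x) (at x)"
    using *[of 0] by (auto intro: real_deriv_works)
  have "isCont f x" for x using *[of 0] by (auto intro: differentiable_imp_continuous_within)
  then show "isCont f x" "continuous_on S f" by (auto intro: continuous_at_imp_continuous_on)
qed

text \<open>Smoothness by coinduction: a family closed under differentiation takes the place of formulas for the derivatives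
of order \<open>n\<close>.\<close>

lemma smooth_in_coinduct:
  assumes "f \<in> X" "X \<subseteq> B"
    and "\<And>f. f \<in> X \<Longrightarrow> \<exists>f'\<in>X. \<forall>x. (f has_vector_derivative f' x) (at x)"
  shows "f \<in> smooth_in B"
proof -
  have "\<forall>f\<in>X. Ck_in B n f" for n
  proof (induction n)
    case 0
    show ?case using assms(2,3) by (metis Ck_in_0I subsetD)
  next
    case (Suc n)
    show ?case using assms(2,3) Suc by (metis Ck_in_SucI subsetD)
  qed
  then show ?thesis using assms(1) by (auto simp: smooth_in_def)
qed

lemma smooth_in_mono: "f \<in> smooth_in B \<Longrightarrow> B \<subseteq> C \<Longrightarrow> f \<in> smooth_in C"
  unfolding smooth_in_def using Ck_in_mono by blast

lemma smooth_in_smooth: "f \<in> smooth_in B \<Longrightarrow> f \<in> smooth"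
  by (erule smooth_in_mono) simp

definition rapid :: "(real \<Rightarrow> complex) set" where
  "rapid = {f. \<forall>m. \<exists>C. \<forall>x. (1 + \<bar>x\<bar>) ^ m * norm (f x) \<le> C}"

definition slow :: "(real \<Rightarrow> complex) set" where
  "slow = {f. \<exists>m C. \<forall>x. norm (f x) \<le> C * (1 + \<bar>x\<bar>) ^ m}"

lemma one_plus_abs_power_le: "(1 + \<bar>x::real\<bar>) ^ m \<le> 2 ^ m * (1 + \<bar>x\<bar> ^ m)"
proof -
  have "(1 + \<bar>x\<bar>) ^ m \<le> (2 * max 1 \<bar>x\<bar>) ^ m" by (intro power_mono) auto
  also have "\<dots> = 2 ^ m * (max 1 \<bar>x\<bar>) ^ m" by (simp add: power_mult_distrib)
  also have "\<dots> \<le> 2 ^ m * (1 + \<bar>x\<bar> ^ m)" by (intro mult_left_mono) (auto simp: max_def)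
  finally show ?thesis .
qed

lemma rapid_iff:
  "f \<in> rapid \<longleftrightarrow> (\<forall>m. bounded (range (\<lambda>x. of_real (x ^ m) * f x)))"
proof (intro iffI allI)
  fix m assume "f \<in> rapid"
  then obtain C where C: "\<And>x. (1 + \<bar>x\<bar>) ^ m * norm (f x) \<le> C" unfolding rapid_def by blast
  have "norm (of_real (x ^ m) * f x) \<le> C" for x
  proof -
    have "norm (of_real (x ^ m) * f x) = \<bar>x\<bar> ^ m * norm (f x)" by (simp add: norm_mult norm_power)
    also have "\<dots> \<le> (1 + \<bar>x\<bar>) ^ m * norm (f x)" by (intro mult_right_mono power_mono) auto
    finally show ?thesis using C[of x] by simp
  qed
  then show "bounded (range (\<lambda>x. of_real (x ^ m) * f x))" by (intro boundedI) auto
next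
  assume a: "\<forall>m. bounded (range (\<lambda>x. of_real (x ^ m) * f x))"
  have "\<exists>C. \<forall>x. (1 + \<bar>x\<bar>) ^ m * norm (f x) \<le> C" for m
  proof -
    obtain C0 where C0: "\<And>x. norm (f x) \<le> C0"
      using spec[OF a, of 0] by (auto simp: bounded_iff)
    obtain C1 where C1: "\<And>x. norm (of_real (x ^ m) * f x) \<le> C1"
      using spec[OF a, of m] unfolding bounded_iff by (metis rangeI)
    have "(1 + \<bar>x\<bar>) ^ m * norm (f x) \<le> 2 ^ m * (C0 + C1)" for x
    proof -
      have "(1 + \<bar>x\<bar>) ^ m * norm (f x) \<le> (2 ^ m * (1 + \<bar>x\<bar> ^ m)) * norm (f x)"
        by (intro mult_right_mono one_plus_abs_power_le) auto
      also have "\<dots> = 2 ^ m * (norm (f x) + norm (of_real (x ^ m) * f x))"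
        by (simp add: norm_mult norm_power algebra_simps)
      also have "\<dots> \<le> 2 ^ m * (C0 + C1)" by (intro mult_left_mono add_mono C0 C1) auto
      finally show ?thesis .
    qed
    then show ?thesis by blast
  qed
  then show "f \<in> rapid" unfolding rapid_def by blast
qed

lemma schwartz_eq: "schwartz = smooth_in rapid"
  by (auto simp: schwartz_def smooth_in_iff_funpow rapid_iff)

lemma rapid_add: "f \<in> rapid \<Longrightarrow> g \<in> rapid \<Longrightarrow> (\<lambda>x. f x + g x) \<in> rapid"
  unfolding rapid_def
proof (safe)
  fix m
  assume "\<forall>m. \<exists>C. \<forall>x. (1 + \<bar>x\<bar>) ^ m * norm (f x) \<le> C" "\<forall>m. \<exists>C. \<forall>x. (1 + \<bar>x\<bar>) ^ m * norm (g x) \<le> C"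
  then obtain C D where "\<And>x. (1 + \<bar>x\<bar>) ^ m * norm (f x) \<le> C" "\<And>x. (1 + \<bar>x\<bar>) ^ m * norm (g x) \<le> D" by metis
  moreover have "(1 + \<bar>x\<bar>) ^ m * norm (f x + g x) \<le> (1 + \<bar>x\<bar>) ^ m * (norm (f x) + norm (g x))" for x
    by (intro mult_left_mono norm_triangle_ineq) auto
  ultimately have "(1 + \<bar>x\<bar>) ^ m * norm (f x + g x) \<le> C + D" for x
    by (smt (verit) distrib_left)
  then show "\<exists>C. \<forall>x. (1 + \<bar>x\<bar>) ^ m * norm (f x + g x) \<le> C" by blast
qed

lemma slow_rapid_mult: "f \<in> slow \<Longrightarrow> g \<in> rapid \<Longrightarrow> (\<lambda>x. f x * g x) \<in> rapid"
  unfolding rapid_def slow_def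
proof (safe)
  fix m j C
  assume f: "\<forall>x. norm (f x) \<le> C * (1 + \<bar>x\<bar>) ^ j" and "\<forall>m. \<exists>C. \<forall>x. (1 + \<bar>x\<bar>) ^ m * norm (g x) \<le> C"
  then obtain D where D: "\<And>x. (1 + \<bar>x\<bar>) ^ (j + m) * norm (g x) \<le> D" by metis
  have "0 \<le> C" using order_trans[OF norm_ge_zero f[rule_format, of 0]] by simp
  have "(1 + \<bar>x\<bar>) ^ m * norm (f x * g x) \<le> C * D" for x
  proof -
    have "(1 + \<bar>x\<bar>) ^ m * norm (f x * g x) = norm (f x) * ((1 + \<bar>x\<bar>) ^ m * norm (g x))"
      by (simp add: norm_mult)
    also have "\<dots> \<le> (C * (1 + \<bar>x\<bar>) ^ j) * ((1 + \<bar>x\<bar>) ^ m * norm (g x))"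
      by (intro mult_right_mono) (use f in auto)
    also have "\<dots> = C * ((1 + \<bar>x\<bar>) ^ (j + m) * norm (g x))" by (simp add: power_add)
    also have "\<dots> \<le> C * D" by (intro mult_left_mono D \<open>0 \<le> C\<close>)
    finally show ?thesis .
  qed
  then show "\<exists>C. \<forall>x. (1 + \<bar>x\<bar>) ^ m * norm (f x * g x) \<le> C" by blast
qed

lemma bounded_slow: assumes "\<And>x. norm (f x) \<le> C" shows "f \<in> slow"
proof -
  have "\<forall>x. norm (f x) \<le> C * (1 + \<bar>x\<bar>) ^ 0" using assms by simp
  then show ?thesis unfolding slow_def by blast
qed

lemma const_slow: "(\<lambda>x. c) \<in> slow"
  by (rule bounded_slow[of _ "norm c"]) auto

lemma slow_add:
  assumes "f \<in> slow" "g \<in> slow" shows "(\<lambda>x. f x + g x) \<in> slow"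
proof -
  from assms obtain m C n D where C: "\<And>x. norm (f x) \<le> C * (1 + \<bar>x\<bar>) ^ m" and D: "\<And>x. norm (g x) \<le> D * (1 + \<bar>x\<bar>) ^ n"
    unfolding slow_def by blast
  have nn: "0 \<le> C" "0 \<le> D"
    using order_trans[OF norm_ge_zero C[of 0]] order_trans[OF norm_ge_zero D[of 0]] by auto
  have "norm (f x + g x) \<le> (C + D) * (1 + \<bar>x\<bar>) ^ (m + n)" for x
  proof -
    have "C * (1 + \<bar>x\<bar>) ^ m \<le> C * (1 + \<bar>x\<bar>) ^ (m + n)" "D * (1 + \<bar>x\<bar>) ^ n \<le> D * (1 + \<bar>x\<bar>) ^ (m + n)"
      using nn by (auto intro!: mult_left_mono power_increasing)
    then show ?thesis using C[of x] D[of x] norm_triangle_ineq[of "f x" "g x"] by (simp add: distrib_right)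
  qed
  then show ?thesis unfolding slow_def by blast
qed

lemma slow_mult:
  assumes "f \<in> slow" "g \<in> slow" shows "(\<lambda>x. f x * g x) \<in> slow"
proof -
  from assms obtain m C n D where C: "\<And>x. norm (f x) \<le> C * (1 + \<bar>x\<bar>) ^ m" and D: "\<And>x. norm (g x) \<le> D * (1 + \<bar>x\<bar>) ^ n"
    unfolding slow_def by blast
  have "norm (f x * g x) \<le> (C * D) * (1 + \<bar>x\<bar>) ^ (m + n)" for x
  proof -
    have "norm (f x * g x) \<le> (C * (1 + \<bar>x\<bar>) ^ m) * (D * (1 + \<bar>x\<bar>) ^ n)"
      unfolding norm_mult by (intro mult_mono C D order_trans[OF norm_ge_zero C]) auto
    then show ?thesis by (simp add: power_add algebra_simps)
  qed
  then show ?thesis unfolding slow_def by blast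
qed

lemma smooth_in_add:
  assumes "\<And>f g. f \<in> B \<Longrightarrow> g \<in> B \<Longrightarrow> (\<lambda>x. f x + g x) \<in> B" "f \<in> smooth_in B" "g \<in> smooth_in B"
  shows "(\<lambda>x. f x + g x) \<in> smooth_in B"
  using assms Ck_in_add[of B B B] by (auto simp: smooth_in_def)

lemma smooth_in_mult:
  assumes "\<And>f g. f \<in> A \<Longrightarrow> g \<in> B \<Longrightarrow> (\<lambda>x. f x * g x) \<in> B"
    "\<And>f g. f \<in> B \<Longrightarrow> g \<in> B \<Longrightarrow> (\<lambda>x. f x + g x) \<in> B" "f \<in> smooth_in A" "g \<in> smooth_in B"
  shows "(\<lambda>x. f x * g x) \<in> smooth_in B"
  using assms Ck_in_mult[of A B B] by (auto simp: smooth_in_def)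

lemmas smooth_add = smooth_in_add[of UNIV, simplified]
lemmas smooth_mult = smooth_in_mult[of UNIV UNIV, simplified]
lemma schwartz_add:
  "f \<in> schwartz \<Longrightarrow> g \<in> schwartz \<Longrightarrow> (\<lambda>x. f x + g x) \<in> schwartz"
  unfolding schwartz_eq by (rule smooth_in_add) (auto intro: rapid_add)

lemma schwartz_mult:
  "f \<in> smooth_in slow \<Longrightarrow> g \<in> schwartz \<Longrightarrow> (\<lambda>x. f x * g x) \<in> schwartz"
  unfolding schwartz_eq by (rule smooth_in_mult[of slow]) (auto intro: slow_rapid_mult rapid_add)

lemma schwartz_smooth: "f \<in> schwartz \<Longrightarrow> f \<in> smooth"
  unfolding schwartz_eq by (rule smooth_in_smooth)

lemma poly_slow: "(\<lambda>x::real. poly p (of_real x :: complex)) \<in> slow"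
proof (induction p)
  case 0
  then show ?case by (auto simp: slow_def intro!: exI[of _ 0])
next
  case (pCons a p)
  have "(\<lambda>x. of_real x) \<in> slow" unfolding slow_def by (auto intro!: exI[of _ 1])
  then show ?case by (auto intro!: slow_add slow_mult const_slow pCons)
qed

lemma poly_chirp_has_derivative:
  "((\<lambda>x. poly p (of_real x) * exp (c * (of_real x)\<^sup>2)) has_vector_derivative
    poly (pderiv p + [:0, 2 * c:] * p) (of_real x) * exp (c * (of_real x)\<^sup>2)) (at x)"
  for c :: complex
proof -
  have "((\<lambda>z. poly p z * exp (c * z\<^sup>2)) has_field_derivative
    poly (pderiv p + [:0, 2 * c:] * p) (of_real x) * exp (c * (of_real x)\<^sup>2)) (at (of_real x))"
    by (auto intro!: derivative_eq_intros poly_DERIV simp: algebra_simps)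
  then show ?thesis by (rule has_vector_derivative_real_field)
qed

lemma smooth_in_poly_chirp:
  assumes "\<And>p. (\<lambda>x::real. poly p (of_real x) * exp (c * (of_real x)\<^sup>2)) \<in> B"
  shows "(\<lambda>x. poly p (of_real x) * exp (c * (of_real x)\<^sup>2)) \<in> smooth_in B"
proof -
  let ?X = "range (\<lambda>p (x::real). poly p (of_real x) * exp (c * (of_real x)\<^sup>2))"
  show ?thesis
  proof (rule smooth_in_coinduct[where X = "?X"])
    show "?X \<subseteq> B"
      using assms by auto
    show "\<exists>f'\<in>?X. \<forall>x. (f has_vector_derivative f' x) (at x)"
      if f: "f \<in> ?X" for f
    proof -
      obtain p where p: "f = (\<lambda>x. poly p (of_real x) * exp (c * (of_real x)\<^sup>2))" using f by blast
      show ?thesis unfolding p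
        by (rule bexI[where x = "\<lambda>x. poly (pderiv p + [:0, 2 * c:] * p) (of_real x) * exp (c * (of_real x)\<^sup>2)"])
           (intro allI poly_chirp_has_derivative, blast)
    qed
  qed auto
qed

lemma poly_smooth_slow: "(\<lambda>x. poly p (of_real x)) \<in> smooth_in slow"
  using smooth_in_poly_chirp[of 0 slow p] poly_slow by auto

lemma chirp_smooth_slow: "(\<lambda>x. exp (\<i> * of_real (c * x\<^sup>2))) \<in> smooth_in slow"
proof -
  have "(\<lambda>x. exp (\<i> * of_real c * (of_real x)\<^sup>2)) \<in> slow"
    by (rule bounded_slow[of _ 1]) (auto simp: norm_exp_eq_Re power2_eq_square)
  then have "(\<lambda>x. poly 1 (of_real x) * exp (\<i> * of_real c * (of_real x)\<^sup>2)) \<in> smooth_in slow"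
    by (intro smooth_in_poly_chirp slow_mult poly_slow)
  then show ?thesis by (simp add: mult.assoc)
qed

lemma exp_ge_power: "0 \<le> t \<Longrightarrow> t ^ m \<le> fact m * exp (t :: real)"
proof -
  assume t: "0 \<le> t"
  have "(\<Sum>i\<in>{m}. t ^ i /\<^sub>R fact i) \<le> (\<Sum>i. t ^ i /\<^sub>R fact i)"
    using t by (intro sum_le_suminf summable_exp_generic) auto
  then have "t ^ m / fact m \<le> exp t" by (simp add: exp_def divide_inverse mult.commute)
  then show ?thesis by (simp add: divide_le_eq mult.commute)
qed

definition gaussian :: "real \<Rightarrow> complex" where "gaussian x = exp (- (of_real x)\<^sup>2 / 2)"

lemma gaussian_rapid: "gaussian \<in> rapid"
proof -
  have "\<exists>C. \<forall>x. (1 + \<bar>x\<bar>) ^ m * norm (gaussian x) \<le> C" for m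
  proof (intro exI allI)
    fix x :: real
    have "(1 + \<bar>x\<bar>) ^ m * exp (- x\<^sup>2 / 2) \<le> (fact m * exp (1 + \<bar>x\<bar>)) * exp (- x\<^sup>2 / 2)"
      by (intro mult_right_mono exp_ge_power) auto
    also have "\<dots> = fact m * exp (1 + \<bar>x\<bar> - x\<^sup>2 / 2)" by (simp add: exp_add[symmetric])
    also have "\<dots> \<le> fact m * exp 2"
    proof -
      have "0 \<le> (1 - \<bar>x\<bar>)\<^sup>2" by simp
      then have "1 + \<bar>x\<bar> - x\<^sup>2 / 2 \<le> 2" by (simp add: power2_eq_square algebra_simps)
      then show ?thesis by simp
    qed
    finally show "(1 + \<bar>x\<bar>) ^ m * norm (gaussian x) \<le> fact m * exp 2"
      by (simp add: gaussian_def norm_exp_eq_Re power2_eq_square)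
  qed
  then show ?thesis by (simp add: rapid_def)
qed

lemma gaussian_schwartz: "gaussian \<in> schwartz"
proof -
  have "(\<lambda>x. poly 1 (of_real x) * exp ((-1/2) * (of_real x)\<^sup>2)) \<in> smooth_in rapid"
    using slow_rapid_mult[OF poly_slow gaussian_rapid]
    by (intro smooth_in_poly_chirp) (simp add: gaussian_def)
  then show ?thesis by (simp add: schwartz_eq gaussian_def[abs_def])
qed

lemma const_smooth_slow: "(\<lambda>x. c) \<in> smooth_in slow"
  using poly_smooth_slow[of "[:c:]"] by simp

lemma schwartz_cmult: "f \<in> schwartz \<Longrightarrow> (\<lambda>x. c * f x) \<in> schwartz"
  by (rule schwartz_mult[OF const_smooth_slow])

lemma schwartz_x_mult: "f \<in> schwartz \<Longrightarrow> (\<lambda>x. of_real x * f x) \<in> schwartz"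
  using schwartz_mult[OF poly_smooth_slow[of "[:0, 1:]"]] by simp

lemma smooth_cmult: "f \<in> smooth \<Longrightarrow> (\<lambda>x. c * f x) \<in> smooth"
  by (rule smooth_mult[OF smooth_in_smooth[OF const_smooth_slow]])

lemma smooth_affine: "f \<in> smooth \<Longrightarrow> (\<lambda>x. f (\<alpha> * x + \<beta>)) \<in> smooth"
  using Ck_in_affine[of UNIV "\<lambda>_. True" \<alpha> \<beta> UNIV _ f 1] by (auto simp: smooth_in_def)

lemma smooth_reflect: "f \<in> smooth \<Longrightarrow> (\<lambda>x. f (- x)) \<in> smooth"
  using smooth_affine[of f "-1" 0] by simp

lemma schwartz_reflect: "f \<in> schwartz \<Longrightarrow> (\<lambda>x. f (- x)) \<in> schwartz"
proof -
  have "(\<lambda>x. c * f (- x)) \<in> rapid" if "f \<in> rapid" for c f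
  proof -
    have "(\<lambda>x. f (- x)) \<in> rapid" using that unfolding rapid_def
      by (auto) (metis abs_minus_cancel)
    then show ?thesis by (rule slow_rapid_mult[OF const_slow])
  qed
  then show "f \<in> schwartz \<Longrightarrow> (\<lambda>x. f (- x)) \<in> schwartz"
    using Ck_in_affine[of rapid "\<lambda>_. True" "-1" 0 rapid _ f 1] by (auto simp: smooth_in_def schwartz_eq)
qed

section \<open>Division by a linear factor\<close>

text \<open>For \<open>m = 0\<close> and the derivative of \<open>f\<close> in place of \<open>f\<close> this is the integral formula for
\<open>(f x - f y) / (x - y)\<close>, which is smooth across \<open>x = y\<close>. Differentiation in \<open>x\<close> raises the exponent \<open>m\<close>.\<close>

definition segment_avg :: "nat \<Rightarrow> real \<Rightarrow> (real \<Rightarrow> complex) \<Rightarrow> real \<Rightarrow> complex" where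
  "segment_avg m y f x = integral {0..1} (\<lambda>t. of_real (t ^ m) * f (y + t * (x - y)))"

lemma segment_avg_integrable:
  assumes "f \<in> smooth"
  shows "(\<lambda>t. of_real (t ^ m) * f (y + t * (x - y))) integrable_on {0..1}"
  by (intro integrable_continuous_real continuous_intros continuous_on_compose2[OF smooth_inD(5)[OF assms, of UNIV]]) auto

lemma segment_avg_has_vector_derivative:
  assumes "f \<in> smooth"
  shows "(segment_avg m y f has_vector_derivative segment_avg (Suc m) y (real_deriv f) x) (at x)"
proof -
  have "((\<lambda>x. integral (cbox 0 1) (\<lambda>t. of_real (t ^ m) * f (y + t * (x - y)))) has_vector_derivative
     integral (cbox 0 1) (\<lambda>t. of_real (t ^ Suc m) * real_deriv f (y + t * (x - y)))) (at x within UNIV)"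
  proof (rule leibniz_rule_vector_derivative)
    fix x t :: real
    have "((f \<circ> (\<lambda>x. y + t * (x - y))) has_vector_derivative t *\<^sub>R real_deriv f (y + t * (x - y))) (at x)"
      by (rule vector_diff_chain_at)
         (use smooth_inD(4)[OF assms] in \<open>auto intro!: derivative_eq_intros simp: has_real_derivative_iff_has_vector_derivative[symmetric]\<close>)
    then show "((\<lambda>x. of_real (t ^ m) * f (y + t * (x - y))) has_vector_derivative
        of_real (t ^ Suc m) * real_deriv f (y + t * (x - y))) (at x within UNIV)"
      using has_vector_derivative_mult_right[of "\<lambda>x. f (y + t * (x - y))"
          "of_real t * real_deriv f (y + t * (x - y))" _ "of_real (t ^ m)"]
      by (simp add: o_def scaleR_conv_of_real mult.assoc mult.left_commute)
  next
    show "(\<lambda>t. of_real (t ^ m) * f (y + t * (x - y))) integrable_on cbox 0 1" for x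
      using segment_avg_integrable[OF assms] by simp
  next
    show "continuous_on (UNIV \<times> cbox 0 1) (\<lambda>(x, t). of_real (t ^ Suc m) * real_deriv f (y + t * (x - y)))"
      unfolding split_beta
      by (intro continuous_intros continuous_on_compose2[OF smooth_inD(5)[OF smooth_inD(3)[OF assms], of UNIV]]) auto
  qed auto
  then show ?thesis by (simp add: segment_avg_def[abs_def])
qed

lemma segment_avg_smooth:
  assumes "f \<in> smooth" shows "segment_avg m y f \<in> smooth"
proof (rule smooth_in_coinduct[where X = "{segment_avg m y f |m f. f \<in> smooth}"])
  show "\<exists>f'\<in>{segment_avg m y f |m f. f \<in> smooth}. \<forall>x. (g has_vector_derivative f' x) (at x)"
    if g: "g \<in> {segment_avg m y f |m f. f \<in> smooth}" for g
  proof -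
    obtain m f where "g = segment_avg m y f" "f \<in> smooth" using g by auto
    then show ?thesis
      by (intro bexI[of _ "segment_avg (Suc m) y (real_deriv f)"]) (auto intro: segment_avg_has_vector_derivative smooth_inD)
  qed
qed (use assms in auto)

definition bounded_by :: "real \<Rightarrow> (real \<Rightarrow> complex) set" where
  "bounded_by C = {f. \<forall>x. norm (f x) \<le> C}"

lemma segment_avg_bounded_by:
  assumes "f \<in> smooth" "f \<in> bounded_by C"
  shows "segment_avg m y f \<in> bounded_by C"
proof -
  have "norm (segment_avg m y f x) \<le> C" for x
  proof -
    have "norm (integral {0..1} (\<lambda>t. of_real (t ^ m) * f (y + t * (x - y)))) \<le> integral {0..1} (\<lambda>t::real. C)"
    proof (rule integral_norm_bound_integral)
      fix t :: real assume t: "t \<in> {0..1}"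
      have "norm (of_real (t ^ m) * f (y + t * (x - y))) \<le> 1 * norm (f (y + t * (x - y)))"
        unfolding norm_mult using t by (intro mult_right_mono) (auto simp: norm_power power_le_one)
      then show "norm (of_real (t ^ m) * f (y + t * (x - y))) \<le> C"
        using assms(2) unfolding bounded_by_def by (metis (mono_tags, lifting) mem_Collect_eq mult_1 order_trans)
    qed (use segment_avg_integrable[OF assms(1)] in auto)
    then show ?thesis by (simp add: segment_avg_def)
  qed
  then show ?thesis by (simp add: bounded_by_def)
qed

lemma Ck_in_segment_avg:
  assumes "f \<in> smooth" "Ck_in (bounded_by C) n f"
  shows "Ck_in (bounded_by C) n (segment_avg m y f)"
  using assms
proof (induction n arbitrary: f m)
  case 0
  show ?case by (rule Ck_in_0I, rule segment_avg_has_vector_derivative) (use 0 segment_avg_bounded_by in auto)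
next
  case (Suc n)
  show ?case
    by (rule Ck_in_SucI, rule segment_avg_has_vector_derivative)
       (use Suc.prems in \<open>auto intro!: segment_avg_bounded_by Suc.IH smooth_inD(3)\<close>)
qed

lemma segment_avg_quotient:
  assumes "f \<in> smooth"
  shows "of_real (x - y) * segment_avg 0 y (real_deriv f) x = f x - f y"
proof -
  have "((\<lambda>t. (x - y) *\<^sub>R real_deriv f (y + t * (x - y))) has_integral f (y + 1 * (x - y)) - f (y + 0 * (x - y))) {0..1}"
  proof (rule fundamental_theorem_of_calculus)
    fix t :: real
    have "((f \<circ> (\<lambda>t. y + t * (x - y))) has_vector_derivative (x - y) *\<^sub>R real_deriv f (y + t * (x - y))) (at t)"
      by (rule vector_diff_chain_at)
         (use smooth_inD(4)[OF assms] in \<open>auto intro!: derivative_eq_intros simp: has_real_derivative_iff_has_vector_derivative[symmetric]\<close>)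
    then show "((\<lambda>t. f (y + t * (x - y))) has_vector_derivative (x - y) *\<^sub>R real_deriv f (y + t * (x - y))) (at t within {0..1})"
      unfolding o_def by (rule has_vector_derivative_at_within)
  qed auto
  then show ?thesis
    by (auto simp: segment_avg_def scaleR_conv_of_real dest!: integral_unique)
qed

lemma segment_avg_at_center: "segment_avg 0 y f y = f y"
  by (simp add: segment_avg_def)

text \<open>Away from \<open>y\<close> the factor \<open>x - y\<close> is harmless; near \<open>y\<close> continuity gives a bound.\<close>

lemma continuous_rapidI:
  assumes "continuous_on UNIV h" "(\<lambda>x. of_real (x - y) * h x) \<in> rapid"
  shows "h \<in> rapid"
proof -
  have "\<exists>C. \<forall>x. (1 + \<bar>x\<bar>) ^ m * norm (h x) \<le> C" for m
  proof -
    obtain C where C: "\<And>x. (1 + \<bar>x\<bar>) ^ m * norm (of_real (x - y) * h x) \<le> C"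
      using assms(2) unfolding rapid_def by blast
    have "compact ((\<lambda>x. of_real ((1 + \<bar>x\<bar>) ^ m) * h x) ` cball y 1)"
      by (intro compact_continuous_image continuous_intros continuous_on_subset[OF assms(1)]) auto
    then obtain D where D: "\<And>x. x \<in> cball y 1 \<Longrightarrow> norm (of_real ((1 + \<bar>x\<bar>) ^ m) * h x) \<le> D"
      by (meson bounded_iff compact_imp_bounded imageI)
    have "(1 + \<bar>x\<bar>) ^ m * norm (h x) \<le> max C D" for x
    proof (cases "x \<in> cball y 1")
      case True
      have "norm (of_real ((1 + \<bar>x\<bar>) ^ m) * h x) = (1 + \<bar>x\<bar>) ^ m * norm (h x)"
        by (simp only: norm_mult norm_of_real) simp
      then show ?thesis using D[OF True] by simp
    next
      case False
      then have "1 * ((1 + \<bar>x\<bar>) ^ m * norm (h x)) \<le> \<bar>x - y\<bar> * ((1 + \<bar>x\<bar>) ^ m * norm (h x))"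
        by (intro mult_right_mono) (auto simp: dist_real_def)
      also have "\<dots> = (1 + \<bar>x\<bar>) ^ m * norm (of_real (x - y) * h x)"
        by (simp only: norm_mult norm_of_real mult.left_commute)
      finally show ?thesis using C[of x] unfolding mult_1 by linarith
    qed
    then show ?thesis by blast
  qed
  then show ?thesis by (simp add: rapid_def)
qed

text \<open>From \<open>(x - y) h' = f' - h\<close>, decay passes from \<open>f'\<close> and \<open>h\<close> to \<open>h'\<close>.\<close>

lemma Ck_in_rapid_divide:
  assumes "Ck_in rapid n f" "h \<in> smooth" "\<And>x. f x = of_real (x - y) * h x"
  shows "Ck_in rapid n h"
  using assms
proof (induction n arbitrary: f h)
  case 0
  have "(\<lambda>x. of_real (x - y) * h x) \<in> rapid"
    using Ck_in_base[OF 0(1)] unfolding ext[OF 0(3)] .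
  then have "h \<in> rapid"
    by (rule continuous_rapidI[OF smooth_inD(5)[OF 0(2)]])
  then show ?case using smooth_inD(4)[OF 0(2)] by (intro Ck_in_0I)
next
  case (Suc n)
  have h: "Ck_in rapid n h" by (rule Suc.IH[OF Ck_in_lower[OF Suc.prems(1)] Suc.prems(2,3)])
  have "(f has_vector_derivative of_real (x - y) * real_deriv h x + 1 * h x) (at x)" for x
    unfolding ext[OF Suc.prems(3)]
    by (intro has_vector_derivative_mult smooth_inD(4)[OF Suc.prems(2)])
       (auto intro!: derivative_eq_intros)
  then have f': "real_deriv f = (\<lambda>x. of_real (x - y) * real_deriv h x + 1 * h x)"
    by (rule real_deriv_eqI)
  have "Ck_in rapid n (\<lambda>x. real_deriv f x + (-1) * h x)"
  proof (intro Ck_in_add[of rapid rapid rapid] rapid_add)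
    show "Ck_in rapid n (\<lambda>x. - 1 * h x)"
      by (rule Ck_in_mult[OF slow_rapid_mult rapid_add _ h])
         (use const_smooth_slow in \<open>auto simp: smooth_in_def\<close>)
  qed (use Suc.prems(1) in auto)
  then have "Ck_in rapid n (real_deriv h)"
    by (rule Suc.IH) (use f' smooth_inD(3)[OF Suc.prems(2)] in auto)
  then show ?case
    using Ck_in_base[OF h] smooth_inD(4)[OF Suc.prems(2)] by (intro Ck_in_SucI)
qed

lemma schwartz_divide:
  assumes "h \<in> smooth" "(\<lambda>x. of_real (x - y) * h x) \<in> schwartz"
  shows "h \<in> schwartz"
  using assms Ck_in_rapid_divide[of _ _ h y] unfolding schwartz_eq smooth_in_def by blast

section \<open>The Dunkl operator on smooth functions\<close>

definition odd_part :: "(real \<Rightarrow> complex) \<Rightarrow> real \<Rightarrow> complex" where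
  "odd_part f x = (f x - f (- x)) / 2"

text \<open>The quotient \<open>(f x - f (- x)) / (2 x)\<close>, extended smoothly to \<open>x = 0\<close>.\<close>

definition dunkl_diff :: "(real \<Rightarrow> complex) \<Rightarrow> real \<Rightarrow> complex" where
  "dunkl_diff f = segment_avg 0 0 (real_deriv (odd_part f))"

lemma odd_part_smooth:
  assumes "f \<in> smooth" shows "odd_part f \<in> smooth"
proof -
  have "(\<lambda>x. (1/2) * f x + (-1/2) * f (- x)) \<in> smooth"
    by (intro smooth_add smooth_cmult assms smooth_reflect)
  then show ?thesis by (simp add: odd_part_def[abs_def] diff_divide_distrib)
qed

lemma odd_part_schwartz:
  assumes "f \<in> schwartz" shows "odd_part f \<in> schwartz"
proof -
  have "(\<lambda>x. (1/2) * f x + (-1/2) * f (- x)) \<in> schwartz"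
    by (intro schwartz_add schwartz_cmult assms schwartz_reflect)
  then show ?thesis by (simp add: odd_part_def[abs_def] diff_divide_distrib)
qed

lemma dunkl_diff_smooth: "f \<in> smooth \<Longrightarrow> dunkl_diff f \<in> smooth"
  unfolding dunkl_diff_def by (intro segment_avg_smooth smooth_inD(3) odd_part_smooth)

lemma dunkl_diff_mult:
  assumes "f \<in> smooth" shows "of_real x * dunkl_diff f x = odd_part f x"
  using segment_avg_quotient[OF odd_part_smooth[OF assms], of x 0] by (simp add: dunkl_diff_def odd_part_def)

lemma has_vector_derivative_reflect:
  fixes f :: "real \<Rightarrow> complex"
  assumes "(f has_vector_derivative f') (at (- x))"
  shows "((\<lambda>x. f (- x)) has_vector_derivative - f') (at x)"
  using affine_has_vector_derivative[of f f' "-1" x 0 1] assms by simp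

lemma real_deriv_odd_part:
  assumes "f \<in> smooth"
  shows "real_deriv (odd_part f) = (\<lambda>x. (real_deriv f x + real_deriv f (- x)) / 2)"
proof (rule real_deriv_eqI)
  fix x
  have "((\<lambda>x. (f x - f (- x)) / 2) has_vector_derivative (real_deriv f x - (- real_deriv f (- x))) / 2) (at x)"
    by (intro has_vector_derivative_divide has_vector_derivative_diff has_vector_derivative_reflect
        smooth_inD(4)[OF assms])
  then show "(odd_part f has_vector_derivative (real_deriv f x + real_deriv f (- x)) / 2) (at x)"
    by (simp add: odd_part_def[abs_def])
qed

lemma dunkl_diff_0:
  assumes "f \<in> smooth" shows "dunkl_diff f 0 = real_deriv f 0"
  by (simp add: dunkl_diff_def segment_avg_at_center real_deriv_odd_part[OF assms])

lemma dunkl_diff_schwartz: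
  assumes "f \<in> schwartz" shows "dunkl_diff f \<in> schwartz"
proof (rule schwartz_divide[of _ 0])
  show "dunkl_diff f \<in> smooth" by (intro dunkl_diff_smooth schwartz_smooth assms)
  show "(\<lambda>x. of_real (x - 0) * dunkl_diff f x) \<in> schwartz"
    using odd_part_schwartz[OF assms] by (simp add: dunkl_diff_mult[OF schwartz_smooth[OF assms]] eta_contract_eq)
qed

text \<open>The right-hand side is continuous and agrees with the quotient away from the origin, so the limit that defines
the Dunkl operator at the origin exists.\<close>

lemma dunkl_op_eq:
  assumes "f \<in> smooth"
  shows "dunkl_op k f = (\<lambda>x. real_deriv f x + of_real (2 * k + 1) * dunkl_diff f x)"
proof
  fix x
  have eq: "dunkl_quotient k f x = real_deriv f x + of_real (2 * k + 1) * dunkl_diff f x" if "x \<noteq> 0" for x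
  proof -
    have "dunkl_diff f x = odd_part f x / of_real x"
      using dunkl_diff_mult[OF assms, of x] that by (simp add: field_simps)
    then show ?thesis by (simp add: dunkl_quotient_def odd_part_def)
  qed
  show "dunkl_op k f x = real_deriv f x + of_real (2 * k + 1) * dunkl_diff f x"
  proof (cases "x = 0")
    case True
    have "((\<lambda>x. real_deriv f x + of_real (2 * k + 1) * dunkl_diff f x) \<longlongrightarrow>
        real_deriv f 0 + of_real (2 * k + 1) * dunkl_diff f 0) (at 0)"
      by (intro tendsto_intros isContD smooth_inD(6)[of _ UNIV] dunkl_diff_smooth smooth_inD(3) assms)
    moreover have "\<forall>\<^sub>F x in at 0. real_deriv f x + of_real (2 * k + 1) * dunkl_diff f x = dunkl_quotient k f x"
      using eq by (auto simp: eventually_at_filter)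
    ultimately have "(dunkl_quotient k f \<longlongrightarrow> real_deriv f 0 + of_real (2 * k + 1) * dunkl_diff f 0) (at 0)"
      by (rule Lim_transform_eventually)
    then show ?thesis using True by (simp add: dunkl_op_def tendsto_Lim)
  qed (simp add: dunkl_op_def eq)
qed

lemma dunkl_op_smooth: "f \<in> smooth \<Longrightarrow> dunkl_op k f \<in> smooth"
  by (simp add: dunkl_op_eq smooth_add smooth_cmult dunkl_diff_smooth smooth_inD(3))

lemma dunkl_op_schwartz:
  assumes "f \<in> schwartz" shows "dunkl_op k f \<in> schwartz"
proof -
  have "real_deriv f \<in> schwartz" using assms unfolding schwartz_eq by (rule smooth_inD)
  then show ?thesis
    unfolding dunkl_op_eq[OF schwartz_smooth[OF assms]]
    by (intro schwartz_add schwartz_cmult dunkl_diff_schwartz assms)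
qed

lemma Ck_in_bounded_add:
  "Ck_in (bounded_by C) n f \<Longrightarrow> Ck_in (bounded_by D) n g \<Longrightarrow> Ck_in (bounded_by (C + D)) n (\<lambda>x. f x + g x)"
  by (rule Ck_in_add[of "bounded_by C" "bounded_by D"])
     (auto simp: bounded_by_def intro: order_trans[OF norm_triangle_ineq add_mono])

lemma Ck_in_bounded_affine:
  assumes "Ck_in (bounded_by C) n f" "\<bar>\<alpha>\<bar> = 1"
  shows "Ck_in (bounded_by (norm c * C)) n (\<lambda>x. c * f (\<alpha> * x + \<beta>))"
  by (rule Ck_in_affine[where B = "bounded_by C" and Q = "\<lambda>d. norm d = norm c"])
     (use assms in \<open>auto simp: bounded_by_def norm_mult intro: mult_left_mono\<close>)

lemma Ck_in_bounded_cmult: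
  "Ck_in (bounded_by C) n f \<Longrightarrow> Ck_in (bounded_by (norm c * C)) n (\<lambda>x. c * f x)"
  using Ck_in_bounded_affine[of C n f 1 c 0] by simp

text \<open>The difference quotient is an average of first derivatives. So it is bounded with the same constant, and
the Dunkl operator loses exactly one order of smoothness.\<close>

lemma Ck_in_dunkl_op:
  assumes f: "f \<in> smooth" "Ck_in (bounded_by C) (Suc n) f" and k: "k \<ge> - 1 / 2"
  shows "Ck_in (bounded_by ((2 * k + 2) * C)) n (dunkl_op k f)"
proof -
  have "Ck_in (bounded_by (norm (1/2::complex) * C + norm (-1/2::complex) * C)) (Suc n)
     (\<lambda>x. 1/2 * f x + (-1/2) * f ((-1) * x + 0))"
    by (intro Ck_in_bounded_add Ck_in_bounded_cmult Ck_in_bounded_affine f) auto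
  then have "Ck_in (bounded_by C) (Suc n) (odd_part f)"
    by (simp add: odd_part_def[abs_def] diff_divide_distrib)
  then have "Ck_in (bounded_by C) n (dunkl_diff f)"
    unfolding dunkl_diff_def by (intro Ck_in_segment_avg smooth_inD(3) odd_part_smooth f) auto
  then have "Ck_in (bounded_by (C + norm (of_real (2 * k + 1) :: complex) * C)) n (dunkl_op k f)"
    unfolding dunkl_op_eq[OF f(1)] using f(2)
    by (intro Ck_in_bounded_add Ck_in_bounded_cmult) auto
  moreover have "C + norm (of_real (2 * k + 1) :: complex) * C = (2 * k + 2) * C"
    unfolding norm_of_real using k by (simp add: algebra_simps)
  ultimately show ?thesis by simp
qed

lemma real_deriv_zero_outside:
  assumes "f \<in> smooth" "closed K" "\<And>x. x \<notin> K \<Longrightarrow> f x = 0" "x \<notin> K"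
  shows "real_deriv f x = 0"
proof -
  have "((\<lambda>x. 0) has_vector_derivative real_deriv f x) (at x)"
    by (rule has_vector_derivative_transform_within_open[OF smooth_inD(4)[OF assms(1)], of "- K"])
       (use assms in auto)
  then show ?thesis using vector_derivative_unique_at[OF _ has_vector_derivative_const] by blast
qed

text \<open>The interval is symmetric because the operator also sees the value at \<open>- x\<close>.\<close>

lemma dunkl_op_zero_outside:
  assumes "f \<in> smooth" "\<And>x. R < \<bar>x\<bar> \<Longrightarrow> f x = 0" "R < \<bar>x\<bar>" "0 \<le> R"
  shows "dunkl_op k f x = 0"
proof -
  have "real_deriv f x = 0"
    by (rule real_deriv_zero_outside[of f "{-R..R}"]) (use assms in auto)
  moreover have "of_real x * dunkl_diff f x = 0"
    unfolding dunkl_diff_mult[OF assms(1)] odd_part_def using assms by simp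
  ultimately show ?thesis using assms by (auto simp: dunkl_op_eq)
qed

section \<open>Bessel functions and the Dunkl kernel\<close>

text \<open>The coefficients of \<open>j\<^sub>\<alpha>\<close> as a power series in \<open>x\<^sup>2\<close>; the Pochhammer symbol replaces a quotient of Gamma
values, so that recurrences between different \<open>\<alpha>\<close> are rational identities.\<close>

definition bessel_coeff :: "real \<Rightarrow> nat \<Rightarrow> real" where
  "bessel_coeff \<alpha> n = (- 1) ^ n / (4 ^ n * fact n * pochhammer (\<alpha> + 1) n)"

lemma pochhammer_ge:
  assumes "\<alpha> \<ge> - 1 / 2" shows "pochhammer (\<alpha> + 1) n \<ge> (1 / 2 :: real) ^ n"
proof -
  have "(\<Prod>i<n. 1 / 2 :: real) \<le> (\<Prod>i<n. \<alpha> + 1 + of_nat i)"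
    by (rule prod_mono) (use assms in auto)
  then show ?thesis by (simp add: pochhammer_prod lessThan_atLeast0)
qed

lemma bessel_coeff_summable:
  assumes "\<alpha> \<ge> - 1 / 2" shows "summable (\<lambda>n. bessel_coeff \<alpha> n * y ^ n)"
proof (rule summable_comparison_test')
  show "summable (\<lambda>n. \<bar>y\<bar> ^ n /\<^sub>R fact n)" by (rule summable_exp_generic)
  fix n :: nat assume "n \<ge> 0"
  have p: "pochhammer (\<alpha> + 1) n \<ge> (1 / 2) ^ n" by (rule pochhammer_ge[OF assms])
  then have p0: "pochhammer (\<alpha> + 1) n > 0" by (rule less_le_trans[rotated]) simp
  have "1 \<le> (2::real) ^ n" by simp
  also have "\<dots> = 4 ^ n * (1 / 2) ^ n" by (simp flip: power_mult_distrib)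
  also have "\<dots> \<le> 4 ^ n * pochhammer (\<alpha> + 1) n" using p by simp
  finally have "fact n * 1 \<le> fact n * (4 ^ n * pochhammer (\<alpha> + 1) n)" by (intro mult_left_mono) auto
  then have "1 / (4 ^ n * fact n * pochhammer (\<alpha> + 1) n) \<le> 1 / fact n"
    using p0 by (intro divide_left_mono) (auto simp: mult_ac)
  then have "\<bar>y\<bar> ^ n * (1 / (4 ^ n * fact n * pochhammer (\<alpha> + 1) n)) \<le> \<bar>y\<bar> ^ n * (1 / fact n)"
    by (intro mult_left_mono) auto
  then show "norm (bessel_coeff \<alpha> n * y ^ n) \<le> \<bar>y\<bar> ^ n /\<^sub>R fact n"
    using p0 by (simp add: bessel_coeff_def abs_mult power_abs divide_inverse mult_ac)
qed

lemma bessel_j_series: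
  assumes "\<alpha> \<ge> - 1 / 2"
  shows "bessel_j \<alpha> x = (\<Sum>n. bessel_coeff \<alpha> n * (x\<^sup>2) ^ n)"
proof -
  have ni: "\<alpha> + 1 \<notin> \<int>\<^sub>\<le>\<^sub>0" using assms by (auto elim!: nonpos_Ints_cases)
  have G: "Gamma (\<alpha> + 1) > 0" using assms by (intro Gamma_real_pos) auto
  have "(- 1) ^ n * (x / 2) ^ (2 * n) / (fact n * Gamma (real n + \<alpha> + 1))
     = (1 / Gamma (\<alpha> + 1)) * (bessel_coeff \<alpha> n * (x\<^sup>2) ^ n)" for n
  proof -
    have "Gamma (real n + \<alpha> + 1) = Gamma (\<alpha> + 1) * pochhammer (\<alpha> + 1) n"
      using G pochhammer_Gamma[OF ni, of n] by (simp add: field_simps)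
    moreover have "(x / 2) ^ (2 * n) = (x\<^sup>2) ^ n / 4 ^ n"
      by (simp add: power_mult power_divide)
    ultimately show ?thesis by (simp add: bessel_coeff_def)
  qed
  then show ?thesis
    using G suminf_mult[OF bessel_coeff_summable[OF assms, of "x\<^sup>2"], of "1 / Gamma (\<alpha> + 1)"]
    by (simp add: bessel_j_def)
qed

lemma bessel_coeff_diffs:
  assumes "\<alpha> \<ge> - 1 / 2"
  shows "diffs (bessel_coeff \<alpha>) n = (- 1 / (4 * (\<alpha> + 1))) * bessel_coeff (\<alpha> + 1) n"
proof -
  have "pochhammer (\<alpha> + 1 + 1) n > 0" using assms by (intro pochhammer_pos) auto
  then show ?thesis using assms
    by (simp add: diffs_def bessel_coeff_def pochhammer_rec add.assoc divide_simps) (auto simp: algebra_simps)?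
qed

lemma bessel_coeff_contiguous:
  assumes "\<alpha> \<ge> - 1 / 2"
  shows "bessel_coeff \<alpha> n = bessel_coeff (\<alpha> + 1) n + of_nat n * bessel_coeff (\<alpha> + 1) n / (\<alpha> + 1)"
proof -
  have pos: "pochhammer (\<alpha> + 1 + 1) n > 0" "pochhammer (\<alpha> + 1) n > 0"
    using assms by (auto intro!: pochhammer_pos)
  have "(\<alpha> + 1) * pochhammer (\<alpha> + 1 + 1) n = pochhammer (\<alpha> + 1) n * (\<alpha> + 1 + n)"
    using pochhammer_rec[of "\<alpha> + 1" n] pochhammer_rec'[of "\<alpha> + 1" n] by (simp add: mult_ac)
  then have "(\<alpha> + 1 + n) / ((\<alpha> + 1) * pochhammer (\<alpha> + 1 + 1) n) = 1 / pochhammer (\<alpha> + 1) n"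
    using pos assms by simp
  moreover have "1 + n / (\<alpha> + 1) = (\<alpha> + 1 + n) / (\<alpha> + 1)"
    using assms by (simp add: add_divide_distrib)
  ultimately have "1 / pochhammer (\<alpha> + 1) n = (1 + n / (\<alpha> + 1)) / pochhammer (\<alpha> + 1 + 1) n"
    by simp
  then have "bessel_coeff \<alpha> n = (- 1) ^ n / (4 ^ n * fact n) * ((1 + n / (\<alpha> + 1)) / pochhammer (\<alpha> + 1 + 1) n)"
    unfolding \<open>1 / pochhammer (\<alpha> + 1) n = _\<close>[symmetric] by (simp add: bessel_coeff_def)
  also have "\<dots> = bessel_coeff (\<alpha> + 1) n + of_nat n * bessel_coeff (\<alpha> + 1) n / (\<alpha> + 1)"
    by (simp add: bessel_coeff_def add_divide_distrib distrib_left mult_ac distrib_right)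
  finally show ?thesis .
qed

lemma bessel_j_has_derivative:
  assumes "\<alpha> \<ge> - 1 / 2"
  shows "(bessel_j \<alpha> has_real_derivative - x / (2 * (\<alpha> + 1)) * bessel_j (\<alpha> + 1) x) (at x)"
proof -
  have "((\<lambda>y. \<Sum>n. bessel_coeff \<alpha> n * y ^ n) has_real_derivative (\<Sum>n. diffs (bessel_coeff \<alpha>) n * (x\<^sup>2) ^ n)) (at (x\<^sup>2))"
    by (rule termdiffs_strong_converges_everywhere) (rule bessel_coeff_summable[OF assms])
  also have "(\<Sum>n. diffs (bessel_coeff \<alpha>) n * (x\<^sup>2) ^ n) = (- 1 / (4 * (\<alpha> + 1))) * bessel_j (\<alpha> + 1) x"
    using assms suminf_mult[OF bessel_coeff_summable[of "\<alpha> + 1" "x\<^sup>2"], of "- 1 / (4 * (\<alpha> + 1))"]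
    by (simp add: bessel_coeff_diffs[OF assms] bessel_j_series mult.assoc)
  finally have "((\<lambda>x. \<Sum>n. bessel_coeff \<alpha> n * (x\<^sup>2) ^ n) has_real_derivative
      ((- 1 / (4 * (\<alpha> + 1))) * bessel_j (\<alpha> + 1) x) * (2 * x)) (at x)"
    by (rule DERIV_chain2) (auto intro!: derivative_eq_intros)
  moreover have "bessel_j \<alpha> = (\<lambda>x. \<Sum>n. bessel_coeff \<alpha> n * (x\<^sup>2) ^ n)"
    using bessel_j_series[OF assms] by auto
  moreover have "((- 1 / (4 * a)) * J) * (2 * x) = - x / (2 * a) * J" if "a \<noteq> 0" for a J :: real
    using that by (simp add: field_simps)
  from this[of "\<alpha> + 1" "bessel_j (\<alpha> + 1) x"]
  have "((- 1 / (4 * (\<alpha> + 1))) * bessel_j (\<alpha> + 1) x) * (2 * x) = - x / (2 * (\<alpha> + 1)) * bessel_j (\<alpha> + 1) x"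
    using assms by linarith
  ultimately show ?thesis by metis
qed

text \<open>The identity \<open>j\<^sub>\<alpha> = j\<^sub>\<alpha>\<^sub>+\<^sub>1 + x j'\<^sub>\<alpha>\<^sub>+\<^sub>1 / (2 (\<alpha> + 1))\<close>, which holds coefficientwise, with the derivative
expressed by \<open>j\<^sub>\<alpha>\<^sub>+\<^sub>2\<close>.\<close>

lemma bessel_j_contiguous:
  assumes "\<alpha> \<ge> - 1 / 2"
  shows "bessel_j \<alpha> x = bessel_j (\<alpha> + 1) x - x\<^sup>2 / (4 * (\<alpha> + 1) * (\<alpha> + 2)) * bessel_j (\<alpha> + 2) x"
proof -
  let ?c = "bessel_coeff (\<alpha> + 1)" and ?y = "x\<^sup>2"
  have a1: "\<alpha> + 1 \<ge> - 1 / 2" "\<alpha> + 2 \<ge> - 1 / 2" using assms by auto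
  have dc: "diffs ?c n = (- 1 / (4 * (\<alpha> + 2))) * bessel_coeff (\<alpha> + 2) n" for n
    using bessel_coeff_diffs[OF a1(1), of n] by (simp add: add.assoc)
  have "(\<lambda>n. bessel_coeff (\<alpha> + 2) n * ?y ^ n) sums bessel_j (\<alpha> + 2) x"
    unfolding bessel_j_series[OF a1(2)] by (rule summable_sums[OF bessel_coeff_summable[OF a1(2)]])
  then have "(\<lambda>n. (- 1 / (4 * (\<alpha> + 2))) * (bessel_coeff (\<alpha> + 2) n * ?y ^ n)) sums ((- 1 / (4 * (\<alpha> + 2))) * bessel_j (\<alpha> + 2) x)"
    by (rule sums_mult)
  then have ds: "(\<lambda>n. diffs ?c n * ?y ^ n) sums ((- 1 / (4 * (\<alpha> + 2))) * bessel_j (\<alpha> + 2) x)"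
    by (simp only: dc mult.assoc)
  have "(\<lambda>n. of_nat n * ?c n * ?y ^ (n - Suc 0)) sums ((- 1 / (4 * (\<alpha> + 2))) * bessel_j (\<alpha> + 2) x)"
    using diffs_equiv[OF sums_summable[OF ds]] sums_unique[OF ds] by simp
  then have "(\<lambda>n. ?y / (\<alpha> + 1) * (of_nat n * ?c n * ?y ^ (n - Suc 0))) sums (?y / (\<alpha> + 1) * ((- 1 / (4 * (\<alpha> + 2))) * bessel_j (\<alpha> + 2) x))"
    by (rule sums_mult)
  moreover have "(\<lambda>n. ?y / (\<alpha> + 1) * (of_nat n * ?c n * ?y ^ (n - Suc 0))) = (\<lambda>n. of_nat n * ?c n / (\<alpha> + 1) * ?y ^ n)"
  proof
    show "?y / (\<alpha> + 1) * (of_nat n * ?c n * ?y ^ (n - Suc 0)) = of_nat n * ?c n / (\<alpha> + 1) * ?y ^ n" for n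
      by (cases n) (simp_all add: mult_ac)
  qed
  moreover have "(\<lambda>n. ?c n * ?y ^ n) sums bessel_j (\<alpha> + 1) x"
    unfolding bessel_j_series[OF a1(1)] by (rule summable_sums[OF bessel_coeff_summable[OF a1(1)]])
  ultimately have "(\<lambda>n. ?c n * ?y ^ n + of_nat n * ?c n / (\<alpha> + 1) * ?y ^ n) sums
      (bessel_j (\<alpha> + 1) x + ?y / (\<alpha> + 1) * ((- 1 / (4 * (\<alpha> + 2))) * bessel_j (\<alpha> + 2) x))"
    by (simp only: sums_add)
  then have "(\<lambda>n. bessel_coeff \<alpha> n * ?y ^ n) sums
      (bessel_j (\<alpha> + 1) x + ?y / (\<alpha> + 1) * ((- 1 / (4 * (\<alpha> + 2))) * bessel_j (\<alpha> + 2) x))"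
    by (simp only: bessel_coeff_contiguous[OF assms] distrib_right)
  then show ?thesis
    by (simp add: bessel_j_series[OF assms] sums_unique[symmetric] algebra_simps)
qed

lemma bessel_j_minus: "bessel_j \<alpha> (- x) = bessel_j \<alpha> x"
  by (simp add: bessel_j_def)

lemma bessel_j_0:
  assumes "\<alpha> \<ge> - 1 / 2" shows "bessel_j \<alpha> 0 = 1"
proof -
  have "(\<lambda>n. bessel_coeff \<alpha> n * 0 ^ n) sums bessel_coeff \<alpha> 0" by (rule powser_sums_zero)
  then show ?thesis by (simp add: bessel_j_series[OF assms] sums_iff bessel_coeff_def)
qed

text \<open>The imaginary part of the Dunkl kernel. Together with \<open>j\<^sub>k\<close> it solves the first-order system
\<open>j' = - o\<close>, \<open>o' = j - (2 k + 1) o / x\<close>.\<close>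

definition bessel_odd :: "real \<Rightarrow> real \<Rightarrow> real" where
  "bessel_odd k x = x / (2 * (k + 1)) * bessel_j (k + 1) x"

lemma bessel_j_has_derivative':
  "k \<ge> - 1 / 2 \<Longrightarrow> (bessel_j k has_real_derivative - bessel_odd k x) (at x)"
  using bessel_j_has_derivative[of k x] by (simp add: bessel_odd_def)

lemma bessel_odd_has_derivative:
  assumes "k \<ge> - 1 / 2"
  shows "(bessel_odd k has_real_derivative
    bessel_j k x - (2 * k + 1) * (bessel_j (k + 1) x / (2 * (k + 1)))) (at x)"
proof -
  have "(bessel_odd k has_real_derivative
    x / (2 * (k + 1)) * (- x / (2 * (k + 2)) * bessel_j (k + 2) x) + 1 / (2 * (k + 1)) * bessel_j (k + 1) x) (at x)"
    unfolding bessel_odd_def[abs_def]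
    using bessel_j_has_derivative[of "k + 1" x] assms
    by (intro DERIV_mult' DERIV_cdivide DERIV_ident) (simp add: add.assoc)
  also have "x / (2 * (k + 1)) * (- x / (2 * (k + 2)) * bessel_j (k + 2) x)
      = - (x\<^sup>2 / (4 * (k + 1) * (k + 2)) * bessel_j (k + 2) x)"
  proof -
    have "4 * (k + 1) * (k + 2) = (2 * (k + 1)) * (2 * (k + 2))" by (simp add: algebra_simps)
    then show ?thesis by (simp only: power2_eq_square) simp
  qed
  also have "\<dots> = bessel_j k x - bessel_j (k + 1) x"
    using bessel_j_contiguous[OF assms, of x] by simp
  also have "bessel_j k x - bessel_j (k + 1) x + 1 / (2 * (k + 1)) * bessel_j (k + 1) x
      = bessel_j k x - (2 * k + 1) * (bessel_j (k + 1) x / (2 * (k + 1)))"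
    using assms by (simp add: field_simps)
  finally show ?thesis .
qed

text \<open>By the first-order system the derivative of \<open>j\<^sup>2 + o\<^sup>2\<close> is \<open>- 2 (2 k + 1) o\<^sup>2 / x\<close>. So this quantity decreases
for \<open>x > 0\<close> from its value 1 at the origin. The sum is the squared modulus of the
Dunkl kernel.\<close>

lemma bessel_energy_le:
  assumes "k \<ge> - 1 / 2"
  shows "(bessel_j k x)\<^sup>2 + (bessel_odd k x)\<^sup>2 \<le> 1"
proof -
  have *: "(bessel_j k x)\<^sup>2 + (bessel_odd k x)\<^sup>2 \<le> 1" if "x \<ge> 0" for x
  proof -
    let ?E = "\<lambda>x. (bessel_j k x)\<^sup>2 + (bessel_odd k x)\<^sup>2"
    have "\<exists>y. (?E has_real_derivative y) (at t) \<and> y \<le> 0" if t: "0 \<le> t" for t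
    proof (intro exI conjI)
      let ?d = "2 * bessel_j k t * (- bessel_odd k t) +
          2 * bessel_odd k t * (bessel_j k t - (2 * k + 1) * (bessel_j (k + 1) t / (2 * (k + 1))))"
      show "(?E has_real_derivative ?d) (at t)"
        by (auto intro!: derivative_eq_intros bessel_j_has_derivative' bessel_odd_has_derivative assms)
      have "?d = - 2 * (2 * k + 1) * t * (bessel_j (k + 1) t / (2 * (k + 1)))\<^sup>2"
      proof -
        have E: "bessel_odd k t = t * (bessel_j (k + 1) t / (2 * (k + 1)))" by (simp add: bessel_odd_def)
        have *: "2 * j * (- (t * v)) + 2 * (t * v) * (j - c * v) = - 2 * c * t * v\<^sup>2" for j c v :: real
          by algebra
        show ?thesis unfolding E by (rule *)
      qed
      also have "\<dots> \<le> 0" using assms t by (intro mult_nonpos_nonneg) auto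
      finally show "?d \<le> 0" .
    qed
    then have "?E x \<le> ?E 0" by (intro DERIV_nonpos_imp_nonincreasing[OF that]) auto
    then show ?thesis by (simp add: bessel_odd_def bessel_j_0[OF assms])
  qed
  show ?thesis
    using *[of "\<bar>x\<bar>"] by (cases "x \<ge> 0") (simp_all add: bessel_j_minus bessel_odd_def)
qed

text \<open>\<open>E\<^sub>k(\<i>z, 1)\<close>, which determines the kernel because \<open>E\<^sub>k(\<i>\<xi>, x)\<close> depends on \<open>\<xi> x\<close> only.\<close>

definition dunkl_exp :: "real \<Rightarrow> real \<Rightarrow> complex" where
  "dunkl_exp k z = Complex (bessel_j k z) (bessel_odd k z)"

lemma dunkl_kernel_eq: "dunkl_kernel k \<xi> x = dunkl_exp k (\<xi> * x)"
  by (simp add: dunkl_kernel_def dunkl_exp_def bessel_odd_def complex_eq_iff)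

lemma norm_dunkl_exp_le: "k \<ge> - 1 / 2 \<Longrightarrow> norm (dunkl_exp k z) \<le> 1"
  using bessel_energy_le[of k z] by (simp add: dunkl_exp_def cmod_def)

lemma norm_bessel_j_le: assumes "k \<ge> - 1 / 2" shows "\<bar>bessel_j k x\<bar> \<le> 1"
proof -
  have "(bessel_j k x)\<^sup>2 \<le> 1\<^sup>2"
    using bessel_energy_le[OF assms, of x] zero_le_power2[of "bessel_odd k x"] unfolding power_one by linarith
  then show ?thesis using abs_le_square_iff[of "bessel_j k x" 1] by simp
qed

text \<open>The derivative is a multiple of \<open>x j\<^sub>k\<^sub>+\<^sub>1\<close>, so all derivatives are polynomial combinations of bounded functions.\<close>

lemma bessel_j_smooth_slow:
  assumes "k \<ge> - 1 / 2" shows "(\<lambda>x. of_real (bessel_j k x)) \<in> smooth_in slow"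
proof -
  have slow: "(\<lambda>x. of_real (bessel_j k x)) \<in> slow" if "k \<ge> - 1 / 2" for k
    by (rule bounded_slow[of _ 1]) (use norm_bessel_j_le[OF that] in auto)
  have der: "((\<lambda>x. of_real (bessel_j k x) :: complex) has_vector_derivative
      poly [:0, - 1 / (2 * (of_real k + 1)):] (of_real x) * of_real (bessel_j (k + 1) x)) (at x)" if "k \<ge> - 1 / 2" for k x
  proof -
    have "poly [:0, - 1 / (2 * (of_real k + 1)):] (of_real x) * of_real (bessel_j (k + 1) x) =
        (of_real (- x / (2 * (k + 1)) * bessel_j (k + 1) x) :: complex)" by simp
    then show ?thesis by (simp only: has_vector_derivative_of_real[OF bessel_j_has_derivative[OF that, of x]])
  qed
  have "Ck_in slow n (\<lambda>x. of_real (bessel_j k x))" if "k \<ge> - 1 / 2" for n k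
    using that
  proof (induction n arbitrary: k)
    case 0
    show ?case by (rule Ck_in_0I[OF der[OF 0] slow[OF 0]])
  next
    case (Suc n)
    have "Ck_in slow n (\<lambda>x. poly [:0, - 1 / (2 * (of_real k + 1)):] (of_real x) * of_real (bessel_j (k + 1) x))"
      by (rule Ck_in_mult[of slow slow slow]) (use poly_smooth_slow Suc in \<open>auto simp: smooth_in_def slow_mult slow_add simp del: poly_pCons\<close>)
    then show ?case by (rule Ck_in_SucI[OF der[OF Suc.prems] slow[OF Suc.prems]])
  qed
  then show ?thesis using assms by (simp add: smooth_in_def)
qed

lemma dunkl_exp_smooth_slow:
  assumes "k \<ge> - 1 / 2" shows "dunkl_exp k \<in> smooth_in slow"
proof -
  have "(\<lambda>x. of_real (bessel_j k x) + poly [:0, \<i> / (2 * (of_real k + 1)):] (of_real x) * of_real (bessel_j (k + 1) x)) \<in> smooth_in slow"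
    using assms
    by (intro smooth_in_add[of slow] smooth_in_mult[of slow slow] slow_add slow_mult poly_smooth_slow bessel_j_smooth_slow)
       auto
  moreover have "(\<lambda>x. of_real (bessel_j k x) + poly [:0, \<i> / (2 * (of_real k + 1)):] (of_real x) * of_real (bessel_j (k + 1) x)) = dunkl_exp k"
    by (rule ext) (simp add: dunkl_exp_def bessel_odd_def Complex_eq mult.left_commute)
  ultimately show ?thesis by simp
qed

lemma real_deriv_dunkl_exp:
  assumes "k \<ge> - 1 / 2"
  shows "real_deriv (dunkl_exp k) z =
    \<i> * dunkl_exp k z - of_real (2 * k + 1) * (\<i> * of_real (bessel_j (k + 1) z / (2 * (k + 1))))"
proof -
  have "((\<lambda>x. of_real (bessel_j k x) + \<i> * of_real (bessel_odd k x)) has_vector_derivative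
     of_real (- bessel_odd k z) + \<i> * of_real (bessel_j k z - (2 * k + 1) * (bessel_j (k + 1) z / (2 * (k + 1))))) (at z)"
    using bessel_j_has_derivative'[OF assms, of z] bessel_odd_has_derivative[OF assms, of z]
    by (intro has_vector_derivative_add has_vector_derivative_mult_right has_vector_derivative_of_real)
       simp_all
  moreover have "dunkl_exp k = (\<lambda>x. of_real (bessel_j k x) + \<i> * of_real (bessel_odd k x))"
    by (rule ext) (simp add: dunkl_exp_def complex_eq_iff)
  ultimately have "real_deriv (dunkl_exp k) z =
     of_real (- bessel_odd k z) + \<i> * of_real (bessel_j k z - (2 * k + 1) * (bessel_j (k + 1) z / (2 * (k + 1))))"
    by (simp only: real_deriv_def vector_derivative_at)
  then show ?thesis by (simp add: dunkl_exp_def complex_eq_iff)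
qed

lemma odd_part_dunkl_exp:
  "odd_part (dunkl_exp k) z = of_real z * (\<i> * of_real (bessel_j (k + 1) z / (2 * (k + 1))))"
proof -
  have "bessel_odd k (- z) = - bessel_odd k z" by (simp add: bessel_odd_def bessel_j_minus)
  then have "odd_part (dunkl_exp k) z = \<i> * of_real (bessel_odd k z)"
    by (simp add: odd_part_def dunkl_exp_def bessel_j_minus complex_eq_iff)
  also have "bessel_odd k z = z * (bessel_j (k + 1) z / (2 * (k + 1)))" by (simp add: bessel_odd_def)
  finally show ?thesis by (simp only: of_real_mult mult.left_commute)
qed

section \<open>The Dunkl measure and integration by parts\<close>

definition dunkl_weight :: "real \<Rightarrow> real \<Rightarrow> real" where
  "dunkl_weight k x = \<bar>x\<bar> powr (2 * k + 1) / (2 powr (k + 1) * Gamma (k + 1))"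

text \<open>The density grows like \<open>\<bar>x\<bar>\<close> to the power \<open>2 k + 1\<close>; the two extra powers make \<open>(1 + \<bar>x\<bar>)\<^sup>-\<^sup>N\<close>
integrable.\<close>

definition decay_exponent :: "real \<Rightarrow> nat" where
  "decay_exponent k = nat \<lceil>2 * k + 1\<rceil> + 2"

abbreviation decay_weight :: "real \<Rightarrow> real \<Rightarrow> real" where
  "decay_weight k x \<equiv> 1 / (1 + \<bar>x\<bar>) ^ decay_exponent k"

lemma dunkl_measure_eq: "dunkl_measure k = density lborel (\<lambda>x. ennreal (dunkl_weight k x))"
  by (simp add: dunkl_measure_def dunkl_weight_def)

lemma sets_dunkl_measure [simp, measurable_cong]: "sets (dunkl_measure k) = sets borel"
  by (simp add: dunkl_measure_eq)

lemma space_dunkl_measure [simp]: "space (dunkl_measure k) = UNIV"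
  by (simp add: dunkl_measure_eq)

lemma measurable_dunkl_measure: "borel_measurable (dunkl_measure k) = borel_measurable borel"
  by (intro measurable_cong_sets) auto

lemma dunkl_weight_measurable [measurable]: "dunkl_weight k \<in> borel_measurable borel"
  unfolding dunkl_weight_def[abs_def] by measurable

lemma dunkl_weight_denom_pos: "k \<ge> - 1 / 2 \<Longrightarrow> 2 powr (k + 1) * Gamma (k + 1) > (0 :: real)"
  by (intro mult_pos_pos Gamma_real_pos) auto

lemma dunkl_weight_nonneg: "k \<ge> - 1 / 2 \<Longrightarrow> 0 \<le> dunkl_weight k x"
  using dunkl_weight_denom_pos[of k] by (simp add: dunkl_weight_def)

lemma dunkl_weight_pos: "k \<ge> - 1 / 2 \<Longrightarrow> x \<noteq> 0 \<Longrightarrow> 0 < dunkl_weight k x"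
  using dunkl_weight_denom_pos[of k] by (simp add: dunkl_weight_def)

lemma dunkl_weight_minus [simp]: "dunkl_weight k (- x) = dunkl_weight k x"
  by (simp add: dunkl_weight_def)

lemma dunkl_weight_le:
  assumes "k \<ge> - 1 / 2"
  shows "dunkl_weight k x \<le> 1 / (2 powr (k + 1) * Gamma (k + 1)) * (1 + \<bar>x\<bar>) ^ (nat \<lceil>2 * k + 1\<rceil>)"
proof -
  have "\<bar>x\<bar> powr (2 * k + 1) \<le> (1 + \<bar>x\<bar>) powr (2 * k + 1)"
    using assms by (intro powr_mono2) auto
  also have "\<dots> \<le> (1 + \<bar>x\<bar>) powr (real (nat \<lceil>2 * k + 1\<rceil>))"
    by (intro powr_mono real_nat_ceiling_ge) auto
  also have "\<dots> = (1 + \<bar>x\<bar>) ^ (nat \<lceil>2 * k + 1\<rceil>)" by (intro powr_realpow) auto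
  finally show ?thesis
    using dunkl_weight_denom_pos[OF assms] by (simp add: dunkl_weight_def divide_right_mono)
qed

lemma integrable_dunkl_iff:
  fixes g :: "real \<Rightarrow> 'a::{banach, second_countable_topology}"
  assumes "k \<ge> - 1 / 2" "g \<in> borel_measurable borel"
  shows "integrable (dunkl_measure k) g \<longleftrightarrow> integrable lborel (\<lambda>x. dunkl_weight k x *\<^sub>R g x)"
  unfolding dunkl_measure_eq
  by (rule integrable_density) (use assms dunkl_weight_nonneg in auto)

lemma integral_dunkl:
  fixes g :: "real \<Rightarrow> 'a::{banach, second_countable_topology}"
  assumes "k \<ge> - 1 / 2" "g \<in> borel_measurable borel"
  shows "integral\<^sup>L (dunkl_measure k) g = (\<integral>x. dunkl_weight k x *\<^sub>R g x \<partial>lborel)"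
  unfolding dunkl_measure_eq
  by (rule integral_density) (use assms dunkl_weight_nonneg in auto)

lemma sigma_finite_dunkl_measure: "sigma_finite_measure (dunkl_measure k)"
  unfolding dunkl_measure_eq
  by (subst sigma_finite_measure.sigma_finite_iff_density_finite[OF sigma_finite_lborel]) auto

lemma integrable_decay:
  assumes "k \<ge> - 1 / 2"
  shows "integrable (dunkl_measure k) (\<lambda>x. decay_weight k x)"
proof -
  let ?C = "1 / (2 powr (k + 1) * Gamma (k + 1))" and ?m = "nat \<lceil>2 * k + 1\<rceil>"
  have i: "integrable lborel (\<lambda>x::real. inverse (1 + x\<^sup>2))"
    using integrable_inverse_1_plus_square by (simp add: set_integrable_def)
  have "integrable lborel (\<lambda>x. dunkl_weight k x *\<^sub>R (decay_weight k x))"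
  proof (rule Bochner_Integration.integrable_bound[OF integrable_mult_right[OF i, of ?C]])
    show "AE x in lborel. norm (dunkl_weight k x *\<^sub>R (decay_weight k x)) \<le> norm (?C * inverse (1 + x\<^sup>2))"
    proof (rule AE_I2)
      fix x :: real
      have "norm (dunkl_weight k x *\<^sub>R (decay_weight k x)) = dunkl_weight k x * (1 / (1 + \<bar>x\<bar>) ^ (?m + 2))"
        using dunkl_weight_nonneg[OF assms] by (simp add: decay_exponent_def)
      also have "\<dots> \<le> (?C * (1 + \<bar>x\<bar>) ^ ?m) * (1 / (1 + \<bar>x\<bar>) ^ (?m + 2))"
        by (intro mult_right_mono dunkl_weight_le assms) auto
      also have "\<dots> = ?C * (1 / (1 + \<bar>x\<bar>)\<^sup>2)"
        unfolding power_add by (simp add: power_add)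
      also have "\<dots> \<le> ?C * inverse (1 + x\<^sup>2)"
      proof (rule mult_left_mono)
        have "1 + x\<^sup>2 \<le> (1 + \<bar>x\<bar>)\<^sup>2" by (simp add: power2_eq_square algebra_simps)
        then show "1 / (1 + \<bar>x\<bar>)\<^sup>2 \<le> inverse (1 + x\<^sup>2)"
          unfolding divide_inverse mult_1 by (intro le_imp_inverse_le) (auto intro: add_pos_nonneg)
      qed (use dunkl_weight_denom_pos[OF assms] in auto)
      finally show "norm (dunkl_weight k x *\<^sub>R (decay_weight k x)) \<le> norm (?C * inverse (1 + x\<^sup>2))"
        by (rule order_trans) (simp only: real_norm_def abs_ge_self)
    qed
  qed simp
  then show ?thesis by (subst integrable_dunkl_iff[OF assms]) auto
qed

lemma dunkl_integrableI:
  fixes f :: "real \<Rightarrow> 'a::{banach, second_countable_topology}"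
  assumes "k \<ge> - 1 / 2" "f \<in> borel_measurable borel"
    and "\<And>x. (1 + \<bar>x\<bar>) ^ decay_exponent k * norm (f x) \<le> C"
  shows "integrable (dunkl_measure k) f"
proof (rule Bochner_Integration.integrable_bound[OF integrable_mult_right[OF integrable_decay[OF assms(1)], of C]])
  show "f \<in> borel_measurable (dunkl_measure k)" using assms(2) by (simp add: measurable_dunkl_measure)
  have "norm (f x) \<le> norm (C * decay_weight k x)" for x
  proof -
    have "norm (f x) \<le> C * decay_weight k x"
      using assms(3)[of x] by (simp add: field_simps)
    then show ?thesis by (rule order_trans) (simp only: real_norm_def abs_ge_self)
  qed
  then show "AE x in dunkl_measure k. norm (f x) \<le> norm (C * decay_weight k x)" by simp
qed

lemma rapid_integrable:
  assumes "k \<ge> - 1 / 2" "continuous_on UNIV f" "f \<in> rapid"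
  shows "integrable (dunkl_measure k) f"
proof -
  obtain C where "\<And>x. (1 + \<bar>x\<bar>) ^ decay_exponent k * norm (f x) \<le> C"
    using assms(3) unfolding rapid_def by blast
  then show ?thesis
    by (intro dunkl_integrableI assms borel_measurable_continuous_onI)
qed

lemma integrable_bounded_mult:
  fixes f E :: "real \<Rightarrow> complex"
  assumes "integrable (dunkl_measure k) f" "E \<in> borel_measurable borel" "\<And>x. norm (E x) \<le> 1"
  shows "integrable (dunkl_measure k) (\<lambda>x. f x * E x)"
proof (rule Bochner_Integration.integrable_bound[OF assms(1)])
  show "(\<lambda>x. f x * E x) \<in> borel_measurable (dunkl_measure k)"
    using assms(1,2) borel_measurable_integrable[OF assms(1)]
    by (simp add: measurable_dunkl_measure)
  show "AE x in dunkl_measure k. norm (f x * E x) \<le> norm (f x)"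
    by (simp add: norm_mult mult_left_le assms(3))
qed

lemma dunkl_integral_reflect:
  fixes g :: "real \<Rightarrow> complex"
  assumes "k \<ge> - 1 / 2" "g \<in> borel_measurable borel"
  shows "(\<integral>x. g (- x) \<partial>dunkl_measure k) = (\<integral>x. g x \<partial>dunkl_measure k)"
proof -
  have "(\<integral>x. dunkl_weight k x *\<^sub>R g x \<partial>lborel) = \<bar>-1\<bar> *\<^sub>R (\<integral>x. dunkl_weight k (0 + (-1) * x) *\<^sub>R g (0 + (-1) * x) \<partial>lborel)"
    by (rule lborel_integral_real_affine) simp
  then show ?thesis using assms by (simp add: integral_dunkl)
qed

text \<open>The origin is excepted since the density of the Dunkl measure need not be differentiable there.\<close>

lemma integral_derivative_eq_0:
  fixes G H :: "real \<Rightarrow> complex"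
  assumes "integrable lborel G" "continuous_on UNIV H"
    and "\<And>x. x \<noteq> 0 \<Longrightarrow> (H has_vector_derivative G x) (at x)"
    and "(\<lambda>n. H (real n) - H (- real n)) \<longlonglongrightarrow> 0"
  shows "integral\<^sup>L lborel G = 0"
proof -
  have "(\<lambda>n. \<integral>x. indicator {- real n..real n} x *\<^sub>R G x \<partial>lborel) \<longlonglongrightarrow> integral\<^sup>L lborel G"
  proof (rule integral_dominated_convergence[where w = "\<lambda>x. norm (G x)"])
    show "AE x in lborel. (\<lambda>n. indicator {- real n..real n} x *\<^sub>R G x) \<longlonglongrightarrow> G x"
    proof (rule AE_I2)
      fix x :: real
      obtain N :: nat where N: "\<bar>x\<bar> \<le> real N" using real_arch_simple by blast
      have "\<forall>\<^sub>F n in sequentially. indicator {- real n..real n} x *\<^sub>R G x = G x"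
        using eventually_ge_at_top[of N] by eventually_elim (use N in \<open>auto simp: indicator_def\<close>)
      then show "(\<lambda>n. indicator {- real n..real n} x *\<^sub>R G x) \<longlonglongrightarrow> G x" by (rule tendsto_eventually)
    qed
  qed (use assms(1) in \<open>auto simp: indicator_def intro: integrable_norm\<close>)
  moreover have "(\<integral>x. indicator {- real n..real n} x *\<^sub>R G x \<partial>lborel) = H (real n) - H (- real n)" for n
  proof -
    have "set_integrable lborel {- real n..real n} G"
      unfolding set_integrable_def using assms(1) by (intro integrable_mult_indicator) auto
    then have "(\<integral>x. indicator {- real n..real n} x *\<^sub>R G x \<partial>lborel) = integral {- real n..real n} G"
      using set_borel_integral_eq_integral(2) unfolding set_lebesgue_integral_def by blast
    moreover have "(G has_integral (H (real n) - H (- real n))) {- real n..real n}"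
      by (rule fundamental_theorem_of_calculus_strong[of "{0}"])
         (use assms(2,3) in \<open>auto intro: continuous_on_subset\<close>)
    ultimately show ?thesis by (simp add: integral_unique)
  qed
  ultimately show ?thesis using assms(4) LIMSEQ_unique by simp
qed

lemma dunkl_weight_has_derivative:
  assumes "x \<noteq> 0"
  shows "(dunkl_weight k has_real_derivative (2 * k + 1) / x * dunkl_weight k x) (at x)"
proof -
  have eq: "\<bar>x\<bar> powr (2 * k + 1) = (x\<^sup>2) powr ((2 * k + 1) / 2)" for x
  proof (cases "x = 0")
    case False
    have "2 * k + 1 = 2 * ((2 * k + 1) / 2)" by simp
    then have "\<bar>x\<bar> powr (2 * k + 1) = \<bar>x\<bar> powr (2 * ((2 * k + 1) / 2))" by metis
    also have "\<dots> = (\<bar>x\<bar> powr 2) powr ((2 * k + 1) / 2)" by (rule powr_powr[symmetric])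
    also have "\<bar>x\<bar> powr 2 = x\<^sup>2" using False by simp
    finally show ?thesis .
  qed simp
  have "((\<lambda>x. (x\<^sup>2) powr ((2 * k + 1) / 2)) has_real_derivative (2 * k + 1) / x * (x\<^sup>2) powr ((2 * k + 1) / 2)) (at x)"
  proof -
    have pos: "0 < x\<^sup>2" using assms by simp
    have "((\<lambda>x. (x\<^sup>2) powr ((2 * k + 1) / 2)) has_real_derivative
        ((2 * k + 1) / 2 * (x\<^sup>2) powr ((2 * k + 1) / 2 - 1)) * (2 * x)) (at x)"
      by (rule DERIV_chain2[where g = "\<lambda>x. x\<^sup>2"], rule has_real_derivative_powr[OF pos])
         (auto intro!: derivative_eq_intros)
    also have "(x\<^sup>2) powr ((2 * k + 1) / 2 - 1) = (x\<^sup>2) powr ((2 * k + 1) / 2) / x\<^sup>2"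
      by (subst powr_diff) (use pos in simp)
    also have "((2 * k + 1) / 2 * ((x\<^sup>2) powr ((2 * k + 1) / 2) / x\<^sup>2)) * (2 * x)
        = (2 * k + 1) / x * (x\<^sup>2) powr ((2 * k + 1) / 2)"
      using assms by (simp add: power2_eq_square)
    finally show ?thesis .
  qed
  then have "((\<lambda>x. \<bar>x\<bar> powr (2 * k + 1)) has_real_derivative (2 * k + 1) / x * \<bar>x\<bar> powr (2 * k + 1)) (at x)"
    unfolding eq .
  from DERIV_cdivide[OF this, of "2 powr (k + 1) * Gamma (k + 1)"]
  show ?thesis by (simp add: dunkl_weight_def[abs_def])
qed

lemma dunkl_diff_rapid:
  assumes "f \<in> smooth" "f \<in> rapid"
  shows "dunkl_diff f \<in> rapid"
proof (rule continuous_rapidI[of _ 0])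
  show "continuous_on UNIV (dunkl_diff f)" using dunkl_diff_smooth[OF assms(1)] by (rule smooth_inD)
  have "(\<lambda>x. f (- x)) \<in> rapid" using assms(2) unfolding rapid_def by auto (metis abs_minus_cancel)
  then have "(\<lambda>x. (1/2) * f x + (-1/2) * f (- x)) \<in> rapid"
    by (intro rapid_add slow_rapid_mult const_slow assms)
  moreover have "(1/2) * f x + (-1/2) * f (- x) = of_real (x - 0) * dunkl_diff f x" for x
    by (simp add: dunkl_diff_mult[OF assms(1)] odd_part_def field_simps)
  ultimately show "(\<lambda>x. of_real (x - 0) * dunkl_diff f x) \<in> rapid" by simp
qed

lemma dunkl_op_rapid:
  assumes "f \<in> smooth" "f \<in> rapid" "real_deriv f \<in> rapid"
  shows "dunkl_op k f \<in> rapid"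
proof -
  show ?thesis unfolding dunkl_op_eq[OF assms(1)]
    by (intro rapid_add slow_rapid_mult dunkl_diff_rapid assms const_slow)
qed

text \<open>With \<open>h = f E\<close> and \<open>w\<close> the density, the integrand and its reflection add up to the derivative of
\<open>w (x) (h x - h (- x))\<close>: the difference terms combine to \<open>(2 k + 1) / x\<close> times \<open>h x - h (- x)\<close>, which is
what differentiating \<open>w\<close> contributes. This function is continuous, because \<open>w\<close> is bounded near the origin
and the bracket vanishes there, and it tends to 0 at infinity.\<close>

lemma dunkl_integration_by_parts:
  assumes k: "k \<ge> - 1 / 2"
    and f: "f \<in> smooth" "f \<in> rapid" "real_deriv f \<in> rapid"
    and E: "E \<in> smooth" "\<And>x. norm (E x) \<le> 1" "\<And>x. dunkl_op k E x = c * E x"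
  shows "(\<integral>x. dunkl_op k f x * E x \<partial>dunkl_measure k) = - c * (\<integral>x. f x * E x \<partial>dunkl_measure k)"
proof -
  let ?h' = "\<lambda>x. f x * real_deriv E x + real_deriv f x * E x"
  let ?M = "dunkl_measure k" and ?w = "dunkl_weight k"
  define I where "I x = dunkl_op k f x * E x + c * (f x * E x)" for x
  define h where "h x = f x * E x" for x
  define H where "H x = ?w x *\<^sub>R (h x - h (- x))" for x
  have Em: "E \<in> borel_measurable borel"
    by (intro borel_measurable_continuous_onI smooth_inD(5)[OF E(1)])
  have int1: "integrable ?M (\<lambda>x. dunkl_op k f x * E x)" "integrable ?M (\<lambda>x. f x * E x)"
    by (intro integrable_bounded_mult rapid_integrable k Em E(2) dunkl_op_rapid f
         smooth_inD(5)[OF f(1)] smooth_inD(5)[OF dunkl_op_smooth[OF f(1)]])+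
  have Iint: "integrable ?M I" unfolding I_def using int1 by auto
  have Im: "I \<in> borel_measurable borel"
    using borel_measurable_integrable[OF Iint] by (simp add: measurable_dunkl_measure)
  have hcont: "continuous_on UNIV h" unfolding h_def
    by (intro continuous_intros smooth_inD(5)[OF f(1)] smooth_inD(5)[OF E(1)])
  have wIint: "integrable lborel (\<lambda>x. ?w x *\<^sub>R I x)"
    using Iint integrable_dunkl_iff[OF k Im] by simp
  have "integrable lborel (\<lambda>x. ?w (0 + (-1) * x) *\<^sub>R I (0 + (-1) * x))"
    by (rule lborel_integrable_real_affine[OF wIint]) simp
  then have Gint: "integrable lborel (\<lambda>x. ?w x *\<^sub>R (I x + I (- x)))"
    using wIint by (simp add: scaleR_add_right)
  have der: "(H has_vector_derivative ?w x *\<^sub>R (I x + I (- x))) (at x)" if "x \<noteq> 0" for x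
  proof -
    have h': "(h has_vector_derivative ?h' x) (at x)" for x
      unfolding h_def[abs_def] by (intro has_vector_derivative_mult smooth_inD(4)[OF f(1)] smooth_inD(4)[OF E(1)])
    have "(H has_vector_derivative
        ?w x *\<^sub>R (?h' x - - ?h' (- x))
        + ((2 * k + 1) / x * ?w x) *\<^sub>R (h x - h (- x))) (at x)"
      unfolding H_def[abs_def]
      by (intro has_vector_derivative_scaleR dunkl_weight_has_derivative that has_vector_derivative_diff
          has_vector_derivative_reflect h')
    also have "?w x *\<^sub>R (?h' x - - ?h' (- x))
        + ((2 * k + 1) / x * ?w x) *\<^sub>R (h x - h (- x)) = ?w x *\<^sub>R (I x + I (- x))"
    proof -
      have dd: "dunkl_diff g x = (g x - g (- x)) / (2 * of_real x)" "dunkl_diff g (- x) = (g x - g (- x)) / (2 * of_real x)"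
        if "g \<in> smooth" for g
        using dunkl_diff_mult[OF that, of x] dunkl_diff_mult[OF that, of "- x"] \<open>x \<noteq> 0\<close>
        by (auto simp: odd_part_def field_simps)
      have I: "I y = (real_deriv f y + of_real (2 * k + 1) * dunkl_diff f y) * E y
          + f y * (real_deriv E y + of_real (2 * k + 1) * dunkl_diff E y)" for y
        using E(3)[of y] by (simp add: I_def dunkl_op_eq[OF f(1)] dunkl_op_eq[OF E(1)] algebra_simps)
      show ?thesis
        unfolding I dd[OF f(1)] dd[OF E(1)] h_def scaleR_conv_of_real using \<open>x \<noteq> 0\<close>
        by (simp add: field_simps)
    qed
    finally show ?thesis .
  qed
  have wle: "?w x \<le> 1 / (2 powr (k + 1) * Gamma (k + 1)) * (1 + \<bar>x\<bar>) ^ (nat \<lceil>2 * k + 1\<rceil>)" for x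
    by (rule dunkl_weight_le[OF k])
  let ?C = "1 / (2 powr (k + 1) * Gamma (k + 1))" and ?m = "nat \<lceil>2 * k + 1\<rceil>"
  have C0: "0 \<le> ?C" using dunkl_weight_denom_pos[OF k] by simp
  have Hcont: "continuous_on UNIV H"
  proof (rule continuous_at_imp_continuous_on, rule ballI)
    fix x :: real
    show "isCont H x"
    proof (cases "x = 0")
      case False
      then show ?thesis using der has_vector_derivative_continuous by blast
    next
      case True
      have "((\<lambda>x. (?C * (1 + \<bar>x\<bar>) ^ ?m) * norm (h x - h (- x))) \<longlongrightarrow> (?C * (1 + \<bar>0\<bar>) ^ ?m) * norm (h 0 - h (- 0))) (at 0)"
        by (intro tendsto_intros isCont_tendsto_compose[of _ h])
           (use hcont in \<open>auto simp: continuous_on_eq_continuous_at\<close>)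
      then have lim: "((\<lambda>x. (?C * (1 + \<bar>x\<bar>) ^ ?m) * norm (h x - h (- x))) \<longlongrightarrow> 0) (at 0)" by simp
      have "(H \<longlongrightarrow> 0) (at 0)"
      proof (rule Lim_null_comparison[OF _ lim])
        have "norm (H x) \<le> (?C * (1 + \<bar>x\<bar>) ^ ?m) * norm (h x - h (- x))" for x
        proof -
          have "norm (H x) = ?w x * norm (h x - h (- x))"
            unfolding H_def using dunkl_weight_nonneg[OF k, of x] by simp
          also have "\<dots> \<le> (?C * (1 + \<bar>x\<bar>) ^ ?m) * norm (h x - h (- x))"
            by (rule mult_right_mono[OF wle]) simp
          finally show ?thesis .
        qed
        then show "\<forall>\<^sub>F x in at 0. norm (H x) \<le> (?C * (1 + \<bar>x\<bar>) ^ ?m) * norm (h x - h (- x))" by simp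
      qed
      then show ?thesis using True by (simp add: isCont_def H_def)
    qed
  qed
  obtain D where D: "\<And>x. (1 + \<bar>x\<bar>) ^ (?m + 1) * norm (f x) \<le> D"
    using f(2) unfolding rapid_def by blast
  have hD: "(1 + \<bar>x\<bar>) ^ (?m + 1) * norm (h x) \<le> D" for x
  proof -
    have "norm (h x) \<le> norm (f x)" unfolding h_def norm_mult by (simp add: mult_left_le E(2))
    then show ?thesis using D[of x] by (meson mult_left_mono order_trans zero_le_power abs_ge_zero add_nonneg_nonneg zero_le_one)
  qed
  have Hbd: "norm (H x) \<le> 2 * ?C * D * inverse (1 + \<bar>x\<bar>)" for x
  proof -
    have "norm (H x) \<le> (?C * (1 + \<bar>x\<bar>) ^ ?m) * (norm (h x) + norm (h (- x)))"
    proof -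
      have "norm (H x) = ?w x * norm (h x - h (- x))"
        unfolding H_def using dunkl_weight_nonneg[OF k, of x] by simp
      also have "\<dots> \<le> (?C * (1 + \<bar>x\<bar>) ^ ?m) * (norm (h x) + norm (h (- x)))"
        by (rule mult_mono[OF wle norm_triangle_ineq4]) (use C0 in auto)
      finally show ?thesis .
    qed
    also have "\<dots> = ?C * inverse (1 + \<bar>x\<bar>) * ((1 + \<bar>x\<bar>) ^ (?m + 1) * norm (h x) + (1 + \<bar>- x\<bar>) ^ (?m + 1) * norm (h (- x)))"
    proof -
      have gen: "(c * A ^ m) * (u + v) = c * inverse A * (A ^ (m + 1) * u + A ^ (m + 1) * v)"
        if "A \<noteq> 0" for c A u v :: real and m :: nat
        using that by (simp add: field_simps)
      show ?thesis unfolding abs_minus_cancel by (rule gen) linarith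
    qed
    also have "\<dots> \<le> ?C * inverse (1 + \<bar>x\<bar>) * (D + D)"
      by (intro mult_left_mono add_mono hD mult_nonneg_nonneg C0) auto
    finally show ?thesis by (simp add: algebra_simps)
  qed
  have "(\<lambda>n. H (real n) - H (- real n)) \<longlonglongrightarrow> 0"
  proof (rule Lim_null_comparison)
    have "norm (H (real n) - H (- real n)) \<le> 4 * ?C * D * inverse (real (Suc n))" for n
    proof -
      have "norm (H (real n) - H (- real n)) \<le> norm (H (real n)) + norm (H (- real n))" by (rule norm_triangle_ineq4)
      also have "\<dots> \<le> 2 * ?C * D * inverse (1 + \<bar>real n\<bar>) + 2 * ?C * D * inverse (1 + \<bar>- real n\<bar>)"
        by (intro add_mono Hbd)
      finally show ?thesis by (simp add: mult_ac)
    qed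
    then show "\<forall>\<^sub>F n in sequentially. norm (H (real n) - H (- real n)) \<le> 4 * ?C * D * inverse (real (Suc n))" by simp
    show "(\<lambda>n. 4 * ?C * D * inverse (real (Suc n))) \<longlonglongrightarrow> 0"
      by (rule tendsto_mult_right_zero[OF LIMSEQ_inverse_real_of_nat])
  qed
  from integral_derivative_eq_0[OF Gint Hcont der this]
  have "0 = (\<integral>x. ?w x *\<^sub>R (I x + I (- x)) \<partial>lborel)" by simp
  also have "\<dots> = (\<integral>x. I x + I (- x) \<partial>?M)" using Im by (simp add: integral_dunkl[OF k])
  also have "\<dots> = (\<integral>x. I x \<partial>?M) + (\<integral>x. I (- x) \<partial>?M)"
  proof (rule Bochner_Integration.integral_add[OF Iint])
    have "integrable lborel (\<lambda>x. ?w x *\<^sub>R I (- x))"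
      using \<open>integrable lborel (\<lambda>x. ?w (0 + (-1) * x) *\<^sub>R I (0 + (-1) * x))\<close> by simp
    then show "integrable ?M (\<lambda>x. I (- x))"
      using Im by (subst integrable_dunkl_iff[OF k]) auto
  qed
  also have "\<dots> = 2 * (\<integral>x. I x \<partial>?M)" using dunkl_integral_reflect[OF k Im] by simp
  also have "(\<integral>x. I x \<partial>?M) = (\<integral>x. dunkl_op k f x * E x \<partial>?M) + c * (\<integral>x. f x * E x \<partial>?M)"
    unfolding I_def using int1 by simp
  finally have "(\<integral>x. dunkl_op k f x * E x \<partial>?M) + c * (\<integral>x. f x * E x \<partial>?M) = 0"
    by (metis mult_eq_0_iff zero_neq_numeral)
  then show ?thesis by (simp add: eq_neg_iff_add_eq_0)
qed

section \<open>The Dunkl transform on Schwartz functions\<close>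

lemma dunkl_diff_dunkl_exp:
  assumes k: "k \<ge> - 1 / 2"
  shows "dunkl_diff (dunkl_exp k) z = \<i> * of_real (bessel_j (k + 1) z / (2 * (k + 1)))"
proof -
  have sm: "dunkl_exp k \<in> smooth" by (rule smooth_in_smooth[OF dunkl_exp_smooth_slow[OF k]])
  show ?thesis
  proof (cases "z = 0")
    case False
    then show ?thesis
      using dunkl_diff_mult[OF sm, of z] unfolding odd_part_dunkl_exp by (metis mult_cancel_left of_real_eq_0_iff)
  next
    case True
    have "dunkl_exp k 0 = 1" using bessel_j_0[OF k] by (simp add: dunkl_exp_def bessel_odd_def complex_eq_iff)
    moreover have "bessel_j (k + 1) 0 = 1" using k by (intro bessel_j_0) auto
    moreover have "1 - (2 * k + 1) * (1 / (2 * (k + 1))) = 1 / (2 * (k + 1))" using k by (simp add: field_simps)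
    ultimately have "real_deriv (dunkl_exp k) 0 = \<i> * of_real (1 / (2 * (k + 1)))"
      unfolding real_deriv_dunkl_exp[OF k] by (simp add: complex_eq_iff)
    then show ?thesis using True \<open>bessel_j (k + 1) 0 = 1\<close> by (simp add: dunkl_diff_0[OF sm])
  qed
qed

lemma dunkl_op_dunkl_exp:
  assumes k: "k \<ge> - 1 / 2"
  shows "dunkl_op k (dunkl_exp k) z = \<i> * dunkl_exp k z"
  by (simp only: dunkl_op_eq[OF smooth_in_smooth[OF dunkl_exp_smooth_slow[OF k]]]
        real_deriv_dunkl_exp[OF k] dunkl_diff_dunkl_exp[OF k] diff_add_cancel)

lemma dunkl_op_scale:
  assumes f: "f \<in> smooth"
  shows "dunkl_op k (\<lambda>x. f (s * x)) x = of_real s * dunkl_op k f (s * x)"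
proof -
  have der: "real_deriv (\<lambda>x. g (s * x)) = (\<lambda>x. of_real s * real_deriv g (s * x))" if "g \<in> smooth" for g
    using affine_has_vector_derivative[of g _ s _ 0 1, OF smooth_inD(4)[OF that]]
    by (intro real_deriv_eqI) simp
  have "odd_part (\<lambda>x. f (s * x)) = (\<lambda>x. odd_part f (s * x))" by (simp add: odd_part_def[abs_def])
  then have "dunkl_diff (\<lambda>x. f (s * x)) x = of_real s * dunkl_diff f (s * x)"
    by (simp add: dunkl_diff_def der[OF odd_part_smooth[OF f]] segment_avg_def mult.left_commute)
  moreover have "(\<lambda>x. f (s * x)) \<in> smooth" using smooth_affine[OF f, of s 0] by simp
  ultimately show ?thesis by (simp add: dunkl_op_eq f der[OF f] distrib_left mult.left_commute)
qed

definition dunkl_transform :: "real \<Rightarrow> (real \<Rightarrow> complex) \<Rightarrow> real \<Rightarrow> complex" where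
  "dunkl_transform k g \<xi> = (\<integral>x. g x * dunkl_exp k (- (\<xi> * x)) \<partial>dunkl_measure k)"

lemma schwartzD:
  assumes "f \<in> schwartz"
  shows "f \<in> smooth" "f \<in> rapid" "real_deriv f \<in> rapid" "continuous_on UNIV f" "f \<in> borel_measurable borel"
proof -
  have f: "f \<in> smooth_in rapid" using assms by (simp add: schwartz_eq)
  show "f \<in> smooth" by (rule smooth_in_smooth[OF f])
  show "f \<in> rapid" by (rule smooth_inD(1)[OF f])
  show "real_deriv f \<in> rapid" by (rule smooth_inD(1)[OF smooth_inD(3)[OF f]])
  show "continuous_on UNIV f" by (rule smooth_inD(5)[OF f])
  then show "f \<in> borel_measurable borel" by (rule borel_measurable_continuous_onI)
qed

lemma schwartz_integrable: "k \<ge> - 1 / 2 \<Longrightarrow> f \<in> schwartz \<Longrightarrow> integrable (dunkl_measure k) f"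
  by (intro rapid_integrable schwartzD)

lemma dunkl_exp_continuous: "k \<ge> - 1 / 2 \<Longrightarrow> continuous_on UNIV (dunkl_exp k)"
  by (rule smooth_inD(5)[OF dunkl_exp_smooth_slow])

lemma dunkl_exp_measurable [measurable]:
  "k \<ge> - 1 / 2 \<Longrightarrow> dunkl_exp k \<in> borel_measurable borel"
  by (intro borel_measurable_continuous_onI dunkl_exp_continuous)

lemma dunkl_exp_scaled_measurable:
  "k \<ge> - 1 / 2 \<Longrightarrow> (\<lambda>x. dunkl_exp k (- (\<xi> * x))) \<in> borel_measurable borel"
  by (rule measurable_compose[OF _ dunkl_exp_measurable]) auto

lemma dunkl_transform_integrable:
  assumes "k \<ge> - 1 / 2" "integrable (dunkl_measure k) g"
  shows "integrable (dunkl_measure k) (\<lambda>x. g x * dunkl_exp k (- (\<xi> * x)))"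
  using assms by (intro integrable_bounded_mult norm_dunkl_exp_le dunkl_exp_scaled_measurable)

lemma norm_dunkl_transform_le:
  assumes "k \<ge> - 1 / 2" "integrable (dunkl_measure k) g"
  shows "norm (dunkl_transform k g \<xi>) \<le> (\<integral>x. norm (g x) \<partial>dunkl_measure k)"
  unfolding dunkl_transform_def
proof (rule order_trans[OF integral_norm_bound integral_mono])
  show "norm (g x * dunkl_exp k (- (\<xi> * x))) \<le> norm (g x)" for x
    using norm_dunkl_exp_le[OF assms(1)] by (simp add: norm_mult mult_left_le)
qed (use assms dunkl_transform_integrable in \<open>auto intro!: integrable_norm\<close>)

lemma dunkl_transform_dunkl_op:
  assumes k: "k \<ge> - 1 / 2" and f: "f \<in> smooth" "f \<in> rapid" "real_deriv f \<in> rapid"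
  shows "dunkl_transform k (dunkl_op k f) \<xi> = \<i> * of_real \<xi> * dunkl_transform k f \<xi>"
proof -
  have sm: "dunkl_exp k \<in> smooth" by (rule smooth_in_smooth[OF dunkl_exp_smooth_slow[OF k]])
  have "dunkl_op k (\<lambda>x. dunkl_exp k (- \<xi> * x)) x = (- \<i> * of_real \<xi>) * dunkl_exp k (- \<xi> * x)" for x
    unfolding dunkl_op_scale[OF sm] dunkl_op_dunkl_exp[OF k] by simp
  from dunkl_integration_by_parts[OF k f _ norm_dunkl_exp_le[OF k] this]
  show ?thesis using smooth_affine[OF sm, of "- \<xi>" 0] by (simp add: dunkl_transform_def)
qed

lemma has_vector_derivative_quotientI:
  fixes f :: "real \<Rightarrow> complex"
  assumes "((\<lambda>y. (f y - f x) / of_real (y - x)) \<longlongrightarrow> f') (at x)"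
  shows "(f has_vector_derivative f') (at x)"
  unfolding has_vector_derivative_def has_derivative_iff_norm
proof
  show "bounded_linear (\<lambda>x. x *\<^sub>R f')" by (rule bounded_linear_scaleR_left)
  have "((\<lambda>y. norm ((f y - f x) / of_real (y - x) - f')) \<longlongrightarrow> 0) (at x)"
    using assms by (intro tendsto_norm_zero LIM_zero)
  moreover have "\<forall>\<^sub>F y in at x. norm ((f y - f x) / of_real (y - x) - f') = norm (f y - f x - (y - x) *\<^sub>R f') / norm (y - x)"
    unfolding eventually_at_filter
  proof (intro always_eventually allI impI)
    fix y assume "y \<noteq> x"
    then have "(f y - f x) / of_real (y - x) - f' = (f y - f x - (y - x) *\<^sub>R f') / of_real (y - x)"
      by (simp add: scaleR_conv_of_real diff_divide_distrib)
    then show "norm ((f y - f x) / of_real (y - x) - f') = norm (f y - f x - (y - x) *\<^sub>R f') / norm (y - x)"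
      by (simp only: norm_divide norm_of_real real_norm_def)
  qed
  ultimately show "((\<lambda>y. norm (f y - f x - (y - x) *\<^sub>R f') / norm (y - x)) \<longlongrightarrow> 0) (at x)"
    by (rule Lim_transform_eventually)
qed

lemma segment_avg_norm_le:
  assumes "f \<in> smooth" "\<And>t. t \<in> {0..1} \<Longrightarrow> norm (f (y + t * (x - y))) \<le> C"
  shows "norm (segment_avg 0 y f x) \<le> C"
proof -
  have "norm (integral {0..1} (\<lambda>t. of_real (t ^ 0) * f (y + t * (x - y)))) \<le> integral {0..1} (\<lambda>t::real. C)"
    by (rule integral_norm_bound_integral) (use segment_avg_integrable[OF assms(1), of 0 y x] assms(2) in auto)
  then show ?thesis by (simp add: segment_avg_def)
qed

text \<open>The difference quotient of \<open>e\<close> is an average of its derivative over a segment. So it is dominated by the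
polynomial bound for the derivative, which the decay of \<open>g\<close> absorbs.\<close>

lemma dilation_integral_has_derivative:
  assumes k: "k \<ge> - 1 / 2" and g: "g \<in> schwartz" and e: "e \<in> smooth_in slow"
  shows "((\<lambda>\<xi>. \<integral>x. g x * e (- (\<xi> * x)) \<partial>dunkl_measure k) has_vector_derivative
     (\<integral>x. (- (of_real x * g x)) * real_deriv e (- (\<xi> * x)) \<partial>dunkl_measure k)) (at \<xi>)"
proof (rule has_vector_derivative_quotientI)
  let ?M = "dunkl_measure k"
  define F where "F \<xi> = (\<integral>x. g x * e (- (\<xi> * x)) \<partial>?M)" for \<xi>
  have es: "e \<in> smooth" and e's: "real_deriv e \<in> smooth"
    using smooth_in_smooth[OF e] smooth_in_smooth[OF smooth_inD(3)[OF e]] by auto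
  have int: "integrable ?M (\<lambda>x. g x * h (- (\<xi> * x)))" if h: "h \<in> smooth_in slow" and g: "g \<in> schwartz" for h g \<xi>
  proof (rule rapid_integrable[OF k])
    show "continuous_on UNIV (\<lambda>x. g x * h (- (\<xi> * x)))"
      by (intro continuous_intros schwartzD(4) g continuous_on_compose2[OF smooth_inD(5)[OF h, of UNIV]]) auto
    have "h \<in> slow" using h by (rule smooth_inD)
    then obtain C m where C: "\<And>x. norm (h x) \<le> C * (1 + \<bar>x\<bar>) ^ m" unfolding slow_def by blast
    have C0: "0 \<le> C" using order_trans[OF norm_ge_zero C[of 0]] by simp
    have "norm (h (- (\<xi> * x))) \<le> (C * (1 + \<bar>\<xi>\<bar>) ^ m) * (1 + \<bar>x\<bar>) ^ m" for x
    proof -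
      have "(1 + \<bar>- (\<xi> * x)\<bar>) ^ m \<le> ((1 + \<bar>\<xi>\<bar>) * (1 + \<bar>x\<bar>)) ^ m"
        by (intro power_mono) (auto simp: abs_mult algebra_simps)
      then have "C * (1 + \<bar>- (\<xi> * x)\<bar>) ^ m \<le> C * ((1 + \<bar>\<xi>\<bar>) * (1 + \<bar>x\<bar>)) ^ m"
        by (rule mult_left_mono[OF _ C0])
      with C[of "- (\<xi> * x)"] show ?thesis by (simp only: power_mult_distrib mult.assoc)
    qed
    then have "(\<lambda>x. h (- (\<xi> * x))) \<in> slow" unfolding slow_def by blast
    then show "(\<lambda>x. g x * h (- (\<xi> * x))) \<in> rapid"
      using slow_rapid_mult[OF _ schwartzD(2)[OF g], of "\<lambda>x. h (- (\<xi> * x))"] by (simp add: mult.commute)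
  qed
  have "(\<lambda>n. (F (X n) - F \<xi>) / of_real (X n - \<xi>)) \<longlonglongrightarrow>
      (\<integral>x. (- (of_real x * g x)) * real_deriv e (- (\<xi> * x)) \<partial>?M)"
    if X: "\<And>n. X n \<noteq> \<xi>" "X \<longlonglongrightarrow> \<xi>" for X
  proof -
    let ?s = "\<lambda>n x. (- (of_real x * g x)) * segment_avg 0 (- (\<xi> * x)) (real_deriv e) (- (X n * x))"
    have eq: "(F (X n) - F \<xi>) / of_real (X n - \<xi>) = (\<integral>x. ?s n x \<partial>?M)"
      and meas: "?s n \<in> borel_measurable ?M" for n
    proof -
      have pt: "(g x * e (- (X n * x)) - g x * e (- (\<xi> * x))) / of_real (X n - \<xi>) = ?s n x" for x
      proof -
        have "e (- (X n * x)) - e (- (\<xi> * x)) = of_real (X n - \<xi>) * (- of_real x * segment_avg 0 (- (\<xi> * x)) (real_deriv e) (- (X n * x)))"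
          using segment_avg_quotient[OF es, of "- (X n * x)" "- (\<xi> * x)"] by (simp add: algebra_simps)
        then have "g x * e (- (X n * x)) - g x * e (- (\<xi> * x)) = of_real (X n - \<xi>) * ?s n x"
          by (simp add: right_diff_distrib[symmetric] mult_ac)
        then show ?thesis using X(1)[of n] by simp
      qed
      have "F (X n) - F \<xi> = (\<integral>x. g x * e (- (X n * x)) - g x * e (- (\<xi> * x)) \<partial>?M)"
        unfolding F_def by (rule Bochner_Integration.integral_diff[symmetric]) (intro int e g)+
      then show "(F (X n) - F \<xi>) / of_real (X n - \<xi>) = (\<integral>x. ?s n x \<partial>?M)"
        unfolding pt[symmetric] by simp
      have "integrable ?M (\<lambda>x. (g x * e (- (X n * x)) - g x * e (- (\<xi> * x))) / of_real (X n - \<xi>))"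
        by (intro integrable_divide Bochner_Integration.integrable_diff int e g)
      then show "?s n \<in> borel_measurable ?M" unfolding pt by (rule borel_measurable_integrable)
    qed
    obtain B where B: "\<And>n. \<bar>X n\<bar> \<le> B" using convergent_imp_Bseq[OF convergentI[OF X(2)]] unfolding Bseq_def by auto
    define R where "R = max B \<bar>\<xi>\<bar>"
    have R: "\<bar>X n\<bar> \<le> R" "\<bar>\<xi>\<bar> \<le> R" "0 \<le> R" for n using B[of n] by (auto simp: R_def)
    have "real_deriv e \<in> slow" by (rule smooth_inD(1)[OF smooth_inD(3)[OF e]])
    then obtain C m where C: "\<And>x. norm (real_deriv e x) \<le> C * (1 + \<bar>x\<bar>) ^ m" unfolding slow_def by blast
    have C0: "0 \<le> C" using order_trans[OF norm_ge_zero C[of 0]] by simp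
    let ?W = "\<lambda>x::real. (C * (1 + R) ^ m) * (1 + \<bar>x\<bar>) ^ m"
    have avgle: "norm (segment_avg 0 (- (\<xi> * x)) (real_deriv e) (- (X n * x))) \<le> ?W x" for n x
    proof (rule segment_avg_norm_le[OF e's])
      fix t :: real assume t: "t \<in> {0..1}"
      let ?z = "- (\<xi> * x) + t * (- (X n * x) - - (\<xi> * x))"
      have z: "?z = - (((1 - t) * \<xi> + t * X n) * x)" by (simp add: algebra_simps)
      have "\<bar>(1 - t) * \<xi> + t * X n\<bar> \<le> (1 - t) * \<bar>\<xi>\<bar> + t * \<bar>X n\<bar>"
        using t by (intro order_trans[OF abs_triangle_ineq]) (auto simp: abs_mult)
      moreover have "\<dots> \<le> (1 - t) * R + t * R" using t R by (intro add_mono mult_left_mono) auto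
      moreover have "(1 - t) * R + t * R = R" by (simp add: algebra_simps)
      ultimately have "\<bar>(1 - t) * \<xi> + t * X n\<bar> \<le> R" by linarith
      then have "\<bar>?z\<bar> \<le> R * \<bar>x\<bar>" unfolding z abs_minus_cancel abs_mult by (rule mult_right_mono) simp
      then have "(1 + \<bar>?z\<bar>) ^ m \<le> ((1 + R) * (1 + \<bar>x\<bar>)) ^ m"
        using R by (intro power_mono) (auto simp: algebra_simps intro: add_increasing2)
      then have "C * (1 + \<bar>?z\<bar>) ^ m \<le> C * ((1 + R) * (1 + \<bar>x\<bar>)) ^ m" by (rule mult_left_mono[OF _ C0])
      with C[of ?z] show "norm (real_deriv e ?z) \<le> ?W x"
        by (simp only: power_mult_distrib mult.assoc)
    qed
    have "(\<lambda>n. \<integral>x. ?s n x \<partial>?M) \<longlonglongrightarrow> (\<integral>x. (- (of_real x * g x)) * real_deriv e (- (\<xi> * x)) \<partial>?M)"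
    proof (rule integral_dominated_convergence[where w = "\<lambda>x. norm (of_real (?W x) * (of_real x * g x))"])
      show "(\<lambda>x. (- (of_real x * g x)) * real_deriv e (- (\<xi> * x))) \<in> borel_measurable ?M"
        using int[OF smooth_inD(3)[OF e] schwartz_cmult[OF schwartz_x_mult[OF g], of "-1"]]
        by (intro borel_measurable_integrable) simp
      have "(\<lambda>x. of_real (?W x)) \<in> slow"
      proof -
        have "norm (of_real (?W x) :: complex) \<le> ?W x" for x
          unfolding norm_of_real using C0 R by (subst abs_of_nonneg) auto
        then show ?thesis unfolding slow_def by blast
      qed
      then have "(\<lambda>x. of_real (?W x) * (of_real x * g x)) \<in> rapid"
        by (rule slow_rapid_mult) (intro schwartzD(2) schwartz_x_mult g)
      then have "integrable ?M (\<lambda>x. of_real (?W x) * (of_real x * g x))"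
        by (intro rapid_integrable[OF k] continuous_intros schwartzD(4) g)
      then show "integrable ?M (\<lambda>x. norm (of_real (?W x) * (of_real x * g x)))"
        by (rule integrable_norm)
      show "AE x in ?M. (\<lambda>n. ?s n x) \<longlonglongrightarrow> (- (of_real x * g x)) * real_deriv e (- (\<xi> * x))"
      proof (rule AE_I2)
        fix x
        have "(\<lambda>n. segment_avg 0 (- (\<xi> * x)) (real_deriv e) (- (X n * x))) \<longlonglongrightarrow> segment_avg 0 (- (\<xi> * x)) (real_deriv e) (- (\<xi> * x))"
          by (intro isCont_tendsto_compose[OF smooth_inD(6)[OF segment_avg_smooth[OF e's]]] tendsto_intros X)
        then show "(\<lambda>n. ?s n x) \<longlonglongrightarrow> (- (of_real x * g x)) * real_deriv e (- (\<xi> * x))"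
          unfolding segment_avg_at_center by (intro tendsto_mult_left)
      qed
      show "AE x in ?M. norm (?s n x) \<le> norm (of_real (?W x) * (of_real x * g x))" for n
      proof (rule AE_I2)
        fix x
        have "norm (?s n x) = norm (of_real x * g x) * norm (segment_avg 0 (- (\<xi> * x)) (real_deriv e) (- (X n * x)))"
          by (simp only: norm_mult norm_minus_cancel)
        also have "\<dots> \<le> norm (of_real x * g x) * (?W x)"
          by (intro mult_left_mono avgle) auto
        also have "\<dots> = norm (of_real (?W x) * (of_real x * g x))"
        proof -
          have nn: "0 \<le> ?W x" using C0 R by simp
          show ?thesis
            unfolding norm_mult[of "of_real (?W x)" "of_real x * g x"]
              norm_of_real abs_of_nonneg[OF nn] by (rule mult.commute)
        qed
        finally show "norm (?s n x) \<le> norm (of_real (?W x) * (of_real x * g x))" .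
      qed
    qed (rule meas)
    then show ?thesis by (simp only: eq)
  qed
  then have "((\<lambda>\<eta>. (F \<eta> - F \<xi>) / of_real (\<eta> - \<xi>)) \<longlongrightarrow>
      (\<integral>x. (- (of_real x * g x)) * real_deriv e (- (\<xi> * x)) \<partial>?M)) (at \<xi>)"
    unfolding tendsto_at_iff_sequentially comp_def by auto
  then show "((\<lambda>\<eta>. ((\<integral>x. g x * e (- (\<eta> * x)) \<partial>?M) - (\<integral>x. g x * e (- (\<xi> * x)) \<partial>?M)) / of_real (\<eta> - \<xi>)) \<longlongrightarrow>
      (\<integral>x. (- (of_real x * g x)) * real_deriv e (- (\<xi> * x)) \<partial>?M)) (at \<xi>)"
    unfolding F_def .
qed

lemma dilation_integral_smooth:
  assumes k: "k \<ge> - 1 / 2" and g: "g \<in> schwartz" and e: "e \<in> smooth_in slow"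
  shows "(\<lambda>\<xi>. \<integral>x. g x * e (- (\<xi> * x)) \<partial>dunkl_measure k) \<in> smooth"
proof -
  let ?X = "{(\<lambda>\<xi>. \<integral>x. g x * e (- (\<xi> * x)) \<partial>dunkl_measure k) |g e. g \<in> schwartz \<and> e \<in> smooth_in slow}"
  show ?thesis
  proof (rule smooth_in_coinduct[where X = "?X"])
    fix F assume "F \<in> ?X"
    then obtain g e where F: "F = (\<lambda>\<xi>. \<integral>x. g x * e (- (\<xi> * x)) \<partial>dunkl_measure k)" and ge: "g \<in> schwartz" "e \<in> smooth_in slow" by blast
    have "(\<lambda>x. - (of_real x * g x)) \<in> schwartz"
      using schwartz_cmult[OF schwartz_x_mult[OF ge(1)], of "-1"] by simp
    then have "(\<lambda>\<xi>. \<integral>x. (- (of_real x * g x)) * real_deriv e (- (\<xi> * x)) \<partial>dunkl_measure k) \<in> ?X"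
      using smooth_inD(3)[OF ge(2)]
      by (intro CollectI exI[of _ "\<lambda>x. - (of_real x * g x)"] exI[of _ "real_deriv e"] conjI refl)
    then show "\<exists>F'\<in>?X. \<forall>\<xi>. (F has_vector_derivative F' \<xi>) (at \<xi>)"
      by (rule bexI[rotated]) (unfold F, intro allI dilation_integral_has_derivative k ge)
  qed (use g e in blast)+
qed

lemma dunkl_transform_smooth:
  "k \<ge> - 1 / 2 \<Longrightarrow> g \<in> schwartz \<Longrightarrow> dunkl_transform k g \<in> smooth"
  unfolding dunkl_transform_def[abs_def] by (intro dilation_integral_smooth dunkl_exp_smooth_slow) auto

text \<open>At the origin both sides are the derivative of the transform.\<close>

lemma dunkl_diff_dunkl_transform:
  assumes k: "k \<ge> - 1 / 2" and g: "g \<in> schwartz"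
  shows "dunkl_diff (dunkl_transform k g) \<xi> =
    (\<integral>x. (- (of_real x * g x)) * dunkl_diff (dunkl_exp k) (- (\<xi> * x)) \<partial>dunkl_measure k)"
proof (cases "\<xi> = 0")
  case True
  have sm: "dunkl_exp k \<in> smooth" by (rule smooth_in_smooth[OF dunkl_exp_smooth_slow[OF k]])
  have "real_deriv (dunkl_transform k g) 0 = (\<integral>x. (- (of_real x * g x)) * real_deriv (dunkl_exp k) (- (0 * x)) \<partial>dunkl_measure k)"
    unfolding dunkl_transform_def[abs_def] real_deriv_def[of "\<lambda>\<xi>. \<integral>x. g x * dunkl_exp k (- (\<xi> * x)) \<partial>dunkl_measure k"]
    by (rule vector_derivative_at[OF dilation_integral_has_derivative[OF k g dunkl_exp_smooth_slow[OF k]]])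
  then show ?thesis
    using True by (simp add: dunkl_diff_0[OF sm] dunkl_diff_0[OF dunkl_transform_smooth[OF k g]])
next
  case False
  let ?M = "dunkl_measure k"
  let ?d = "\<lambda>x. (g x * dunkl_exp k (- (\<xi> * x)) - g x * dunkl_exp k (- (- \<xi> * x))) / 2"
  let ?q = "\<lambda>x. (- (of_real x * g x)) * dunkl_diff (dunkl_exp k) (- (\<xi> * x))"
  have sm: "dunkl_exp k \<in> smooth" by (rule smooth_in_smooth[OF dunkl_exp_smooth_slow[OF k]])
  have int: "integrable ?M (\<lambda>x. g x * dunkl_exp k (- (\<xi> * x)))" for \<xi>
    by (intro dunkl_transform_integrable schwartz_integrable k g)
  have "of_real \<xi> * dunkl_diff (dunkl_transform k g) \<xi> = (dunkl_transform k g \<xi> - dunkl_transform k g (- \<xi>)) / 2"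
    by (simp add: dunkl_diff_mult[OF dunkl_transform_smooth[OF k g]] odd_part_def)
  also have "\<dots> = (\<integral>x. ?d x \<partial>?M)"
    unfolding dunkl_transform_def using Bochner_Integration.integral_diff[OF int int, of \<xi> "- \<xi>"] by simp
  also have "\<dots> = (\<integral>x. of_real \<xi> * (?q x) \<partial>?M)"
  proof (rule Bochner_Integration.integral_cong[OF refl])
    fix x
    have "?d x = g x * odd_part (dunkl_exp k) (- (\<xi> * x))"
      by (simp add: odd_part_def right_diff_distrib diff_divide_distrib)
    then show "?d x
        = of_real \<xi> * (?q x)"
      by (simp add: dunkl_diff_mult[OF sm, symmetric] mult_ac)
  qed
  also have "\<dots> = of_real \<xi> * (\<integral>x. ?q x \<partial>?M)"
    by (rule integral_mult_right_zero)
  finally show ?thesis using False unfolding mult_cancel_left of_real_eq_0_iff by blast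
qed

text \<open>The dual of \<open>dunkl_transform_dunkl_op\<close>, since the kernel is symmetric in its two variables.\<close>

lemma dunkl_op_dunkl_transform:
  assumes k: "k \<ge> - 1 / 2" and g: "g \<in> schwartz"
  shows "dunkl_op k (dunkl_transform k g) \<xi> = - \<i> * dunkl_transform k (\<lambda>x. of_real x * g x) \<xi>"
proof -
  let ?M = "dunkl_measure k" and ?e = "dunkl_exp k" and ?c = "of_real (2 * k + 1) :: complex"
  have sm: "?e \<in> smooth" by (rule smooth_in_smooth[OF dunkl_exp_smooth_slow[OF k]])
  have xg: "(\<lambda>x. - (of_real x * g x)) \<in> schwartz"
    using schwartz_cmult[OF schwartz_x_mult[OF g], of "-1"] by simp
  have int1: "integrable ?M (\<lambda>x. (- (of_real x * g x)) * ?e (- (\<xi> * x)))"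
    by (intro dunkl_transform_integrable schwartz_integrable k xg)
  have int2: "integrable ?M (\<lambda>x. (- (of_real x * g x)) * dunkl_diff ?e (- (\<xi> * x)))"
  proof (rule integrable_bounded_mult[OF schwartz_integrable[OF k xg]])
    show "(\<lambda>x. dunkl_diff ?e (- (\<xi> * x))) \<in> borel_measurable borel"
      by (intro borel_measurable_continuous_onI
        continuous_on_compose2[OF smooth_inD(5)[OF dunkl_diff_smooth[OF sm], of UNIV]] continuous_intros) auto
    have "\<bar>bessel_j (k + 1) z\<bar> \<le> 2 * (k + 1)" for z
      using norm_bessel_j_le[of "k + 1" z] k by simp
    then show "norm (dunkl_diff ?e (- (\<xi> * x))) \<le> 1" for x
      unfolding dunkl_diff_dunkl_exp[OF k] norm_mult norm_of_real using k
      by (simp add: abs_mult divide_le_eq)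
  qed
  have "real_deriv (dunkl_transform k g) \<xi> = (\<integral>x. (- (of_real x * g x)) * real_deriv ?e (- (\<xi> * x)) \<partial>?M)"
    unfolding dunkl_transform_def[abs_def] real_deriv_def[of "\<lambda>\<xi>. \<integral>x. g x * dunkl_exp k (- (\<xi> * x)) \<partial>dunkl_measure k"]
    by (rule vector_derivative_at[OF dilation_integral_has_derivative[OF k g dunkl_exp_smooth_slow[OF k]]])
  also have "\<dots> = (\<integral>x. \<i> * ((- (of_real x * g x)) * ?e (- (\<xi> * x)))
       - ?c * ((- (of_real x * g x)) * dunkl_diff ?e (- (\<xi> * x))) \<partial>?M)"
    unfolding real_deriv_dunkl_exp[OF k] dunkl_diff_dunkl_exp[OF k]
    by (intro Bochner_Integration.integral_cong refl) (simp only: right_diff_distrib mult.left_commute)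
  also have "\<dots> = \<i> * (\<integral>x. (- (of_real x * g x)) * ?e (- (\<xi> * x)) \<partial>?M)
       - ?c * (\<integral>x. (- (of_real x * g x)) * dunkl_diff ?e (- (\<xi> * x)) \<partial>?M)"
    by (subst Bochner_Integration.integral_diff) (intro integrable_mult_right int1 int2, intro integrable_mult_right int1 int2, simp only: integral_mult_right_zero)
  finally show ?thesis
    unfolding dunkl_op_eq[OF dunkl_transform_smooth[OF k g]] dunkl_diff_dunkl_transform[OF k g]
    by (simp add: dunkl_transform_def)
qed

text \<open>The operator that the Dunkl transform turns into multiplication by \<open>\<xi>\<close>.\<close>

definition dunkl_momentum :: "real \<Rightarrow> (real \<Rightarrow> complex) \<Rightarrow> real \<Rightarrow> complex" where
  "dunkl_momentum k f x = - \<i> * dunkl_op k f x"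

lemma dunkl_momentum_schwartz: "f \<in> schwartz \<Longrightarrow> dunkl_momentum k f \<in> schwartz"
  unfolding dunkl_momentum_def[abs_def] by (intro schwartz_cmult dunkl_op_schwartz)

lemma dunkl_transform_cmult: "dunkl_transform k (\<lambda>x. c * g x) \<xi> = c * dunkl_transform k g \<xi>"
  by (simp add: dunkl_transform_def mult.assoc)

lemma dunkl_transform_add:
  assumes "k \<ge> - 1 / 2" "f \<in> schwartz" "g \<in> schwartz"
  shows "dunkl_transform k (\<lambda>x. f x + g x) \<xi> = dunkl_transform k f \<xi> + dunkl_transform k g \<xi>"
  unfolding dunkl_transform_def distrib_right
  by (intro Bochner_Integration.integral_add dunkl_transform_integrable schwartz_integrable assms)

lemma dunkl_transform_momentum:
  assumes "k \<ge> - 1 / 2" "f \<in> smooth" "f \<in> rapid" "real_deriv f \<in> rapid"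
  shows "dunkl_transform k (dunkl_momentum k f) \<xi> = of_real \<xi> * dunkl_transform k f \<xi>"
  unfolding dunkl_momentum_def[abs_def] dunkl_transform_cmult dunkl_transform_dunkl_op[OF assms]
  by (simp flip: mult.assoc)

lemma dunkl_momentum_transform:
  assumes "k \<ge> - 1 / 2" "g \<in> schwartz"
  shows "dunkl_momentum k (dunkl_transform k g) \<xi> = - dunkl_transform k (\<lambda>x. of_real x * g x) \<xi>"
  by (simp add: dunkl_momentum_def dunkl_op_dunkl_transform[OF assms])

lemma dunkl_momentum_pow_schwartz: "f \<in> schwartz \<Longrightarrow> (dunkl_momentum k ^^ n) f \<in> schwartz"
  by (induction n) (auto intro: dunkl_momentum_schwartz)

lemma dunkl_transform_momentum_pow:
  assumes "k \<ge> - 1 / 2" "f \<in> schwartz"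
  shows "dunkl_transform k ((dunkl_momentum k ^^ n) f) \<xi> = of_real \<xi> ^ n * dunkl_transform k f \<xi>"
proof (induction n)
  case (Suc n)
  then show ?case
    using dunkl_transform_momentum[OF assms(1) schwartzD(1-3)[OF dunkl_momentum_pow_schwartz[OF assms(2)]]] by simp
qed simp

lemma dunkl_transform_rapid:
  assumes k: "k \<ge> - 1 / 2" and g: "g \<in> schwartz"
  shows "dunkl_transform k g \<in> rapid"
  unfolding rapid_iff
proof
  fix m
  have "norm (of_real (\<xi> ^ m) * dunkl_transform k g \<xi>) \<le> (\<integral>x. norm ((dunkl_momentum k ^^ m) g x) \<partial>dunkl_measure k)" for \<xi>
    using norm_dunkl_transform_le[where \<xi> = \<xi>, OF k schwartz_integrable[OF k dunkl_momentum_pow_schwartz[where n = m and k = k, OF g]]]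
    by (simp add: dunkl_transform_momentum_pow[OF k g])
  then show "bounded (range (\<lambda>\<xi>. of_real (\<xi> ^ m) * dunkl_transform k g \<xi>))"
    by (intro boundedI) auto
qed

text \<open>Only \<open>\<Lambda> (D g)\<close> is directly a transform; the ordinary derivative is recovered by subtracting the difference
quotient.\<close>

lemma dunkl_transform_deriv_rapid:
  assumes k: "k \<ge> - 1 / 2" and g: "g \<in> schwartz"
  shows "real_deriv (dunkl_transform k g) \<in> rapid"
proof -
  have "(\<lambda>\<xi>. (- \<i>) * dunkl_transform k (\<lambda>x. of_real x * g x) \<xi> + (- of_real (2 * k + 1)) * dunkl_diff (dunkl_transform k g) \<xi>) \<in> rapid"
    by (intro rapid_add slow_rapid_mult const_slow dunkl_transform_rapid dunkl_diff_rapid dunkl_transform_smooth schwartz_x_mult k g)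
  moreover have "(- \<i>) * dunkl_transform k (\<lambda>x. of_real x * g x) \<xi> + (- of_real (2 * k + 1)) * dunkl_diff (dunkl_transform k g) \<xi>
     = real_deriv (dunkl_transform k g) \<xi>" for \<xi>
    unfolding dunkl_op_dunkl_transform[OF k g, of \<xi>, symmetric] dunkl_op_eq[OF dunkl_transform_smooth[OF k g]]
    by (simp add: algebra_simps)
  ultimately show ?thesis by simp
qed

lemma dunkl_transform_reflect:
  assumes k: "k \<ge> - 1 / 2" and g: "g \<in> schwartz"
  shows "dunkl_transform k g (- \<xi>) = dunkl_transform k (\<lambda>x. g (- x)) \<xi>"
proof -
  have "(\<lambda>x. g x * dunkl_exp k (\<xi> * x)) \<in> borel_measurable borel"
    using borel_measurable_times[OF schwartzD(5)[OF g] dunkl_exp_scaled_measurable[OF k, of "- \<xi>"]] by simp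
  from dunkl_integral_reflect[OF k this] show ?thesis
    by (simp add: dunkl_transform_def)
qed

section \<open>Inversion and symmetry of the Dunkl transform\<close>

lemma real_deriv_gaussian: "real_deriv gaussian x = - of_real x * gaussian x"
proof -
  have "((\<lambda>x. poly 1 (of_real x) * exp ((-1/2 :: complex) * (of_real x)\<^sup>2)) has_vector_derivative
    poly (pderiv 1 + [:0, 2 * (-1/2):] * 1) (of_real x) * exp ((-1/2) * (of_real x)\<^sup>2)) (at x)"
    by (rule poly_chirp_has_derivative)
  then show ?thesis by (simp add: real_deriv_def gaussian_def[abs_def] vector_derivative_at)
qed

lemma dunkl_diff_even:
  assumes "\<And>x. f (- x) = f x" shows "dunkl_diff f x = 0"
proof -
  have "odd_part f = (\<lambda>x. 0)" by (auto simp: odd_part_def assms)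
  moreover have "real_deriv (\<lambda>x. 0) = (\<lambda>x. 0)" by (rule real_deriv_eqI) auto
  ultimately show ?thesis by (simp add: dunkl_diff_def segment_avg_def)
qed

text \<open>The Gaussian satisfies \<open>\<Lambda> G = - x G\<close>, and the exchange of \<open>\<Lambda>\<close> and \<open>x\<close> turns this into the same equation for its
transform. Both functions are even, so the equation is \<open>y' = - x y\<close>.\<close>

lemma dunkl_transform_gaussian:
  assumes k: "k \<ge> - 1 / 2"
  shows "dunkl_transform k gaussian \<xi> = dunkl_transform k gaussian 0 * gaussian \<xi>"
proof -
  let ?D = "dunkl_transform k gaussian"
  have G: "gaussian \<in> schwartz" by (rule gaussian_schwartz)
  have Geven: "gaussian (- x) = gaussian x" for x by (simp add: gaussian_def)
  have Deven: "?D (- x) = ?D x" for x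
    unfolding dunkl_transform_reflect[OF k G] Geven ..
  have "dunkl_op k gaussian = (\<lambda>x. (- 1) * (of_real x * gaussian x))"
    by (simp add: dunkl_op_eq[OF schwartzD(1)[OF G]] real_deriv_gaussian dunkl_diff_even[of gaussian, OF Geven])
  then have "\<i> * of_real \<xi> * ?D \<xi> = (- 1) * dunkl_transform k (\<lambda>x. of_real x * gaussian x) \<xi>" for \<xi>
    using dunkl_transform_dunkl_op[OF k schwartzD(1-3)[OF G], of \<xi>]
    unfolding dunkl_transform_cmult[symmetric] by simp
  then have "real_deriv ?D \<xi> = - of_real \<xi> * ?D \<xi>" for \<xi>
    using dunkl_op_dunkl_transform[OF k G, of \<xi>]
    by (simp add: dunkl_op_eq[OF dunkl_transform_smooth[OF k G]] dunkl_diff_even[of ?D, OF Deven] complex_eq_iff)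
  then have D': "(?D has_vector_derivative - of_real \<xi> * ?D \<xi>) (at \<xi>)" for \<xi>
    using smooth_inD(4)[OF dunkl_transform_smooth[OF k G], of \<xi>] by simp
  have e': "((\<lambda>x. exp ((of_real x)\<^sup>2 / 2) :: complex) has_vector_derivative of_real x * exp ((of_real x)\<^sup>2 / 2)) (at x)" for x
    using poly_chirp_has_derivative[of 1 "1/2" x] by simp
  have "((\<lambda>x. ?D x * exp ((of_real x)\<^sup>2 / 2)) has_vector_derivative 0) (at x within UNIV)" for x
    using has_vector_derivative_mult[OF D' e', of x] by (simp add: algebra_simps)
  then obtain c where c: "\<And>x. ?D x * exp ((of_real x)\<^sup>2 / 2) = c"
    using has_vector_derivative_zero_constant[of UNIV "\<lambda>x. ?D x * exp ((of_real x)\<^sup>2 / 2)"] by auto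
  have "?D \<xi> * exp ((of_real \<xi>)\<^sup>2 / 2) = ?D 0"
    using c[of \<xi>] c[of 0] by simp
  then have "?D \<xi> * (exp ((of_real \<xi>)\<^sup>2 / 2) * gaussian \<xi>) = ?D 0 * gaussian \<xi>"
    by (simp only: mult.assoc[symmetric])
  moreover have "exp ((of_real \<xi>)\<^sup>2 / 2) * gaussian \<xi> = 1"
    by (simp add: gaussian_def exp_add[symmetric])
  ultimately show ?thesis by simp
qed

text \<open>The density can vanish only at the origin, a null set.\<close>

lemma integral_pos_dunkl:
  fixes g :: "real \<Rightarrow> real"
  assumes k: "k \<ge> - 1 / 2" and g: "integrable (dunkl_measure k) g" "\<And>x. 0 \<le> g x"
    and pos: "a < b" "\<And>x. x \<in> {a<..<b} \<Longrightarrow> 0 < g x"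
  shows "0 < (\<integral>x. g x \<partial>dunkl_measure k)"
proof -
  have gm: "g \<in> borel_measurable borel"
    using borel_measurable_integrable[OF g(1)] by (simp add: measurable_dunkl_measure)
  have "(\<integral>x. g x \<partial>dunkl_measure k) \<noteq> 0"
  proof
    assume "(\<integral>x. g x \<partial>dunkl_measure k) = 0"
    then have "(\<integral>x. dunkl_weight k x *\<^sub>R g x \<partial>lborel) = 0" by (simp add: integral_dunkl[OF k gm])
    moreover have "integrable lborel (\<lambda>x. dunkl_weight k x *\<^sub>R g x)"
      using g(1) integrable_dunkl_iff[OF k gm] by simp
    ultimately have "AE x in lborel. dunkl_weight k x *\<^sub>R g x = 0"
      using integral_nonneg_eq_0_iff_AE[of lborel "\<lambda>x. dunkl_weight k x *\<^sub>R g x"] dunkl_weight_nonneg[OF k] g(2) by simp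
    moreover have "AE x in lborel. x \<noteq> (0::real)" by (rule AE_lborel_singleton)
    ultimately have "AE x in lborel. x \<notin> {a<..<b}"
    proof eventually_elim
      case (elim x)
      then show ?case using dunkl_weight_pos[OF k, of x] pos(2)[of x] by auto
    qed
    then have "emeasure lborel {a<..<b} = 0"
      using AE_iff_null_sets[of "{a<..<b}" lborel] by auto
    then show False using pos(1) by simp
  qed
  moreover have "0 \<le> (\<integral>x. g x \<partial>dunkl_measure k)" using g(2) by simp
  ultimately show ?thesis by simp
qed

lemma dunkl_transform_gaussian_0_nonzero:
  assumes k: "k \<ge> - 1 / 2" shows "dunkl_transform k gaussian 0 \<noteq> 0"
proof -
  have g: "gaussian x = of_real (exp (- x\<^sup>2 / 2))" for x
    by (simp add: gaussian_def exp_of_real[symmetric])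
  have "integrable (dunkl_measure k) (\<lambda>x. norm (gaussian x))"
    by (intro integrable_norm schwartz_integrable k gaussian_schwartz)
  then have "0 < (\<integral>x. exp (- x\<^sup>2 / 2) \<partial>dunkl_measure k)"
    by (intro integral_pos_dunkl[OF k, of _ 0 1]) (auto simp: g)
  moreover have "dunkl_transform k gaussian 0 = of_real (\<integral>x. exp (- x\<^sup>2 / 2) \<partial>dunkl_measure k)"
  proof -
    have "dunkl_exp k 0 = 1" using bessel_j_0[OF k] by (simp add: dunkl_exp_def bessel_odd_def complex_eq_iff)
    then show ?thesis by (simp add: dunkl_transform_def g flip: integral_complex_of_real)
  qed
  ultimately show ?thesis by simp
qed

text \<open>Subtracting from \<open>g\<close> the multiple of the Gaussian \<open>G\<close> that agrees with it at \<open>y\<close> leaves \<open>(x - y) h\<close> with \<open>h\<close>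
Schwartz. Two transforms turn \<open>x\<close> into \<open>- x\<close>, so this remainder contributes 0 at \<open>- y\<close>. The constant is
the squared eigenvalue of \<open>G\<close>.\<close>

theorem dunkl_inversion:
  assumes k: "k \<ge> - 1 / 2" and g: "g \<in> schwartz"
  shows "dunkl_transform k (dunkl_transform k g) (- y) = (dunkl_transform k gaussian 0)\<^sup>2 * g y"
proof -
  let ?D = "dunkl_transform k" and ?c = "dunkl_transform k gaussian 0"
  define \<alpha> where "\<alpha> = g y / gaussian y"
  have gy: "gaussian y \<noteq> 0" by (simp add: gaussian_def)
  have f: "(\<lambda>x. g x + (- \<alpha>) * gaussian x) \<in> schwartz"
    by (intro schwartz_add schwartz_cmult g gaussian_schwartz)
  \<comment> \<open>The quotient of \<open>g - \<alpha> G\<close> by \<open>x - y\<close>.\<close>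
  define h where "h = segment_avg 0 y (real_deriv (\<lambda>x. g x + (- \<alpha>) * gaussian x))"
  have hq: "of_real (x - y) * h x = g x + (- \<alpha>) * gaussian x" for x
    unfolding h_def segment_avg_quotient[OF schwartzD(1)[OF f]] using gy by (simp add: \<alpha>_def)
  have h: "h \<in> schwartz"
  proof (rule schwartz_divide)
    show "h \<in> smooth" unfolding h_def by (intro segment_avg_smooth smooth_inD(3) schwartzD(1) f)
    show "(\<lambda>x. of_real (x - y) * h x) \<in> schwartz" unfolding hq by (rule f)
  qed
  have "g = (\<lambda>x. \<alpha> * gaussian x + (of_real x * h x + (- of_real y) * h x))"
  proof
    show "g x = \<alpha> * gaussian x + (of_real x * h x + (- of_real y) * h x)" for x
      using hq[of x] by (simp add: algebra_simps)
  qed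
  then have "?D g \<xi> = ?D (\<lambda>x. \<alpha> * gaussian x + (of_real x * h x + (- of_real y) * h x)) \<xi>" for \<xi> by simp
  also have "\<dots> \<xi> = (\<alpha> * ?c) * gaussian \<xi> + (?D (\<lambda>x. of_real x * h x) \<xi> + (- of_real y) * ?D h \<xi>)" for \<xi>
    by (simp only: dunkl_transform_add[OF k] schwartz_cmult schwartz_add schwartz_x_mult gaussian_schwartz h
         dunkl_transform_cmult dunkl_transform_gaussian[OF k, of \<xi>] mult.assoc)
  finally have Dg: "?D g = (\<lambda>\<xi>. (\<alpha> * ?c) * gaussian \<xi> + ((- 1) * dunkl_momentum k (?D h) \<xi> + (- of_real y) * ?D h \<xi>))"
    by (auto simp: dunkl_momentum_transform[OF k h])
  have s: "?D h \<in> smooth" "?D h \<in> rapid" "real_deriv (?D h) \<in> rapid"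
    using dunkl_transform_smooth[OF k h] dunkl_transform_rapid[OF k h] dunkl_transform_deriv_rapid[OF k h] by auto
  have i1: "integrable (dunkl_measure k) (?D h)" by (intro rapid_integrable k s smooth_inD(5)[OF s(1)])
  have "dunkl_momentum k (?D h) = (\<lambda>\<xi>. (- 1) * ?D (\<lambda>x. of_real x * h x) \<xi>)"
    by (auto simp: dunkl_momentum_transform[OF k h])
  then have i2: "integrable (dunkl_measure k) (dunkl_momentum k (?D h))"
    using rapid_integrable[OF k smooth_inD(5)[OF dunkl_transform_smooth[OF k schwartz_x_mult[OF h]]]
       dunkl_transform_rapid[OF k schwartz_x_mult[OF h]]] by simp
  have add: "?D (\<lambda>x. a x + b x) \<xi> = ?D a \<xi> + ?D b \<xi>"
    if "integrable (dunkl_measure k) a" "integrable (dunkl_measure k) b" for a b \<xi>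
    unfolding dunkl_transform_def distrib_right
    by (intro Bochner_Integration.integral_add dunkl_transform_integrable k that)
  have "?D (?D g) (- y) = ?D (\<lambda>\<xi>. (\<alpha> * ?c) * gaussian \<xi> + ((- 1) * dunkl_momentum k (?D h) \<xi> + (- of_real y) * ?D h \<xi>)) (- y)"
    by (simp only: Dg)
  also have "\<dots> = (\<alpha> * ?c) * ?D gaussian (- y) + ((- 1) * ?D (dunkl_momentum k (?D h)) (- y) + (- of_real y) * ?D (?D h) (- y))"
    using i1 i2 schwartz_integrable[OF k gaussian_schwartz]
    by (simp only: add integrable_mult_right Bochner_Integration.integrable_add dunkl_transform_cmult)
  also have "\<dots> = (\<alpha> * ?c) * ?D gaussian (- y)"
    by (simp add: dunkl_transform_momentum[OF k s])
  also have "\<dots> = ?c\<^sup>2 * (\<alpha> * gaussian y)"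
    unfolding dunkl_transform_gaussian[OF k, of "- y"] by (simp add: power2_eq_square gaussian_def mult_ac)
  also have "\<alpha> * gaussian y = g y" using gy by (simp add: \<alpha>_def)
  finally show ?thesis .
qed

lemma dunkl_transform_symmetric:
  assumes k: "k \<ge> - 1 / 2" and u: "integrable (dunkl_measure k) u" and v: "integrable (dunkl_measure k) v"
  shows "(\<integral>\<xi>. dunkl_transform k u \<xi> * v \<xi> \<partial>dunkl_measure k) = (\<integral>x. u x * dunkl_transform k v x \<partial>dunkl_measure k)"
proof -
  let ?K = "\<lambda>\<xi> x. v \<xi> * u x * dunkl_exp k (- (\<xi> * x))"
  let ?M = "dunkl_measure k"
  interpret M: sigma_finite_measure ?M by (rule sigma_finite_dunkl_measure)
  interpret P: pair_sigma_finite ?M ?M ..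
  have um: "u \<in> borel_measurable ?M" "v \<in> borel_measurable ?M" using u v by auto
  have e2: "(\<lambda>p. dunkl_exp k (- (fst p * snd p))) \<in> borel_measurable (?M \<Otimes>\<^sub>M ?M)"
    by (rule measurable_compose[OF _ dunkl_exp_measurable[OF k]]) measurable
  have int: "integrable (?M \<Otimes>\<^sub>M ?M) (\<lambda>(\<xi>, x). ?K \<xi> x)"
  proof (rule Bochner_Integration.integrable_bound)
    show "integrable (?M \<Otimes>\<^sub>M ?M) (\<lambda>(\<xi>, x). v \<xi> * u x)"
    proof (rule P.Fubini_integrable)
      show "(\<lambda>(\<xi>, x). v \<xi> * u x) \<in> borel_measurable (?M \<Otimes>\<^sub>M ?M)" using um by measurable
      have "integrable ?M (\<lambda>x. norm (v x) * (\<integral>y. norm (u y) \<partial>?M))"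
        using v by (intro integrable_mult_left integrable_norm)
      then show "integrable ?M (\<lambda>x. \<integral>y. norm (case (x, y) of (\<xi>, x) \<Rightarrow> v \<xi> * u x) \<partial>?M)"
        by (simp add: norm_mult)
      show "AE x in ?M. integrable ?M (\<lambda>y. case (x, y) of (\<xi>, x) \<Rightarrow> v \<xi> * u x)" using u by simp
    qed
    show "(\<lambda>(\<xi>, x). ?K \<xi> x) \<in> borel_measurable (?M \<Otimes>\<^sub>M ?M)"
      using um e2 unfolding split_beta by measurable
    show "AE x in ?M \<Otimes>\<^sub>M ?M. norm (case x of (\<xi>, x) \<Rightarrow> ?K \<xi> x) \<le> norm (case x of (\<xi>, x) \<Rightarrow> v \<xi> * u x)"
      by (intro AE_I2) (auto simp: norm_mult intro!: mult_left_le norm_dunkl_exp_le k)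
  qed
  have "(\<integral>\<xi>. dunkl_transform k u \<xi> * v \<xi> \<partial>?M) = (\<integral>\<xi>. (\<integral>x. ?K \<xi> x \<partial>?M) \<partial>?M)"
    by (simp only: dunkl_transform_def mult.assoc integral_mult_right_zero mult.commute[of _ "v _"])
  also have "\<dots> = (\<integral>x. (\<integral>\<xi>. ?K \<xi> x \<partial>?M) \<partial>?M)"
    by (rule P.Fubini_integral[OF int, symmetric])
  also have "\<dots> = (\<integral>x. u x * dunkl_transform k v x \<partial>?M)"
    unfolding dunkl_transform_def integral_mult_right_zero[symmetric] by (simp add: mult_ac)
  finally show ?thesis .
qed

section \<open>Decay of transforms of compactly supported functions\<close>

lemma compact_support_bounded:
  fixes F :: "real \<Rightarrow> complex"
  assumes "continuous_on UNIV F" "\<And>x. R < \<bar>x\<bar> \<Longrightarrow> F x = 0"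
  obtains B where "0 \<le> B" "\<And>x. norm (F x) \<le> B"
proof -
  have "compact (F ` {-R..R})"
    by (intro compact_continuous_image continuous_on_subset[OF assms(1)]) auto
  then obtain B where B: "\<And>x. x \<in> {-R..R} \<Longrightarrow> norm (F x) \<le> B"
    by (meson bounded_iff compact_imp_bounded imageI)
  have "norm (F x) \<le> max B 0" for x
  proof (cases "R < \<bar>x\<bar>")
    case True
    then show ?thesis using assms(2) by simp
  next
    case False
    then have "x \<in> {-R..R}" by auto
    then show ?thesis using B[of x] by linarith
  qed
  then show ?thesis by (intro that[of "max B 0"]) auto
qed

lemma compact_support_schwartz:
  assumes "F \<in> smooth" "\<And>x. R < \<bar>x\<bar> \<Longrightarrow> F x = 0"
  shows "F \<in> schwartz"
proof -
  let ?X = "{F \<in> smooth. \<forall>x. R < \<bar>x\<bar> \<longrightarrow> F x = 0}"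
  show ?thesis unfolding schwartz_eq
  proof (rule smooth_in_coinduct[where X = "?X"])
    show "?X \<subseteq> rapid"
    proof
      fix F assume "F \<in> ?X"
      then have F: "F \<in> smooth" "\<And>x. R < \<bar>x\<bar> \<Longrightarrow> F x = 0" by auto
      obtain B where B: "0 \<le> B" "\<And>x. norm (F x) \<le> B"
        using compact_support_bounded[OF smooth_inD(5)[OF F(1)] F(2)] by blast
      have "(1 + \<bar>x\<bar>) ^ m * norm (F x) \<le> (1 + \<bar>R\<bar>) ^ m * B" for x m
      proof (cases "R < \<bar>x\<bar>")
        case False
        then show ?thesis by (intro mult_mono power_mono B) auto
      qed (use F B in auto)
      then show "F \<in> rapid" unfolding rapid_def by blast
    qed
    show "\<exists>F'\<in>?X. \<forall>x. (F has_vector_derivative F' x) (at x)"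
      if "F \<in> ?X" for F
    proof (rule bexI[of _ "real_deriv F"])
      have F: "F \<in> smooth" "\<And>x. R < \<bar>x\<bar> \<Longrightarrow> F x = 0" using that by auto
      show "\<forall>x. (F has_vector_derivative real_deriv F x) (at x)" using smooth_inD(4)[OF F(1)] by blast
      have "real_deriv F x = 0" if "R < \<bar>x\<bar>" for x
        by (rule real_deriv_zero_outside[OF F(1), of "{-R..R}"]) (use F(2) that in auto)
      then show "real_deriv F \<in> ?X"
        using smooth_inD(3)[OF F(1)] by auto
    qed
  qed (use assms in auto)
qed

text \<open>A factor \<open>\<xi>\<close> in front of the transform is one application of \<open>- \<i> \<Lambda>\<close> to \<open>F\<close>, which keeps the support in
\<open>[- R, R]\<close> and costs one derivative. The constant depends on \<open>R\<close> and \<open>N\<close> only, which is what makes the bound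
useful for a sequence of functions.\<close>

lemma dunkl_transform_decay:
  assumes k: "k \<ge> - 1 / 2" and R: "0 \<le> R"
  obtains K where "0 \<le> K" "\<And>F C \<xi>. F \<in> smooth \<Longrightarrow> (\<And>x. R < \<bar>x\<bar> \<Longrightarrow> F x = 0) \<Longrightarrow>
    Ck_in (bounded_by C) N F \<Longrightarrow> (1 + \<bar>\<xi>\<bar>) ^ N * norm (dunkl_transform k F \<xi>) \<le> K * C"
proof
  let ?M = "dunkl_measure k"
  define A where "A = (\<integral>x. indicator {-R..R} x \<partial>?M :: real)"
  have iA: "integrable ?M (indicator {-R..R} :: real \<Rightarrow> real)"
  proof (rule dunkl_integrableI[OF k])
    show "(1 + \<bar>x\<bar>) ^ decay_exponent k * norm (indicator {-R..R} x :: real) \<le> (1 + R) ^ decay_exponent k" for x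
      using R by (cases "x \<in> {-R..R}") (auto intro!: power_mono)
  qed auto
  have A0: "0 \<le> A" unfolding A_def by simp
  show "0 \<le> 2 ^ N * (A * (1 + (2 * k + 2) ^ N))" using A0 k by simp
  fix F C \<xi>
  let ?n = "norm (dunkl_transform k F \<xi>)"
  assume F: "F \<in> smooth" "\<And>x. R < \<bar>x\<bar> \<Longrightarrow> F x = 0" "Ck_in (bounded_by C) N F"
  have FS: "F \<in> schwartz" by (rule compact_support_schwartz[OF F(1,2)])
  have it: "(dunkl_momentum k ^^ m) F \<in> smooth \<and> (\<forall>x. R < \<bar>x\<bar> \<longrightarrow> (dunkl_momentum k ^^ m) F x = 0) \<and>
     Ck_in (bounded_by ((2 * k + 2) ^ m * C)) (N - m) ((dunkl_momentum k ^^ m) F)" if "m \<le> N" for m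
    using that
  proof (induction m)
    case (Suc m)
    let ?G = "(dunkl_momentum k ^^ m) F"
    have G: "?G \<in> smooth" "\<And>x. R < \<bar>x\<bar> \<Longrightarrow> ?G x = 0" "Ck_in (bounded_by ((2 * k + 2) ^ m * C)) (N - m) ?G"
      using Suc by auto
    have "N - m = Suc (N - Suc m)" using Suc.prems by simp
    then have "Ck_in (bounded_by ((2 * k + 2) * ((2 * k + 2) ^ m * C))) (N - Suc m) (dunkl_op k ?G)"
      using G(3) by (intro Ck_in_dunkl_op[OF G(1) _ k]) simp
    from Ck_in_bounded_cmult[OF this, of "- \<i>"]
    have "Ck_in (bounded_by ((2 * k + 2) ^ Suc m * C)) (N - Suc m) (dunkl_momentum k ?G)"
      by (simp add: dunkl_momentum_def[abs_def] mult_ac)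
    moreover have "dunkl_momentum k ?G \<in> smooth"
      using smooth_cmult[OF dunkl_op_smooth[OF G(1)], of "- \<i>" k] by (simp add: dunkl_momentum_def[abs_def])
    moreover have "dunkl_momentum k ?G x = 0" if "R < \<bar>x\<bar>" for x
      using dunkl_op_zero_outside[OF G(1) G(2) that R] by (simp add: dunkl_momentum_def)
    ultimately show ?case by simp
  qed (use F in auto)
  have *: "\<bar>\<xi>\<bar> ^ m * ?n \<le> A * (2 * k + 2) ^ m * C" if "m \<le> N" for m
  proof -
    let ?G = "(dunkl_momentum k ^^ m) F"
    have "?G \<in> bounded_by ((2 * k + 2) ^ m * C)" using it[OF that] Ck_in_base by blast
    then have G: "norm (?G x) \<le> (2 * k + 2) ^ m * C" for x unfolding bounded_by_def by blast
    have Gi: "norm (?G x) \<le> (2 * k + 2) ^ m * C * indicator {-R..R} x" for x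
    proof (cases "R < \<bar>x\<bar>")
      case True
      then show ?thesis using it[OF that] by (auto simp: indicator_def)
    next
      case False
      then have "x \<in> {-R..R}" by auto
      then show ?thesis using G[of x] by simp
    qed
    have "norm (of_real \<xi> ^ m * dunkl_transform k F \<xi>) \<le> (\<integral>x. norm (?G x) \<partial>?M)"
      using norm_dunkl_transform_le[where \<xi> = \<xi>, OF k schwartz_integrable[OF k dunkl_momentum_pow_schwartz[where n = m and k = k, OF FS]]]
      by (simp add: dunkl_transform_momentum_pow[OF k FS])
    also have "\<dots> \<le> (\<integral>x. (2 * k + 2) ^ m * C * indicator {-R..R} x \<partial>?M)"
      by (intro integral_mono integrable_norm schwartz_integrable k dunkl_momentum_pow_schwartz FS integrable_mult_right iA Gi)
    also have "\<dots> = (2 * k + 2) ^ m * C * A" unfolding A_def by simp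
    finally show ?thesis by (simp add: norm_mult norm_power mult_ac)
  qed
  have "(1 + \<bar>\<xi>\<bar>) ^ N * ?n \<le> (2 ^ N * (1 + \<bar>\<xi>\<bar> ^ N)) * ?n"
    by (intro mult_right_mono one_plus_abs_power_le) auto
  also have "\<dots> = 2 ^ N * (\<bar>\<xi>\<bar> ^ 0 * ?n + \<bar>\<xi>\<bar> ^ N * ?n)"
    by (simp add: algebra_simps)
  also have "\<dots> \<le> 2 ^ N * (A * (2 * k + 2) ^ 0 * C + A * (2 * k + 2) ^ N * C)"
    by (intro mult_left_mono add_mono *) auto
  also have "\<dots> = 2 ^ N * (A * (1 + (2 * k + 2) ^ N)) * C" by (simp add: algebra_simps)
  finally show "(1 + \<bar>\<xi>\<bar>) ^ N * ?n \<le> 2 ^ N * (A * (1 + (2 * k + 2) ^ N)) * C" .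
qed

lemma smooth_power: "q \<in> smooth \<Longrightarrow> (\<lambda>x. q x ^ n) \<in> smooth"
proof (induction n)
  case 0
  then show ?case using smooth_in_smooth[OF const_smooth_slow[of 1]] by simp
next
  case (Suc n)
  then show ?case using smooth_mult[of q "\<lambda>x. q x ^ n"] by simp
qed

lemma bounded_by_mono: "C \<le> D \<Longrightarrow> bounded_by C \<subseteq> bounded_by D"
  unfolding bounded_by_def by (auto intro: order_trans)

text \<open>The derivative of \<open>q\<^sup>n \<phi>\<close> is \<open>n q\<^sup>n\<^sup>-\<^sup>1 (q' \<phi>) + q\<^sup>n \<phi>'\<close>, and both \<open>q' \<phi>\<close> and \<open>\<phi>'\<close> vanish outside of \<open>K\<close> again. So
each derivative costs one factor \<open>n\<close> and leaves the exponential rate \<open>\<rho>\<close> unchanged.\<close>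

lemma Ck_in_power_mult:
  assumes q: "q \<in> smooth" and K: "closed K" "K \<subseteq> {-R..R}" "\<And>x. x \<in> K \<Longrightarrow> norm (q x) \<le> \<rho>" and \<rho>: "0 < \<rho>"
    and \<phi>: "\<phi> \<in> smooth" "\<And>x. x \<notin> K \<Longrightarrow> \<phi> x = 0"
  shows "\<exists>C\<ge>0. \<forall>n. Ck_in (bounded_by (C * (real n + 1) ^ j * \<rho> ^ n)) j (\<lambda>x. q x ^ n * \<phi> x)"
  using \<phi>
proof (induction j arbitrary: \<phi>)
  case 0
  have "\<phi> x = 0" if "R < \<bar>x\<bar>" for x
  proof (rule 0(2))
    show "x \<notin> K"
    proof
      assume "x \<in> K"
      then have "x \<in> {-R..R}" using K(2) by blast
      then show False using that by auto
    qed
  qed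
  then obtain B where B: "0 \<le> B" "\<And>x. norm (\<phi> x) \<le> B"
    using compact_support_bounded[OF smooth_inD(5)[OF 0(1)]] by metis
  have "Ck_in (bounded_by (B * (real n + 1) ^ 0 * \<rho> ^ n)) 0 (\<lambda>x. q x ^ n * \<phi> x)" for n
  proof (rule Ck_in_0I[OF smooth_inD(4)[OF smooth_mult[OF smooth_power[OF q] 0(1)]]])
    have "norm (q x ^ n * \<phi> x) \<le> B * \<rho> ^ n" for x
    proof (cases "x \<in> K")
      case True
      have "norm (q x) ^ n * norm (\<phi> x) \<le> \<rho> ^ n * B"
        by (intro mult_mono power_mono K(3) True B) (use \<rho> in auto)
      then show ?thesis by (simp add: norm_mult norm_power mult.commute)
    next
      case False
      then show ?thesis using 0(2) B \<rho> by simp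
    qed
    then show "(\<lambda>x. q x ^ n * \<phi> x) \<in> bounded_by (B * (real n + 1) ^ 0 * \<rho> ^ n)" by (simp add: bounded_by_def)
  qed
  then show ?case using B(1) by blast
next
  case (Suc j)
  obtain C0 where C0: "0 \<le> C0" "\<And>n. Ck_in (bounded_by (C0 * (real n + 1) ^ j * \<rho> ^ n)) j (\<lambda>x. q x ^ n * \<phi> x)"
    using Suc.IH[OF Suc.prems] by blast
  have "(\<lambda>x. real_deriv q x * \<phi> x) \<in> smooth" by (intro smooth_mult smooth_inD(3) q Suc.prems(1))
  from Suc.IH[OF this] Suc.prems(2)
  obtain C1 where C1: "0 \<le> C1" "\<And>n. Ck_in (bounded_by (C1 * (real n + 1) ^ j * \<rho> ^ n)) j (\<lambda>x. q x ^ n * (real_deriv q x * \<phi> x))"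
    by auto
  have "real_deriv \<phi> x = 0" if "x \<notin> K" for x
    by (rule real_deriv_zero_outside[OF Suc.prems(1) K(1) Suc.prems(2) that])
  from Suc.IH[OF smooth_inD(3)[OF Suc.prems(1)] this]
  obtain C2 where C2: "0 \<le> C2" "\<And>n. Ck_in (bounded_by (C2 * (real n + 1) ^ j * \<rho> ^ n)) j (\<lambda>x. q x ^ n * real_deriv \<phi> x)"
    by auto
  define C where "C = C0 + C1 / \<rho> + C2"
  let ?d = "\<lambda>\<phi> n x. of_nat n * (q x ^ (n - 1) * (real_deriv q x * \<phi> x)) + q x ^ n * real_deriv \<phi> x"
  have "Ck_in (bounded_by (C * (real n + 1) ^ Suc j * \<rho> ^ n)) (Suc j) (\<lambda>x. q x ^ n * \<phi> x)" for n
  proof (rule Ck_in_SucI)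
    have pos: "0 \<le> (real n + 1) ^ j * \<rho> ^ n" "(real n + 1) ^ j * \<rho> ^ n \<le> (real n + 1) ^ Suc j * \<rho> ^ n"
      using \<rho> by (auto intro!: mult_right_mono)
    show "((\<lambda>x. q x ^ n * \<phi> x) has_vector_derivative
      (?d \<phi> n x)) (at x)" for x
    proof -
      have "((\<lambda>x. q x ^ n) has_vector_derivative of_nat n * (real_deriv q x * q x ^ (n - 1))) (at x)"
        using has_derivative_power[OF smooth_inD(4)[OF q, of x, unfolded has_vector_derivative_def], of n]
        unfolding has_vector_derivative_def by (simp add: scaleR_conv_of_real mult_ac)
      from has_vector_derivative_mult[OF this smooth_inD(4)[OF Suc.prems(1)]]
      show ?thesis by (simp add: algebra_simps)
    qed
    have le1: "C0 * (real n + 1) ^ j * \<rho> ^ n \<le> C * (real n + 1) ^ Suc j * \<rho> ^ n"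
    proof -
      have "C0 * ((real n + 1) ^ j * \<rho> ^ n) \<le> C * ((real n + 1) ^ Suc j * \<rho> ^ n)"
        using C0(1) C1(1) C2(1) \<rho> by (intro mult_mono pos) (auto simp: C_def)
      then show ?thesis by (simp only: mult.assoc)
    qed
    show "(\<lambda>x. q x ^ n * \<phi> x) \<in> bounded_by (C * (real n + 1) ^ Suc j * \<rho> ^ n)"
      using Ck_in_base[OF C0(2)[of n]] bounded_by_mono[OF le1] by blast
    have "Ck_in (bounded_by (norm (of_nat n :: complex) * (C1 * (real (n - 1) + 1) ^ j * \<rho> ^ (n - 1)) + C2 * (real n + 1) ^ j * \<rho> ^ n)) j
      (\<lambda>x. ?d \<phi> n x)"
      by (intro Ck_in_bounded_add Ck_in_bounded_cmult C1 C2)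
    moreover have "norm (of_nat n :: complex) * (C1 * (real (n - 1) + 1) ^ j * \<rho> ^ (n - 1)) + C2 * (real n + 1) ^ j * \<rho> ^ n
        \<le> C * (real n + 1) ^ Suc j * \<rho> ^ n"
    proof -
      have "real n * (C1 * (real (n - 1) + 1) ^ j * \<rho> ^ (n - 1)) \<le> (C1 / \<rho>) * ((real n + 1) ^ Suc j * \<rho> ^ n)"
      proof (cases n)
        case (Suc m)
        have "real n * (C1 * (real (n - 1) + 1) ^ j * \<rho> ^ (n - 1)) = (C1 / \<rho>) * (real n ^ Suc j * \<rho> ^ n)"
          using Suc \<rho> by (simp add: mult_ac add.commute)
        also have "\<dots> \<le> (C1 / \<rho>) * ((real n + 1) ^ Suc j * \<rho> ^ n)"
          using C1(1) \<rho> by (intro mult_left_mono mult_right_mono power_mono) auto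
        finally show ?thesis .
      qed (use C1(1) \<rho> in auto)
      moreover have "C2 * ((real n + 1) ^ j * \<rho> ^ n) \<le> C2 * ((real n + 1) ^ Suc j * \<rho> ^ n)"
        using C2(1) by (intro mult_left_mono pos)
      moreover have "0 \<le> C0 * ((real n + 1) ^ Suc j * \<rho> ^ n)" using C0(1) \<rho> by simp
      moreover have "C * (real n + 1) ^ Suc j * \<rho> ^ n = C0 * ((real n + 1) ^ Suc j * \<rho> ^ n) + (C1 / \<rho>) * ((real n + 1) ^ Suc j * \<rho> ^ n) + C2 * ((real n + 1) ^ Suc j * \<rho> ^ n)"
        by (simp only: C_def distrib_right mult.assoc)
      ultimately show ?thesis unfolding norm_of_nat mult.assoc by linarith
    qed
    ultimately show "Ck_in (bounded_by (C * (real n + 1) ^ Suc j * \<rho> ^ n)) j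
      (\<lambda>x. ?d \<phi> n x)"
      using Ck_in_mono bounded_by_mono by blast
  qed
  moreover have "0 \<le> C" using C0 C1 C2 \<rho> by (simp add: C_def)
  ultimately show ?case by blast
qed

section \<open>Smooth bump functions\<close>

text \<open>The functions \<open>p (1 / x) exp (- 1 / x)\<close> for \<open>x > 0\<close>, continued by 0, form a family closed under
differentiation.\<close>

definition flat_fun :: "complex poly \<Rightarrow> real \<Rightarrow> complex" where
  "flat_fun p x = (if 0 < x then poly p (of_real (1 / x)) * of_real (exp (- 1 / x)) else 0)"

lemma flat_fun_has_derivative:
  "(flat_fun p has_vector_derivative flat_fun ([:0, 0, 1:] * (p - pderiv p)) x) (at x)"
proof -
  let ?q = "[:0, 0, 1:] * (p - pderiv p)"
  consider "0 < x" | "x < 0" | "x = 0" by linarith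
  then show ?thesis
  proof cases
    case 1
    have "((\<lambda>z. poly p (1 / z) * exp (- 1 / z)) has_field_derivative
        poly (?q) (1 / of_real x) * exp (- 1 / of_real x)) (at (of_real x))"
      using 1
    proof -
      have "((\<lambda>z. 1 / z) has_field_derivative - (1 / (of_real x)\<^sup>2)) (at (of_real x :: complex))"
        using 1 by (auto intro!: derivative_eq_intros simp: power2_eq_square)
      from DERIV_chain2[OF poly_DERIV this, of p]
      have d1: "((\<lambda>z. poly p (1 / z)) has_field_derivative
          poly (pderiv p) (1 / of_real x) * - (1 / (of_real x)\<^sup>2)) (at (of_real x))" .
      have d2: "((\<lambda>z. exp (- 1 / z)) has_field_derivative exp (- 1 / of_real x) * (1 / (of_real x)\<^sup>2)) (at (of_real x :: complex))"
        using 1 by (auto intro!: derivative_eq_intros simp: power2_eq_square)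
      show ?thesis
        using DERIV_mult'[OF d1 d2] by (simp add: algebra_simps power2_eq_square)
    qed
    then have "((\<lambda>x. poly p (1 / of_real x) * exp (- 1 / of_real x)) has_vector_derivative
        poly (?q) (1 / of_real x) * exp (- 1 / of_real x)) (at x)"
      by (rule has_vector_derivative_real_field)
    then have "((\<lambda>x. poly p (of_real (1 / x)) * of_real (exp (- 1 / x))) has_vector_derivative
        flat_fun (?q) x) (at x)"
      using 1 by (simp add: flat_fun_def exp_of_real[symmetric])
    then show ?thesis
      by (rule has_vector_derivative_transform_within_open[of _ _ _ "{0<..}"]) (use 1 in \<open>auto simp: flat_fun_def\<close>)
  next
    case 2
    have "((\<lambda>x. 0) has_vector_derivative flat_fun (?q) x) (at x)"
      using 2 by (simp add: flat_fun_def)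
    then show ?thesis
      by (rule has_vector_derivative_transform_within_open[of _ _ _ "{..<0}"]) (use 2 in \<open>auto simp: flat_fun_def\<close>)
  next
    case 3
    obtain C m where C: "\<And>t::real. norm (poly p (of_real t)) \<le> C * (1 + \<bar>t\<bar>) ^ m"
      using poly_slow[of p] unfolding slow_def by blast
    have C0: "0 \<le> C" using order_trans[OF norm_ge_zero C[of 0]] by simp
    \<comment> \<open>With \<open>t = 1 / y\<close>, the bound \<open>(1 + t)\<^sup>m\<^sup>+\<^sup>2 \<le> (m + 2)! exp (1 + t)\<close> leaves a factor \<open>y\<close> to spare.\<close>
    define L where "L = C * (fact (m + 2) * exp 1)"
    have "norm (flat_fun p y / of_real y) \<le> L * \<bar>y\<bar>" for y
    proof (cases "0 < y")
      case True
      define t where "t = 1 / y"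
      have t: "0 < t" using True by (simp add: t_def)
      have "norm (flat_fun p y / of_real y) = norm (poly p (of_real t)) * exp (- t) * t"
        using True by (simp add: flat_fun_def t_def norm_mult norm_divide)
      also have "\<dots> \<le> (C * (1 + t) ^ m) * exp (- t) * t"
        using C[of t] t by (intro mult_right_mono) auto
      also have "\<dots> = C * ((1 + t) ^ m * t * t) * exp (- t) * y"
        using True by (simp add: t_def)
      also have "\<dots> \<le> C * (fact (m + 2) * exp (1 + t)) * exp (- t) * y"
      proof -
        have "(1 + t) ^ m * t * t \<le> (1 + t) ^ m * (1 + t) * (1 + t)"
          using t by (intro mult_mono) auto
        also have "\<dots> = (1 + t) ^ (m + 2)" by (simp add: power_add power2_eq_square)
        also have "\<dots> \<le> fact (m + 2) * exp (1 + t)" using t by (intro exp_ge_power) auto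
        finally show ?thesis using C0 True by (intro mult_right_mono mult_left_mono) auto
      qed
      also have "\<dots> = L * \<bar>y\<bar>" using True by (simp add: L_def exp_add exp_minus)
      finally show ?thesis .
    next
      case False
      have "0 \<le> L" using C0 by (simp add: L_def)
      then show ?thesis using False by (simp add: flat_fun_def mult_nonneg_nonpos)
    qed
    then have "\<forall>\<^sub>F y in at 0. norm (flat_fun p y / of_real y) \<le> L * \<bar>y\<bar>"
      by (intro always_eventually allI)
    moreover have "((\<lambda>y. L * \<bar>y\<bar>) \<longlongrightarrow> 0) (at 0)"
      by (intro tendsto_mult_right_zero tendsto_rabs_zero tendsto_ident_at)
    ultimately have "((\<lambda>y. flat_fun p y / of_real y) \<longlongrightarrow> 0) (at 0)"
      by (rule Lim_null_comparison)
    then show ?thesis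
      using 3 by (intro has_vector_derivative_quotientI) (simp add: flat_fun_def)
  qed
qed

lemma flat_fun_smooth: "flat_fun p \<in> smooth"
  by (rule smooth_in_coinduct[where X = "range flat_fun"]) (use flat_fun_has_derivative in auto)

lemma bump_exists:
  obtains \<eta> :: "real \<Rightarrow> real" where "(\<lambda>x. of_real (\<eta> x)) \<in> smooth" "\<And>x. 0 \<le> \<eta> x"
    "\<And>x. 0 < \<eta> x \<longleftrightarrow> a < x \<and> x < b"
proof
  let ?\<beta> = "\<lambda>x::real. if 0 < x then exp (- 1 / x) else 0"
  have \<beta>: "flat_fun 1 x = of_real (?\<beta> x)" for x by (simp add: flat_fun_def)
  have "(\<lambda>x. flat_fun 1 (1 * x + (- a)) * flat_fun 1 ((-1) * x + b)) \<in> smooth"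
    by (rule smooth_mult[OF smooth_affine[OF flat_fun_smooth] smooth_affine[OF flat_fun_smooth]])
  then have "(\<lambda>x. flat_fun 1 (x - a) * flat_fun 1 (b - x)) \<in> smooth" by simp
  then show "(\<lambda>x. of_real (?\<beta> (x - a) * ?\<beta> (b - x))) \<in> smooth"
    unfolding \<beta> of_real_mult[symmetric] .
  show "0 \<le> ?\<beta> (x - a) * ?\<beta> (b - x)" for x by simp
  show "0 < ?\<beta> (x - a) * ?\<beta> (b - x) \<longleftrightarrow> a < x \<and> x < b" for x by simp
qed

lemma smooth_cnj:
  assumes "f \<in> smooth" shows "(\<lambda>x. cnj (f x)) \<in> smooth"
proof (rule smooth_in_coinduct[where X = "{\<lambda>x. cnj (f x) |f. f \<in> smooth}"])
  fix g assume "g \<in> {\<lambda>x. cnj (f x) |f. f \<in> smooth}"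
  then obtain f where g: "g = (\<lambda>x. cnj (f x))" and f: "f \<in> smooth" by auto
  have "\<forall>x. (g has_vector_derivative cnj (real_deriv f x)) (at x)"
    unfolding g by (intro allI has_vector_derivative_cnj smooth_inD(4)[OF f])
  then show "\<exists>f'\<in>{\<lambda>x. cnj (f x) |f. f \<in> smooth}. \<forall>x. (g has_vector_derivative f' x) (at x)"
    using smooth_inD(3)[OF f] by (intro bexI[of _ "\<lambda>x. cnj (real_deriv f x)"]) auto
qed (use assms in auto)

section \<open>Powers of a polynomial in the Dunkl operator\<close>

lemma schwartz_sum: "finite A \<Longrightarrow> (\<And>i. i \<in> A \<Longrightarrow> F i \<in> schwartz) \<Longrightarrow> (\<lambda>x. \<Sum>i\<in>A. F i x) \<in> schwartz"
proof (induction A rule: finite_induct)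
  case empty
  show ?case using schwartz_cmult[OF gaussian_schwartz, of 0] by simp
qed (auto intro: schwartz_add)

lemma dunkl_transform_sum:
  assumes k: "k \<ge> - 1 / 2" and F: "finite A" "\<And>i. i \<in> A \<Longrightarrow> F i \<in> schwartz"
  shows "dunkl_transform k (\<lambda>x. \<Sum>i\<in>A. F i x) \<xi> = (\<Sum>i\<in>A. dunkl_transform k (F i) \<xi>)"
  unfolding dunkl_transform_def sum_distrib_right
  by (intro Bochner_Integration.integral_sum dunkl_transform_integrable schwartz_integrable k F)

lemma poly_op_schwartz: "f \<in> schwartz \<Longrightarrow> poly_op P (dunkl_momentum k) f \<in> schwartz"
  unfolding poly_op_def[abs_def] by (intro schwartz_sum schwartz_cmult dunkl_momentum_pow_schwartz) auto

lemma poly_op_pow_schwartz: "f \<in> schwartz \<Longrightarrow> (poly_op P (dunkl_momentum k) ^^ n) f \<in> schwartz"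
  by (induction n) (auto intro: poly_op_schwartz)

lemma dunkl_transform_poly_op:
  assumes k: "k \<ge> - 1 / 2" and f: "f \<in> schwartz"
  shows "dunkl_transform k (poly_op P (dunkl_momentum k) f) \<xi> = poly P (of_real \<xi>) * dunkl_transform k f \<xi>"
  unfolding poly_op_def[abs_def]
  by (subst dunkl_transform_sum[OF k])
     (auto intro!: schwartz_cmult dunkl_momentum_pow_schwartz f
       simp: dunkl_transform_cmult dunkl_transform_momentum_pow[OF k f] poly_altdef sum_distrib_right mult.assoc)

lemma dunkl_transform_poly_op_pow:
  assumes k: "k \<ge> - 1 / 2" and f: "f \<in> schwartz"
  shows "dunkl_transform k ((poly_op P (dunkl_momentum k) ^^ n) f) \<xi> = poly P (of_real \<xi>) ^ n * dunkl_transform k f \<xi>"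
  by (induction n) (simp_all add: dunkl_transform_poly_op[OF k poly_op_pow_schwartz[OF f]])

section \<open>Lebesgue norms and polynomial decay\<close>

lemma ennreal_rpow_mono:
  assumes "x \<le> y" "0 \<le> r" shows "ennreal_rpow x r \<le> ennreal_rpow y r"
proof (cases "y = \<infinity>")
  case False
  then have "x \<noteq> \<infinity>" using assms(1) by (auto simp: top_unique)
  moreover have "enn2real x \<le> enn2real y" using assms False by (intro enn2real_mono) (auto simp: less_top)
  ultimately show ?thesis using False assms(2) by (auto simp: ennreal_rpow_def intro!: ennreal_leI powr_mono2)
qed (auto simp: ennreal_rpow_def)

lemma ennreal_rpow_ennreal: "0 \<le> a \<Longrightarrow> ennreal_rpow (ennreal a) r = ennreal (a powr r)"
  by (simp add: ennreal_rpow_def)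

lemma ennreal_rpow_le_iff:
  assumes "0 < r" "0 \<le> s"
  shows "ennreal_rpow x (1 / r) \<le> ennreal s \<longleftrightarrow> x \<le> ennreal (s powr r)"
proof (cases x)
  case (real a)
  have "a powr (1 / r) \<le> s \<longleftrightarrow> a \<le> s powr r"
  proof
    assume "a powr (1 / r) \<le> s"
    then have "(a powr (1 / r)) powr r \<le> s powr r" using assms by (intro powr_mono2) auto
    then show "a \<le> s powr r" using assms real by (simp add: powr_powr)
  next
    assume "a \<le> s powr r"
    then have "a powr (1 / r) \<le> (s powr r) powr (1 / r)" using assms real by (intro powr_mono2) auto
    then show "a powr (1 / r) \<le> s" using assms by (simp add: powr_powr)
  qed
  then show ?thesis using real assms by (simp add: ennreal_rpow_ennreal)
qed (simp add: ennreal_rpow_def top_unique)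

definition decay_mass :: "real \<Rightarrow> real" where
  "decay_mass k = (\<integral>x. decay_weight k x \<partial>dunkl_measure k)"

lemma decay_mass_nonneg: "0 \<le> decay_mass k"
  by (simp add: decay_mass_def)

lemma nn_integral_decay:
  assumes "k \<ge> - 1 / 2"
  shows "(\<integral>\<^sup>+x. ennreal (decay_weight k x) \<partial>dunkl_measure k) = ennreal (decay_mass k)"
  unfolding decay_mass_def by (rule nn_integral_eq_integral[OF integrable_decay[OF assms]]) simp

lemma enn2real_ge_1:
  assumes "1 \<le> p" "p \<noteq> \<infinity>" shows "1 \<le> enn2real p"
  using assms enn2real_mono[of 1 p] by (auto simp: less_top)

text \<open>The exponent that makes the weight integrable serves for all \<open>p\<close> at once, since the weight is at most 1.\<close>

lemma Lp_norm_le_of_decay: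
  assumes k: "k \<ge> - 1 / 2" and p: "1 \<le> p"
  obtains A where "0 \<le> A" "\<And>u B. u \<in> borel_measurable borel \<Longrightarrow> 0 \<le> B \<Longrightarrow>
    (\<And>x. norm (u x) \<le> B * decay_weight k x) \<Longrightarrow> Lp_norm k p u \<le> ennreal (B * A)"
proof (cases "p = \<infinity>")
  case True
  show ?thesis
  proof (rule that[of 1])
    fix u :: "real \<Rightarrow> complex" and B :: real
    assume u: "u \<in> borel_measurable borel" "0 \<le> B" "\<And>x. norm (u x) \<le> B * decay_weight k x"
    have "norm (u x) \<le> B" for x
    proof -
      have "B * decay_weight k x \<le> B * 1" using u(2) by (intro mult_left_mono) auto
      then show ?thesis using u(3)[of x] by simp
    qed
    then show "Lp_norm k p u \<le> ennreal (B * 1)"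
      unfolding Lp_norm_def using True u(1) by (auto intro!: esssup_I ennreal_leI simp: measurable_dunkl_measure)
  qed simp
next
  case False
  define r where "r = enn2real p"
  have r: "1 \<le> r" unfolding r_def by (rule enn2real_ge_1[OF p False])
  let ?w = "decay_weight k"
  have w: "0 \<le> ?w x" "?w x \<le> 1" for x by auto
  show ?thesis
  proof (rule that[of "decay_mass k powr (1 / r)"])
    fix u :: "real \<Rightarrow> complex" and B :: real
    assume u: "u \<in> borel_measurable borel" "0 \<le> B" "\<And>x. norm (u x) \<le> B * ?w x"
    have "(\<integral>\<^sup>+x. ennreal (norm (u x) powr r) \<partial>dunkl_measure k) \<le> (\<integral>\<^sup>+x. ennreal (B powr r) * ennreal (?w x) \<partial>dunkl_measure k)"
    proof (rule nn_integral_mono)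
      fix x
      have "norm (u x) powr r \<le> (B * ?w x) powr r" using u r by (intro powr_mono2) auto
      also have "\<dots> = B powr r * ?w x powr r" by (rule powr_mult)
      also have "\<dots> \<le> B powr r * ?w x powr 1"
        using w[of x] r by (intro mult_left_mono powr_mono') auto
      finally show "ennreal (norm (u x) powr r) \<le> ennreal (B powr r) * ennreal (?w x)"
        using w[of x] by (simp add: ennreal_mult[symmetric] ennreal_leI)
    qed
    also have "\<dots> = ennreal (B powr r * decay_mass k)"
      by (subst nn_integral_cmult) (auto simp: nn_integral_decay[OF k] ennreal_mult[symmetric] decay_mass_nonneg measurable_dunkl_measure)
    also have "B powr r * decay_mass k = (B * decay_mass k powr (1 / r)) powr r"
      using u(2) r decay_mass_nonneg[of k] by (simp add: powr_mult powr_powr)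
    finally show "Lp_norm k p u \<le> ennreal (B * decay_mass k powr (1 / r))"
      unfolding Lp_norm_def r_def[symmetric] using False r u(2)
      by (simp add: ennreal_rpow_le_iff)
  qed simp
qed

text \<open>A Hoelder inequality with an explicit constant. For finite \<open>p\<close> with real value \<open>r\<close>, integrate the bound
\<open>a \<le> S + S\<^sup>1\<^sup>-\<^sup>r a\<^sup>r\<close> for \<open>a = \<bar>u x\<bar>\<close>, weighted by the decay weight. Either \<open>a \<le> S\<close>, or \<open>a = a\<^sup>1\<^sup>-\<^sup>r a\<^sup>r\<close> is at most the last term.\<close>

lemma weighted_integral_le_of_Lp_norm:
  assumes k: "k \<ge> - 1 / 2" and p: "1 \<le> p" and u: "u \<in> borel_measurable borel" and S: "0 < S" "Lp_norm k p u \<le> ennreal S"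
  shows "(\<integral>\<^sup>+x. ennreal (norm (u x) * decay_weight k x) \<partial>dunkl_measure k) \<le> ennreal (S * (decay_mass k + 1))"
proof -
  let ?w = "decay_weight k"
  have w: "0 \<le> ?w x" "?w x \<le> 1" for x by auto
  show ?thesis
  proof (cases "p = \<infinity>")
    case True
    have "AE x in dunkl_measure k. ennreal (norm (u x)) \<le> ennreal S"
      using esssup_AE[of "\<lambda>x. ennreal (norm (u x))" "dunkl_measure k"] S(2) True
      by (auto simp: Lp_norm_def elim!: eventually_mono)
    then have "(\<integral>\<^sup>+x. ennreal (norm (u x) * ?w x) \<partial>dunkl_measure k) \<le> (\<integral>\<^sup>+x. ennreal S * ennreal (?w x) \<partial>dunkl_measure k)"
    proof (intro nn_integral_mono_AE, eventually_elim)
      case (elim x)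
      then show ?case using w[of x] S(1) by (simp add: ennreal_mult[symmetric] ennreal_le_iff mult_right_mono divide_right_mono)
    qed
    also have "\<dots> = ennreal (S * decay_mass k)"
      using S by (subst nn_integral_cmult) (auto simp: nn_integral_decay[OF k] ennreal_mult[symmetric] decay_mass_nonneg measurable_dunkl_measure)
    also have "\<dots> \<le> ennreal (S * (decay_mass k + 1))"
      using S by (intro ennreal_leI mult_left_mono) auto
    finally show ?thesis .
  next
    case False
    define r where "r = enn2real p"
  let ?b = "\<lambda>x r. ennreal S * ennreal (?w x) + ennreal (S powr (1 - r)) * ennreal (norm (u x) powr r)"
    have r: "1 \<le> r" unfolding r_def by (rule enn2real_ge_1[OF p False])
    have X: "(\<integral>\<^sup>+x. ennreal (norm (u x) powr r) \<partial>dunkl_measure k) \<le> ennreal (S powr r)"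
      using S r False by (simp add: Lp_norm_def r_def[symmetric] ennreal_rpow_le_iff)
    have young: "a * ?w x \<le> S * ?w x + S powr (1 - r) * a powr r" if "0 \<le> a" for a x :: real
    proof (cases "a \<le> S")
      case True
      then have "a * ?w x \<le> S * ?w x" by (intro mult_right_mono w)
      moreover have "0 \<le> S powr (1 - r) * a powr r" by simp
      ultimately show ?thesis by linarith
    next
      case False
      have "a = a powr (1 - r) * a powr r" using False S r by (simp flip: powr_add)
      also have "\<dots> \<le> S powr (1 - r) * a powr r"
        using False S r by (intro mult_right_mono powr_mono2') auto
      finally have "a \<le> S powr (1 - r) * a powr r" .
      moreover have "a * ?w x \<le> a * 1" using that by (intro mult_left_mono w) auto
      moreover have "0 \<le> S * ?w x" using S by simp
      ultimately show ?thesis by linarith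
    qed
    have "(\<integral>\<^sup>+x. ennreal (norm (u x) * ?w x) \<partial>dunkl_measure k) \<le>
        (\<integral>\<^sup>+x. ?b x r \<partial>dunkl_measure k)"
    proof (rule nn_integral_mono)
      fix x
      have "ennreal (norm (u x) * ?w x) \<le> ennreal (S * ?w x + S powr (1 - r) * norm (u x) powr r)"
        by (intro ennreal_leI young) auto
      also have "\<dots> = ?b x r"
      proof -
        have gen: "ennreal (S * v + a * b) = ennreal S * ennreal v + ennreal a * ennreal b"
          if "0 \<le> v" "0 \<le> a" "0 \<le> b" for v a b
          using that S(1) by (simp add: ennreal_mult)
        show ?thesis by (rule gen) auto
      qed
      finally show "ennreal (norm (u x) * ?w x) \<le> ?b x r" .
    qed
    also have "\<dots> = ennreal S * ennreal (decay_mass k) + ennreal (S powr (1 - r)) * (\<integral>\<^sup>+x. ennreal (norm (u x) powr r) \<partial>dunkl_measure k)"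
      using u by (subst nn_integral_add) (auto simp: nn_integral_cmult nn_integral_decay[OF k] measurable_dunkl_measure)
    also have "\<dots> \<le> ennreal S * ennreal (decay_mass k) + ennreal (S powr (1 - r)) * ennreal (S powr r)"
      by (intro add_left_mono mult_left_mono X) auto
    also have "\<dots> = ennreal (S * decay_mass k + S powr (1 - r) * S powr r)"
      using S by (simp add: ennreal_mult decay_mass_nonneg)
    also have "S * decay_mass k + S powr (1 - r) * S powr r = S * (decay_mass k + 1)"
      using S by (simp add: distrib_left flip: powr_add)
    finally show ?thesis .
  qed
qed

section \<open>The real Paley-Wiener theorem for the Dunkl transform\<close>

lemma poly_sublevel_bounded:
  fixes P :: "complex poly"
  assumes "degree P \<noteq> 0"
  obtains R where "0 \<le> R" "\<And>x::real. norm (poly P (of_real x)) \<le> 1 \<Longrightarrow> \<bar>x\<bar> \<le> R"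
proof -
  have "filterlim (poly P) at_infinity at_infinity"
    using assms by (intro filterlim_poly_at_infinity) auto
  then have "\<forall>\<^sub>F z in at_infinity. 2 \<le> norm (poly P z)"
    unfolding filterlim_at_infinity[OF order_refl] by auto
  then obtain b where b: "\<And>z. b \<le> norm z \<Longrightarrow> 2 \<le> norm (poly P z)"
    unfolding eventually_at_infinity by auto
  show ?thesis
  proof (rule that[of "max b 0"])
    fix x :: real assume "norm (poly P (of_real x)) \<le> 1"
    then show "\<bar>x\<bar> \<le> max b 0" using b[of "of_real x"] by (cases "b \<le> \<bar>x\<bar>") auto
  qed simp
qed

lemma poly_smooth: "(\<lambda>x. poly P (of_real x)) \<in> smooth"
  by (rule smooth_in_smooth[OF poly_smooth_slow])

text \<open>By inversion \<open>u\<^sub>n\<close> is, up to reflection and a constant, the transform of \<open>P\<^sup>n \<cdot> D g\<close>; the rate in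
\<open>Ck_in_power_mult\<close> is 1. The factor \<open>(n + 1)\<^sup>N\<close> disappears in the \<open>n\<close>-th root.\<close>

lemma limsup_le_1_of_support:
  fixes P :: "complex poly" and p :: ennreal
  assumes k: "k \<ge> - 1 / 2" and g: "g \<in> schwartz" and P: "degree P \<noteq> 0" and p: "1 \<le> p"
    and supp: "\<And>\<xi>::real. 1 < norm (poly P (of_real \<xi>)) \<Longrightarrow> dunkl_transform k g \<xi> = 0"
  shows "limsup (\<lambda>n. ennreal_rpow (Lp_norm k p ((poly_op P (dunkl_momentum k) ^^ n) g)) (1 / real n)) \<le> 1"
proof -
  let ?N = "decay_exponent k" and ?D = "dunkl_transform k" and ?u = "\<lambda>n. (poly_op P (dunkl_momentum k) ^^ n) g"
  let ?c = "(dunkl_transform k gaussian 0)\<^sup>2"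
  have c0: "norm ?c > 0" using dunkl_transform_gaussian_0_nonzero[OF k] by simp
  obtain R where R: "0 \<le> R" "\<And>x::real. norm (poly P (of_real x)) \<le> 1 \<Longrightarrow> \<bar>x\<bar> \<le> R"
    using poly_sublevel_bounded[OF P] by blast
  define K where "K = {x::real. norm (poly P (of_real x)) \<le> 1}"
  have Kc: "closed K" unfolding K_def by (intro closed_Collect_le continuous_intros)
  have KR: "K \<subseteq> {-R..R}" using R(2) by (force simp: K_def)
  have DK: "?D g x = 0" if "x \<notin> K" for x using supp that by (auto simp: K_def)
  obtain C where C: "0 \<le> C" "\<And>n. Ck_in (bounded_by (C * (real n + 1) ^ ?N * 1 ^ n)) ?N (\<lambda>x. poly P (of_real x) ^ n * ?D g x)"
    using Ck_in_power_mult[OF poly_smooth Kc KR, of P 1 "?D g" ?N] dunkl_transform_smooth[OF k g] DK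
    by (auto simp: K_def)
  obtain L where L: "0 \<le> L" "\<And>F C \<xi>. F \<in> smooth \<Longrightarrow> (\<And>x. R < \<bar>x\<bar> \<Longrightarrow> F x = 0) \<Longrightarrow>
    Ck_in (bounded_by C) ?N F \<Longrightarrow> (1 + \<bar>\<xi>\<bar>) ^ ?N * norm (?D F \<xi>) \<le> L * C"
    using dunkl_transform_decay[OF k R(1), of ?N] by metis
  define B where "B n = L * (C * (real n + 1) ^ ?N) / norm ?c" for n :: nat
  have B0: "0 \<le> B n" for n using L(1) C(1) by (simp add: B_def)
  have bound: "norm (?u n x) \<le> B n * (1 / (1 + \<bar>x\<bar>) ^ ?N)" for n x
  proof -
    have "(1 + \<bar>- x\<bar>) ^ ?N * norm (?D (\<lambda>x. poly P (of_real x) ^ n * ?D g x) (- x)) \<le> L * (C * (real n + 1) ^ ?N * 1 ^ n)"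
    proof (rule L(2)[OF _ _ C(2)])
      show "(\<lambda>x. poly P (of_real x) ^ n * ?D g x) \<in> smooth"
        by (intro smooth_mult smooth_power poly_smooth dunkl_transform_smooth k g)
      show "poly P (of_real y) ^ n * ?D g y = 0" if "R < \<bar>y\<bar>" for y
        using R(2)[of y] that DK[of y] by (auto simp: K_def)
    qed
    moreover have "?D (\<lambda>x. poly P (of_real x) ^ n * ?D g x) (- x) = ?c * ?u n x"
    proof -
      have "?D (?u n) = (\<lambda>x. poly P (of_real x) ^ n * ?D g x)"
        by (rule ext) (rule dunkl_transform_poly_op_pow[OF k g])
      then show ?thesis
        using dunkl_inversion[OF k poly_op_pow_schwartz[where P = P and n = n and k = k, OF g], of x] by simp
    qed
    ultimately have "(1 + \<bar>x\<bar>) ^ ?N * (norm ?c * norm (?u n x)) \<le> L * (C * (real n + 1) ^ ?N)"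
      by (simp only: norm_mult abs_minus_cancel power_one mult_1_right)
    then have "norm ?c * (norm (?u n x) * (1 + \<bar>x\<bar>) ^ ?N) \<le> L * (C * (real n + 1) ^ ?N)"
      by (simp only: mult_ac)
    then have "norm (?u n x) * (1 + \<bar>x\<bar>) ^ ?N \<le> B n"
      unfolding B_def pos_le_divide_eq[OF c0] by (simp only: mult_ac)
    moreover have "0 < (1 + \<bar>x\<bar>) ^ ?N" by (intro zero_less_power) auto
    ultimately show ?thesis by (simp add: pos_le_divide_eq)
  qed
  obtain A where A: "0 \<le> A" "\<And>u B. u \<in> borel_measurable borel \<Longrightarrow> 0 \<le> B \<Longrightarrow>
    (\<And>x. norm (u x) \<le> B * (1 / (1 + \<bar>x\<bar>) ^ ?N)) \<Longrightarrow> Lp_norm k p u \<le> ennreal (B * A)"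
    using Lp_norm_le_of_decay[OF k p] by metis
  define E where "E = L * C / norm ?c * A + 1"
  have E: "0 < E" using L(1) C(1) A(1) by (simp add: E_def add_nonneg_pos)
  let ?e = "\<lambda>n. (E * (real n + 1) ^ ?N) powr (1 / real n)"
  have le: "ennreal_rpow (Lp_norm k p (?u n)) (1 / real n) \<le> ennreal (?e n)" for n
  proof -
    have "Lp_norm k p (?u n) \<le> ennreal (B n * A)"
      by (rule A(2)[OF schwartzD(5)[OF poly_op_pow_schwartz[OF g]] B0 bound])
    also have "\<dots> \<le> ennreal (E * (real n + 1) ^ ?N)"
    proof (rule ennreal_leI)
      have "B n * A = (L * C / norm ?c * A) * (real n + 1) ^ ?N" by (simp add: B_def)
      also have "\<dots> \<le> E * (real n + 1) ^ ?N" by (intro mult_right_mono) (auto simp: E_def)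
      finally show "B n * A \<le> E * (real n + 1) ^ ?N" .
    qed
    finally have "ennreal_rpow (Lp_norm k p (?u n)) (1 / real n) \<le> ennreal_rpow (ennreal (E * (real n + 1) ^ ?N)) (1 / real n)"
      by (rule ennreal_rpow_mono) simp
    then show ?thesis using E by (simp add: ennreal_rpow_ennreal)
  qed
  have "?e \<longlonglongrightarrow> 1"
    using E by real_asymp
  then have "(\<lambda>n. ennreal (?e n)) \<longlonglongrightarrow> ennreal 1"
    by (rule tendsto_ennrealI)
  then have "limsup (\<lambda>n. ennreal (?e n)) = 1"
    by (simp add: lim_imp_Limsup)
  then show ?thesis
    using Limsup_mono[of "\<lambda>n. ennreal_rpow (Lp_norm k p (?u n)) (1 / real n)" "\<lambda>n. ennreal (?e n)" sequentially] le
    by simp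
qed

lemma poly_vs_exponential:
  fixes K I \<theta> :: real
  assumes "0 < I" "1 < \<theta>" "\<forall>\<^sub>F n in sequentially. \<theta> ^ n * I \<le> K * (real n + 1) ^ N"
  shows False
proof -
  have "(\<lambda>n. K * (real n + 1) ^ N / \<theta> ^ n) \<longlonglongrightarrow> 0"
    using assms(2) by real_asymp
  then have "\<forall>\<^sub>F n in sequentially. K * (real n + 1) ^ N / \<theta> ^ n < I"
    using assms(1) by (rule order_tendstoD)
  with assms(3) have "\<forall>\<^sub>F n in sequentially. False"
  proof eventually_elim
    case (elim n)
    then have "K * (real n + 1) ^ N < I * \<theta> ^ n" using assms(2) by (simp add: divide_less_eq)
    then show ?case using elim(1) by (simp add: mult.commute)
  qed
  then show False by simp
qed

text \<open>The test functions \<open>F\<^sub>n = \<eta> cnj (P\<^sup>n \<cdot> D g)\<close> make the pairing with \<open>P\<^sup>n \<cdot> D g\<close> a positive integral, while their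
transforms are controlled by the largest value of \<open>\<bar>P\<bar>\<close> on the support of the bump \<open>\<eta>\<close>.\<close>

lemma support_of_limsup_le_1:
  fixes P :: "complex poly" and p :: ennreal
  assumes k: "k \<ge> - 1 / 2" and g: "g \<in> schwartz" and p: "1 \<le> p"
    and lim: "limsup (\<lambda>n. ennreal_rpow (Lp_norm k p ((poly_op P (dunkl_momentum k) ^^ n) g)) (1 / real n)) \<le> 1"
    and \<xi>: "1 < norm (poly P (of_real \<xi>))"
  shows "dunkl_transform k g \<xi> = 0"
proof (rule ccontr)
  assume nz: "dunkl_transform k g \<xi> \<noteq> 0"
  let ?N = "decay_exponent k" and ?D = "dunkl_transform k" and ?u = "\<lambda>n. (poly_op P (dunkl_momentum k) ^^ n) g"
  let ?M = "dunkl_measure k" and ?w = "decay_weight k"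
  define m where "m x = norm (poly P (of_real x))" for x :: real
  \<comment> \<open>With \<open>\<bar>P\<bar>\<close> between \<open>s\<^sup>4\<close> and \<open>s\<^sup>6\<close> on the bump and a norm of at most \<open>s\<^sup>n\<close>, the lower rate \<open>(s\<^sup>4)\<^sup>2\<close>
      beats the upper rate \<open>s\<^sup>6 \<cdot> s\<close>.\<close>
  define s where "s = m \<xi> powr (1 / 5)"
  have m1: "1 < m \<xi>" using \<xi> by (simp add: m_def)
  have s1: "1 < s" unfolding s_def using m1 by simp
  have ms: "m \<xi> = s ^ 5"
  proof -
    have "s ^ 5 = s powr 5" using s1 by simp
    also have "\<dots> = m \<xi>" unfolding s_def using m1 by (simp add: powr_powr)
    finally show ?thesis ..
  qed
  have mcont: "continuous_on UNIV m" unfolding m_def[abs_def] by (intro continuous_intros)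
  have s46: "s ^ 4 < m \<xi>" "m \<xi> < s ^ 6" unfolding ms using s1 by (auto intro: power_strict_increasing)
  have Dcont: "continuous_on UNIV (?D g)" by (rule smooth_inD(5)[OF dunkl_transform_smooth[OF k g]])
  have "open {x. s ^ 4 < m x \<and> m x < s ^ 6 \<and> ?D g x \<noteq> 0}"
    by (intro open_Collect_conj open_Collect_less open_Collect_neq continuous_intros mcont Dcont)
  moreover have "\<xi> \<in> {x. s ^ 4 < m x \<and> m x < s ^ 6 \<and> ?D g x \<noteq> 0}" using s46 nz by simp
  ultimately obtain e where e: "0 < e" "cball \<xi> e \<subseteq> {x. s ^ 4 < m x \<and> m x < s ^ 6 \<and> ?D g x \<noteq> 0}"
    by (meson open_contains_cball)
  then have near: "s ^ 4 < m x" "m x < s ^ 6" "?D g x \<noteq> 0" if "x \<in> {\<xi> - e..\<xi> + e}" for x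
    using that by (auto simp: subset_iff dist_real_def abs_le_iff)
  obtain \<eta> :: "real \<Rightarrow> real" where \<eta>: "(\<lambda>x. of_real (\<eta> x)) \<in> smooth" "\<And>x. 0 \<le> \<eta> x"
    "\<And>x. 0 < \<eta> x \<longleftrightarrow> \<xi> - e < x \<and> x < \<xi> + e"
    using bump_exists by metis
  have \<eta>0: "\<eta> x = 0" if "x \<notin> {\<xi> - e..\<xi> + e}" for x
  proof -
    have "\<not> 0 < \<eta> x" using that by (auto simp: \<eta>(3))
    then show ?thesis using \<eta>(2)[of x] by linarith
  qed
  define \<phi> where "\<phi> x = of_real (\<eta> x) * cnj (?D g x)" for x
  have \<phi>s: "\<phi> \<in> smooth" unfolding \<phi>_def[abs_def]
    by (intro smooth_mult \<eta> smooth_cnj dunkl_transform_smooth k g)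
  define q where "q x = cnj (poly P (of_real x))" for x :: real
  have qs: "q \<in> smooth" unfolding q_def[abs_def] by (intro smooth_cnj poly_smooth)
  define R where "R = \<bar>\<xi>\<bar> + e"
  have R: "0 \<le> R" "{\<xi> - e..\<xi> + e} \<subseteq> {-R..R}" using e(1) by (auto simp: R_def)
  have \<phi>0: "\<phi> x = 0" if "x \<notin> {\<xi> - e..\<xi> + e}" for x using \<eta>0[OF that] by (simp add: \<phi>_def)
  obtain C where C: "0 \<le> C" "\<And>n. Ck_in (bounded_by (C * (real n + 1) ^ ?N * (s ^ 6) ^ n)) ?N (\<lambda>x. q x ^ n * \<phi> x)"
    using Ck_in_power_mult[OF qs _ R(2), of "s ^ 6" \<phi> ?N] near(2) \<phi>s \<phi>0 s1
    by (auto simp: q_def m_def less_imp_le)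
  obtain L where L: "0 \<le> L" "\<And>F C \<xi>. F \<in> smooth \<Longrightarrow> (\<And>x. R < \<bar>x\<bar> \<Longrightarrow> F x = 0) \<Longrightarrow>
    Ck_in (bounded_by C) ?N F \<Longrightarrow> (1 + \<bar>\<xi>\<bar>) ^ ?N * norm (?D F \<xi>) \<le> L * C"
    using dunkl_transform_decay[OF k R(1), of ?N] by metis
  let ?F = "\<lambda>n x. q x ^ n * \<phi> x"
  have Fs: "?F n \<in> smooth" for n by (intro smooth_mult smooth_power qs \<phi>s)
  have F0: "?F n x = 0" if "R < \<bar>x\<bar>" for n x
  proof -
    have "x \<notin> {\<xi> - e..\<xi> + e}" using that R(2) by (auto simp: subset_iff R_def)
    then show ?thesis using \<phi>0 by simp
  qed
  have FS: "?F n \<in> schwartz" for n by (rule compact_support_schwartz[OF Fs F0])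
  have DF: "norm (?D (?F n) x) \<le> L * (C * (real n + 1) ^ ?N * (s ^ 6) ^ n) * ?w x" for n x
  proof -
    have "0 < (1 + \<bar>x\<bar>) ^ ?N" by (intro zero_less_power) auto
    then show ?thesis using L(2)[OF Fs F0 C(2), of x n] by (simp add: pos_le_divide_eq mult.commute)
  qed
  let ?A = "\<lambda>x. \<eta> x * (norm (?D g x))\<^sup>2"
  define I where "I = (\<integral>x. ?A x \<partial>?M)"
  have gs: "?u n \<in> schwartz" for n by (rule poly_op_pow_schwartz[OF g])
  have prod: "?D (?u n) x * ?F n x = of_real ((m x)\<^sup>2 ^ n * ?A x)" for n x
  proof -
    have "?D (?u n) x * ?F n x = (poly P (of_real x) * q x) ^ n * (of_real (\<eta> x) * (?D g x * cnj (?D g x)))"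
      by (simp add: dunkl_transform_poly_op_pow[OF k g] \<phi>_def power_mult_distrib)
    then show ?thesis by (simp add: q_def m_def complex_norm_square[symmetric])
  qed
  have int: "integrable ?M (\<lambda>x. (m x)\<^sup>2 ^ n * ?A x)" for n
  proof -
    have "(\<lambda>x. ?D (?u n) x * ?F n x) \<in> smooth" by (intro smooth_mult dunkl_transform_smooth k gs Fs)
    then have "(\<lambda>x. ?D (?u n) x * ?F n x) \<in> schwartz"
      by (rule compact_support_schwartz[of _ R]) (simp only: F0 mult_zero_right)
    then have "integrable ?M (\<lambda>x. norm (?D (?u n) x * ?F n x))" by (intro integrable_norm schwartz_integrable k)
    then show ?thesis unfolding prod norm_of_real using \<eta>(2) by simp
  qed
  have I0: "0 < I" unfolding I_def
  proof (rule integral_pos_dunkl[OF k])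
    show "integrable ?M (\<lambda>x. ?A x)" using int[of 0] by simp
    show "\<xi> - e < \<xi> + e" using e by simp
    show "0 < ?A x" if "x \<in> {\<xi> - e<..<\<xi> + e}" for x
      using that near(3)[of x] \<eta>(3)[of x] by simp
  qed (use \<eta>(2) in simp)
  let ?J = "\<lambda>n. \<integral>x. ?D (?u n) x * ?F n x \<partial>?M"
  have lower: "((s ^ 4)\<^sup>2) ^ n * I \<le> norm (?J n)" for n
  proof -
    have "((s ^ 4)\<^sup>2) ^ n * I = (\<integral>x. ((s ^ 4)\<^sup>2) ^ n * ?A x \<partial>?M)"
      unfolding I_def by simp
    also have "\<dots> \<le> (\<integral>x. (m x)\<^sup>2 ^ n * ?A x \<partial>?M)"
    proof (rule integral_mono[OF _ int])
      show "integrable ?M (\<lambda>x. ((s ^ 4)\<^sup>2) ^ n * ?A x)"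
        using int[of 0] by (intro integrable_mult_right) simp
      show "((s ^ 4)\<^sup>2) ^ n * ?A x \<le> (m x)\<^sup>2 ^ n * ?A x" for x
      proof (cases "x \<in> {\<xi> - e..\<xi> + e}")
        case True
        then show ?thesis using near(1)[OF True] s1 \<eta>(2)[of x] by (intro mult_right_mono power_mono) auto
      qed (simp add: \<eta>0)
    qed
    also have "\<dots> \<le> norm (complex_of_real (\<integral>x. (m x)\<^sup>2 ^ n * ?A x \<partial>?M))" by simp
    also have "complex_of_real (\<integral>x. (m x)\<^sup>2 ^ n * ?A x \<partial>?M) = (?J n)"
      unfolding prod by (rule integral_complex_of_real[symmetric])
    finally show ?thesis .
  qed
  define T where "T n = L * (C * (real n + 1) ^ ?N * (s ^ 6) ^ n)" for n :: nat
  have T0: "0 \<le> T n" for n using L(1) C(1) s1 by (simp add: T_def)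
  let ?B = "\<lambda>n x. norm (?u n x * ?D (?F n) x)"
  have upper: "norm (?J n) \<le> T n * (s ^ n * (decay_mass k + 1))"
    if n: "Lp_norm k p (?u n) \<le> ennreal (s ^ n)" for n
  proof -
    have eq: "(?J n) = (\<integral>x. ?u n x * ?D (?F n) x \<partial>?M)"
      by (intro dunkl_transform_symmetric schwartz_integrable k gs FS)
    have "ennreal (norm (\<integral>x. ?u n x * ?D (?F n) x \<partial>?M)) \<le> (\<integral>\<^sup>+x. ennreal (?B n x) \<partial>?M)"
    proof (rule integral_norm_bound_ennreal)
      show "integrable ?M (\<lambda>x. ?u n x * ?D (?F n) x)"
      proof (rule rapid_integrable[OF k])
        show "continuous_on UNIV (\<lambda>x. ?u n x * ?D (?F n) x)"
          by (intro continuous_intros schwartzD(4) gs smooth_inD(5)[OF dunkl_transform_smooth[OF k FS]])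
        have "norm (?D (?F n) x) \<le> (\<integral>x. norm (?F n x) \<partial>?M)" for x
          by (rule norm_dunkl_transform_le[OF k schwartz_integrable[OF k FS]])
        then have "?D (?F n) \<in> slow" by (rule bounded_slow)
        from slow_rapid_mult[OF this schwartzD(2)[OF gs]]
        show "(\<lambda>x. ?u n x * ?D (?F n) x) \<in> rapid" by (simp add: mult.commute)
      qed
    qed
    also have "\<dots> \<le> (\<integral>\<^sup>+x. ennreal (T n) * ennreal (norm (?u n x) * ?w x) \<partial>?M)"
    proof (rule nn_integral_mono)
      fix x
      have "?B n x \<le> norm (?u n x) * (T n * ?w x)"
        unfolding norm_mult T_def by (intro mult_left_mono DF) auto
      then have "ennreal (?B n x) \<le> ennreal (T n * (norm (?u n x) * ?w x))"
        by (intro ennreal_leI) (simp only: mult_ac)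
      also have "\<dots> = ennreal (T n) * ennreal (norm (?u n x) * ?w x)"
        by (rule ennreal_mult[OF T0]) simp
      finally show "ennreal (?B n x) \<le> ennreal (T n) * ennreal (norm (?u n x) * ?w x)" .
    qed
    also have "\<dots> = ennreal (T n) * (\<integral>\<^sup>+x. ennreal (norm (?u n x) * ?w x) \<partial>?M)"
      using schwartzD(5)[OF gs[of n]] by (intro nn_integral_cmult) (simp add: measurable_dunkl_measure)
    also have "\<dots> \<le> ennreal (T n) * ennreal (s ^ n * (decay_mass k + 1))"
      using s1 by (intro mult_left_mono weighted_integral_le_of_Lp_norm[OF k p schwartzD(5)[OF gs] _ n]) auto
    also have "\<dots> = ennreal (T n * (s ^ n * (decay_mass k + 1)))"
      using s1 decay_mass_nonneg[of k] T0[of n] by (intro ennreal_mult[symmetric]) auto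
    finally show ?thesis
      unfolding eq using T0[of n] s1 decay_mass_nonneg[of k] by (subst (asm) ennreal_le_iff) auto
  qed
  have "\<forall>\<^sub>F n in sequentially. ennreal_rpow (Lp_norm k p (?u n)) (1 / real n) < ennreal s"
    using lim s1 by (intro Limsup_lessD) (auto intro: le_less_trans)
  then have "\<forall>\<^sub>F n in sequentially. s ^ n * I \<le> (L * C * (decay_mass k + 1)) * (real n + 1) ^ ?N"
    using eventually_gt_at_top[of 0]
  proof eventually_elim
    case (elim n)
    have "Lp_norm k p (?u n) \<le> ennreal (s powr real n)"
      using ennreal_rpow_le_iff[of "real n" s "Lp_norm k p (?u n)"] less_imp_le[OF elim(1)] elim(2) s1 by simp
    also have "s powr real n = s ^ n" using s1 by (intro powr_realpow) auto
    finally have "((s ^ 4)\<^sup>2) ^ n * I \<le> T n * (s ^ n * (decay_mass k + 1))"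
      using upper lower order_trans by blast
    moreover have "((s ^ 4)\<^sup>2) ^ n = s ^ n * ((s ^ 6) ^ n * s ^ n)"
      unfolding power_mult[symmetric] power_add[symmetric] by simp
    moreover have "T n * (s ^ n * (decay_mass k + 1)) = ((L * C * (decay_mass k + 1)) * (real n + 1) ^ ?N) * ((s ^ 6) ^ n * s ^ n)"
      by (simp only: T_def mult_ac)
    ultimately have "(s ^ n * I) * ((s ^ 6) ^ n * s ^ n) \<le> ((L * C * (decay_mass k + 1)) * (real n + 1) ^ ?N) * ((s ^ 6) ^ n * s ^ n)"
      by (simp only: mult_ac)
    moreover have "0 < (s ^ 6) ^ n * s ^ n" using s1 by simp
    ultimately show ?case by (simp only: mult_le_cancel_right_pos)
  qed
  then show False by (rule poly_vs_exponential[OF I0 s1])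
qed

section \<open>Reduction of the linear canonical transform\<close>

definition chirp :: "real \<Rightarrow> real \<Rightarrow> complex" where
  "chirp c x = exp (\<i> * of_real (c * x\<^sup>2))"

lemma chirp_schwartz: "f \<in> schwartz \<Longrightarrow> (\<lambda>x. chirp c x * f x) \<in> schwartz"
  unfolding chirp_def by (rule schwartz_mult[OF chirp_smooth_slow])

lemma chirp_inverse: "chirp (- c) x * chirp c x = 1"
  by (simp add: chirp_def exp_add[symmetric])

lemma norm_chirp: "norm (chirp c x) = 1"
  by (simp add: chirp_def norm_exp_eq_Re)

lemma matrix_inv_2_2:
  fixes M :: "real ^ 2 ^ 2"
  assumes "det M = 1"
  shows "matrix_inv M $ 1 $ 2 = - (M $ 1 $ 2)" "matrix_inv M $ 2 $ 2 = M $ 1 $ 1"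
proof -
  define N :: "real ^ 2 ^ 2" where
    "N = vector [vector [M $ 2 $ 2, - (M $ 1 $ 2)], vector [- (M $ 2 $ 1), M $ 1 $ 1]]"
  have d: "M $ 1 $ 1 * M $ 2 $ 2 - M $ 1 $ 2 * M $ 2 $ 1 = 1" using assms by (simp add: det_2)
  have MN: "M ** N = mat 1"
    using d by (simp add: matrix_matrix_mult_def mat_def vec_eq_iff forall_2 sum_2 N_def algebra_simps)
  have "invertible M" using assms by (simp add: invertible_det_nz)
  then have "matrix_inv M ** M = mat 1" unfolding matrix_inv_def invertible_def by (rule someI2_ex) simp
  then have "matrix_inv M = N" using MN by (metis matrix_mul_assoc matrix_mul_lid matrix_mul_rid)
  then show "matrix_inv M $ 1 $ 2 = - (M $ 1 $ 2)" "matrix_inv M $ 2 $ 2 = M $ 1 $ 1"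
    by (simp_all add: N_def)
qed

text \<open>The chirp is even, so it passes through the difference quotient and only the derivative sees it.\<close>

lemma dunkl_op_chirp:
  assumes f: "f \<in> smooth"
  shows "dunkl_op k (\<lambda>x. chirp c x * f x) x = chirp c x * (dunkl_op k f x + 2 * \<i> * of_real c * of_real x * f x)"
proof -
  have cs: "chirp c \<in> smooth"
    using smooth_in_smooth[OF chirp_smooth_slow[of c]] by (simp add: chirp_def[abs_def])
  have cd: "(chirp c has_vector_derivative 2 * \<i> * of_real c * of_real x * chirp c x) (at x)" for x
    using poly_chirp_has_derivative[of 1 "\<i> * of_real c" x] by (simp add: chirp_def[abs_def] mult_ac)
  have sm: "(\<lambda>x. chirp c x * f x) \<in> smooth" by (intro smooth_mult cs f)
  have d1: "real_deriv (\<lambda>x. chirp c x * f x) = (\<lambda>x. chirp c x * real_deriv f x + 2 * \<i> * of_real c * of_real x * chirp c x * f x)"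
    by (intro real_deriv_eqI has_vector_derivative_mult cd smooth_inD(4)[OF f])
  have d2: "dunkl_diff (\<lambda>x. chirp c x * f x) x = chirp c x * dunkl_diff f x"
  proof (cases "x = 0")
    case True
    then show ?thesis by (simp add: dunkl_diff_0[OF sm] dunkl_diff_0[OF f] d1)
  next
    case False
    have "of_real x * dunkl_diff (\<lambda>x. chirp c x * f x) x = chirp c x * (of_real x * dunkl_diff f x)"
      unfolding dunkl_diff_mult[OF sm] dunkl_diff_mult[OF f] by (simp add: odd_part_def chirp_def right_diff_distrib)
    then have "of_real x * dunkl_diff (\<lambda>x. chirp c x * f x) x = of_real x * (chirp c x * dunkl_diff f x)"
      by (simp only: mult.left_commute)
    then show ?thesis using False by simp
  qed
  show ?thesis
    unfolding dunkl_op_eq[OF sm] dunkl_op_eq[OF f] d1 d2 by (simp add: algebra_simps)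
qed

text \<open>The derivative of the chirp supplies the term \<open>\<i> (a / b) x f\<close> of the operator for \<open>M\<^sup>-\<^sup>1\<close>.\<close>

lemma lc_dunkl_op_conjugate:
  fixes M :: "real ^ 2 ^ 2"
  assumes f: "f \<in> smooth" and M: "det M = 1" "M $ 1 $ 2 \<noteq> 0"
  shows "chirp (M $ 1 $ 1 / M $ 1 $ 2 / 2) x * (- \<i> * lc_dunkl_op k (matrix_inv M) f x) =
    dunkl_momentum k (\<lambda>x. chirp (M $ 1 $ 1 / M $ 1 $ 2 / 2) x * f x) x"
  unfolding dunkl_momentum_def dunkl_op_chirp[OF f] lc_dunkl_op_def matrix_inv_2_2[OF M(1)]
  by (simp add: algebra_simps)

theorem theorem6p2:
  fixes k :: real and M :: "real ^ 2 ^ 2" and P :: "complex poly"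
    and p :: ennreal and f :: "real \<Rightarrow> complex"
  assumes "k \<ge> - 1 / 2"
    and "det M = 1"
    and "M $ 1 $ 2 \<noteq> 0"
    and "degree P \<noteq> 0"
    and "1 \<le> p"
    and "f \<in> schwartz"
  shows "(\<forall>\<xi>. \<xi> \<notin> Omega P (M $ 1 $ 2) \<longrightarrow> lc_dunkl_transform k M f \<xi> = 0) \<longleftrightarrow>
    limsup (\<lambda>n. ennreal_rpow
      (Lp_norm k p
        ((poly_op P (\<lambda>g x. - \<i> * lc_dunkl_op k (matrix_inv M) g x) ^^ n) f))
      (1 / real n)) \<le> 1"
proof -
  note k = assms(1)
  define a b where "a = M $ 1 $ 1" and "b = M $ 1 $ 2"
  have b: "b \<noteq> 0" using assms(3) by (simp add: b_def)
  let ?T = "\<lambda>g x. - \<i> * lc_dunkl_op k (matrix_inv M) g x"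
  let ?U = "\<lambda>f x. chirp (a / b / 2) x * f x"
  define g where "g = ?U f"
  have g: "g \<in> schwartz" unfolding g_def by (rule chirp_schwartz[OF assms(6)])
  have inv: "h = (\<lambda>x. chirp (- (a / b / 2)) x * ?U h x)" for h :: "real \<Rightarrow> complex"
    by (rule ext) (simp only: mult.assoc[symmetric] chirp_inverse mult_1_left)
  have unchirp: "h \<in> schwartz" if "?U h \<in> schwartz" for h
    by (subst inv[of h]) (rule chirp_schwartz[OF that])
  have T: "?U (?T h) = dunkl_momentum k (?U h)" if "h \<in> schwartz" for h
    unfolding a_def b_def using lc_dunkl_op_conjugate[OF schwartzD(1)[OF that] assms(2,3)] by (intro ext)
  have Tpow: "(?T ^^ j) h \<in> schwartz \<and> ?U ((?T ^^ j) h) = (dunkl_momentum k ^^ j) (?U h)" if h: "h \<in> schwartz" for h j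
  proof (induction j)
    case (Suc j)
    have "?U ((?T ^^ Suc j) h) = (dunkl_momentum k ^^ Suc j) (?U h)"
      using Suc T[of "(?T ^^ j) h"] by simp
    moreover have "(dunkl_momentum k ^^ Suc j) (?U h) \<in> schwartz"
      by (intro dunkl_momentum_pow_schwartz chirp_schwartz h)
    ultimately show ?case using unchirp[of "(?T ^^ Suc j) h"] by simp
  qed (use h in simp)
  have poly: "poly_op P ?T h \<in> schwartz \<and> ?U (poly_op P ?T h) = poly_op P (dunkl_momentum k) (?U h)" if h: "h \<in> schwartz" for h
  proof -
    have "?U (poly_op P ?T h) x = poly_op P (dunkl_momentum k) (?U h) x" for x
    proof -
      have "?U (poly_op P ?T h) x = (\<Sum>j\<le>degree P. coeff P j * ?U ((?T ^^ j) h) x)"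
        unfolding poly_op_def sum_distrib_left by (simp only: mult.left_commute)
      also have "\<dots> = poly_op P (dunkl_momentum k) (?U h) x"
        unfolding poly_op_def using fun_cong[OF conjunct2[OF Tpow[OF h]], where x = x] by simp
      finally show ?thesis .
    qed
    then have e: "?U (poly_op P ?T h) = poly_op P (dunkl_momentum k) (?U h)" by (rule ext)
    have "poly_op P (dunkl_momentum k) (?U h) \<in> schwartz" by (intro poly_op_schwartz chirp_schwartz h)
    then show ?thesis using e unchirp[of "poly_op P ?T h"] by simp
  qed
  have "(poly_op P ?T ^^ n) f \<in> schwartz \<and> ?U ((poly_op P ?T ^^ n) f) = (poly_op P (dunkl_momentum k) ^^ n) g" for n
  proof (induction n)
    case (Suc n)
    then show ?case using poly[of "(poly_op P ?T ^^ n) f"] by simp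
  qed (use assms(6) in \<open>simp add: g_def\<close>)
  then have u: "norm ((poly_op P ?T ^^ n) f x) = norm ((poly_op P (dunkl_momentum k) ^^ n) g x)" for n x
    by (metis (no_types, lifting) mult_1 norm_chirp norm_mult)
  have Lp: "Lp_norm k p ((poly_op P ?T ^^ n) f) = Lp_norm k p ((poly_op P (dunkl_momentum k) ^^ n) g)" for n
    unfolding Lp_norm_def u ..
  have tr: "lc_dunkl_transform k M f \<xi> = 0 \<longleftrightarrow> dunkl_transform k g (\<xi> / b) = 0" for \<xi>
  proof -
    let ?c = "exp (\<i> / 2 * of_real (M $ 2 $ 2 / b * \<xi>\<^sup>2))"
    have "f x * lc_dunkl_kernel k M \<xi> x = ?c * (g x * dunkl_exp k (- (\<xi> / b * x)))" for x
    proof -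
      have "exp (\<i> / 2 * of_real (M $ 2 $ 2 / b * \<xi>\<^sup>2 + a / b * x\<^sup>2)) = ?c * chirp (a / b / 2) x"
        by (simp add: chirp_def exp_add[symmetric] algebra_simps)
      then show ?thesis
        by (simp add: lc_dunkl_kernel_def dunkl_kernel_eq g_def flip: a_def b_def)
    qed
    then have "lc_dunkl_transform k M f \<xi> = 1 / (\<i> * of_real b) powr of_real (k + 1) * (?c * dunkl_transform k g (\<xi> / b))"
      by (simp add: lc_dunkl_transform_def dunkl_transform_def flip: b_def)
    moreover have "(\<i> * of_real b) powr of_real (k + 1) \<noteq> (0 :: complex)" using b by (simp add: powr_def)
    ultimately show ?thesis by simp
  qed
  have "(\<forall>\<xi>. \<xi> \<notin> Omega P b \<longrightarrow> lc_dunkl_transform k M f \<xi> = 0) \<longleftrightarrow>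
      (\<forall>\<xi>. 1 < norm (poly P (of_real \<xi>)) \<longrightarrow> dunkl_transform k g \<xi> = 0)"
  proof
    assume *: "\<forall>\<xi>. \<xi> \<notin> Omega P b \<longrightarrow> lc_dunkl_transform k M f \<xi> = 0"
    show "\<forall>\<xi>. 1 < norm (poly P (of_real \<xi>)) \<longrightarrow> dunkl_transform k g \<xi> = 0"
    proof (intro allI impI)
      fix \<xi> :: real assume "1 < norm (poly P (of_real \<xi>))"
      then have "b * \<xi> \<notin> Omega P b" using b by (simp add: Omega_def)
      then show "dunkl_transform k g \<xi> = 0" using * tr[of "b * \<xi>"] b by simp
    qed
  qed (auto simp: tr Omega_def not_le)
  also have "\<dots> \<longleftrightarrow> limsup (\<lambda>n. ennreal_rpow (Lp_norm k p ((poly_op P (dunkl_momentum k) ^^ n) g)) (1 / real n)) \<le> 1"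
    using limsup_le_1_of_support[OF k g assms(4,5)] support_of_limsup_le_1[OF k g assms(5)] by blast
  finally show ?thesis unfolding Lp b_def .
qed

end
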